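(* \textsc{Distinct Shortest Walks}$(\mathcal{D},\mathcal{A},s,t)$ can be enumerated with a memoryless algorithm with preprocessing time in $O(|\mathcal{D}|\times|\mathcal{A}|)$ and delay in $O(\lambda\times|\mathcal{A}|)$, where $\lambda$ is the length of a shortest walk from $s$ to $t$ matching $\mathcal{A}$.
   Context: \textsc{Distinct Shortest Walks}: given a database $\mathcal{D}=(\Sigma,V,E,\mathrm{src},\mathrm{tgt},\mathrm{lbl})$ (finite vertex set $V$, finite edge set $E$, source and target maps $E\to V$, labelling $\mathrm{lbl}:E\to 2^\Sigma$; multiple edges with same endpoints allowed), two vertices $s,t$, and a nondeterministic finite automaton $\mathcal{A}=(\Sigma,Q,\Delta,I,F)$ without $\varepsilon$-transitions, enumerate without duplicates all walks from $s$ to $t$ of minimal length among those matching $\mathcal{A}$. A walk $\langle v_0,e_0,\dots,e_{k-1},v_k\rangle$ (with $\mathrm{src}(e_i)=v_i$, $\mathrm{tgt}(e_i)=v_{i+1}$) has length $k$ and labels $\{a_0\cdots a_{k-1}:a_i\in\mathrm{lbl}(e_i)\}$; it matches $\mathcal{A}$ if one of its labels is in $L(\mathcal{A})$. Complexity model: $|\mathcal{D}|=O(|V|+|E|+\sum_e|\mathrm{lbl}(e)|)$, $|\mathcal{A}|=O(|\Sigma|+|Q|+|\Delta|)$; labels have constant size with constant-time equality; each vertex gives in constant time arrays of its incoming and outgoing edges and their sizes; each edge gives in constant time its source, target, label set (browsable in time linear in its size) and its position in the incoming-edge array of its target; for each state $q$ and label $a$ the list $\Delta(q,a)$ is accessible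 in constant time. Preprocessing is the time before the first output; delay is the maximal time between consecutive outputs. An enumeration algorithm is memoryless if the precomputed data structures are never modified during enumeration and the $(i+1)$-th output is computed directly from the $i$-th output and the precomputed data structures. *)

theory Defs
  imports Main
begin

section \<open>Databases, automata, walks\<close>

record ('v, 'e, 'a) database =
  db_alph :: "'a set"
  verts :: "'v set"
  edges :: "'e set"
  src :: "'e \<Rightarrow> 'v"
  tgt :: "'e \<Rightarrow> 'v"
  lbl :: "'e \<Rightarrow> 'a set"

record ('q, 'a) nfa =
  nfa_alph :: "'a set"
  states :: "'q set"
  trans :: "('q \<times> 'a \<times> 'q) set"
  initial :: "'q set"
  final :: "'q set"

definition database :: "('v, 'e, 'a) database \<Rightarrow> bool" where
  "database D \<longleftrightarrow> finite (db_alph D) \<and> finite (verts D) \<and> finite (edges D) \<and>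
     (\<forall>e \<in> edges D. src D e \<in> verts D \<and> tgt D e \<in> verts D \<and> lbl D e \<subseteq> db_alph D)"

definition nfa :: "('q, 'a) nfa \<Rightarrow> bool" where
  "nfa A \<longleftrightarrow> finite (nfa_alph A) \<and> finite (states A) \<and>
     trans A \<subseteq> states A \<times> nfa_alph A \<times> states A \<and>
     initial A \<subseteq> states A \<and> final A \<subseteq> states A"

definition db_size :: "('v, 'e, 'a) database \<Rightarrow> nat" where
  "db_size D = card (verts D) + card (edges D) + (\<Sum>e \<in> edges D. card (lbl D e))"

definition nfa_size :: "('q, 'a) nfa \<Rightarrow> nat" where
  "nfa_size A = card (nfa_alph A) + card (states A) + card (trans A)"

definition lang :: "('q, 'a) nfa \<Rightarrow> 'a list set" where
  "lang A = {w. \<exists>qs. length qs = Suc (length w) \<and> hd qs \<in> initial A \<and> last qs \<in> final A \<and>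
     (\<forall>i < length w. (qs ! i, w ! i, qs ! Suc i) \<in> trans A)}"

text \<open>The walk \<open>\<langle>v\<^sub>0, e\<^sub>0, \<dots>, e\<^sub>k\<^sub>-\<^sub>1, v\<^sub>k\<rangle>\<close> is the pair of its vertex list and its edge list.\<close>

type_synonym ('v, 'e) walk = "'v list \<times> 'e list"

definition walk :: "('v, 'e, 'a) database \<Rightarrow> ('v, 'e) walk \<Rightarrow> bool" where
  "walk D w \<longleftrightarrow> (case w of (vs, es) \<Rightarrow>
     length vs = Suc (length es) \<and> set vs \<subseteq> verts D \<and> set es \<subseteq> edges D \<and>
     (\<forall>i < length es. src D (es ! i) = vs ! i \<and> tgt D (es ! i) = vs ! Suc i))"

definition walk_length :: "('v, 'e) walk \<Rightarrow> nat" where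
  "walk_length w = length (snd w)"

definition walk_labels :: "('v, 'e, 'a) database \<Rightarrow> ('v, 'e) walk \<Rightarrow> 'a list set" where
  "walk_labels D w = {as. length as = length (snd w) \<and>
     (\<forall>i < length as. as ! i \<in> lbl D (snd w ! i))}"

definition matching_walks ::
  "('v, 'e, 'a) database \<Rightarrow> ('q, 'a) nfa \<Rightarrow> 'v \<Rightarrow> 'v \<Rightarrow> ('v, 'e) walk set" where
  "matching_walks D A s t = {w. walk D w \<and> hd (fst w) = s \<and> last (fst w) = t \<and>
     walk_labels D w \<inter> lang A \<noteq> {}}"

text \<open>If there is no matching walk, \<open>shortest_length\<close> is an unspecified number.\<close>

definition shortest_length ::
  "('v, 'e, 'a) database \<Rightarrow> ('q, 'a) nfa \<Rightarrow> 'v \<Rightarrow> 'v \<Rightarrow> nat" where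
  "shortest_length D A s t = (LEAST k. \<exists>w \<in> matching_walks D A s t. walk_length w = k)"

definition distinct_shortest_walks ::
  "('v, 'e, 'a) database \<Rightarrow> ('q, 'a) nfa \<Rightarrow> 'v \<Rightarrow> 'v \<Rightarrow> ('v, 'e) walk set" where
  "distinct_shortest_walks D A s t =
     {w \<in> matching_walks D A s t. walk_length w = shortest_length D A s t}"


section \<open>How an instance is presented to the machine\<close>

text \<open>
  Vertices, edges, labels and states are known to the machine by their positions in
  arbitrary enumerations of the respective sets; adjacency arrays, label lists and
  successor lists may come in any order.
\<close>

record ('v, 'e, 'a, 'q) presentation =
  vert_list :: "'v list"
  edge_list :: "'e list"
  alph_list :: "'a list"
  state_list :: "'q list"
  in_arr :: "'v \<Rightarrow> 'e list"
  out_arr :: "'v \<Rightarrow> 'e list"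
  lbl_list :: "'e \<Rightarrow> 'a list"
  succ_list :: "'q \<Rightarrow> 'a \<Rightarrow> 'q list"
  initial_list :: "'q list"
  final_list :: "'q list"

definition lists_set :: "'x list \<Rightarrow> 'x set \<Rightarrow> bool" where
  "lists_set xs X \<longleftrightarrow> distinct xs \<and> set xs = X"

definition presents ::
  "('v, 'e, 'a, 'q) presentation \<Rightarrow> ('v, 'e, 'a) database \<Rightarrow> ('q, 'a) nfa \<Rightarrow> bool" where
  "presents P D A \<longleftrightarrow>
     lists_set (vert_list P) (verts D) \<and> lists_set (edge_list P) (edges D) \<and>
     lists_set (alph_list P) (db_alph D) \<and> lists_set (state_list P) (states A) \<and>
     (\<forall>v \<in> verts D. lists_set (in_arr P v) {e \<in> edges D. tgt D e = v} \<and>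
                    lists_set (out_arr P v) {e \<in> edges D. src D e = v}) \<and>
     (\<forall>e \<in> edges D. lists_set (lbl_list P e) (lbl D e)) \<and>
     (\<forall>q \<in> states A. \<forall>a \<in> db_alph D. lists_set (succ_list P q a) {q'. (q, a, q') \<in> trans A}) \<and>
     lists_set (initial_list P) (initial A) \<and> lists_set (final_list P) (final A)"

definition pos :: "'x list \<Rightarrow> 'x \<Rightarrow> nat" where
  "pos xs x = (LEAST i. i < length xs \<and> xs ! i = x)"

definition at :: "'x list \<Rightarrow> nat \<Rightarrow> ('x \<Rightarrow> nat) \<Rightarrow> nat" where
  "at xs i f = (if i < length xs then f (xs ! i) else 0)"

datatype query =
    NumVerts | NumEdges | NumLetters | NumStates
  | Source | Target
  | EdgeSrc | EdgeTgt | EdgeInPos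
  | InDeg | InEdge | OutDeg | OutEdge
  | NumLabels | Label
  | NumSuccs | SuccState
  | NumInitial | InitialState | NumFinal | FinalState

text \<open>
  Constant-time accesses to the instance. Every query takes three arguments, of which it
  uses the first ones. \<open>EdgeInPos\<close> is the position of an edge in the array of incoming
  edges of its target.
\<close>

fun instance_input ::
  "('v, 'e, 'a, 'q) presentation \<Rightarrow> ('v, 'e, 'a) database \<Rightarrow> 'v \<Rightarrow> 'v \<Rightarrow>
   query \<Rightarrow> nat \<Rightarrow> nat \<Rightarrow> nat \<Rightarrow> nat" where
  "instance_input P D s t NumVerts _ _ _ = length (vert_list P)"
| "instance_input P D s t NumEdges _ _ _ = length (edge_list P)"
| "instance_input P D s t NumLetters _ _ _ = length (alph_list P)"
| "instance_input P D s t NumStates _ _ _ = length (state_list P)"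
| "instance_input P D s t Source _ _ _ = pos (vert_list P) s"
| "instance_input P D s t Target _ _ _ = pos (vert_list P) t"
| "instance_input P D s t EdgeSrc e _ _ = at (edge_list P) e (\<lambda>x. pos (vert_list P) (src D x))"
| "instance_input P D s t EdgeTgt e _ _ = at (edge_list P) e (\<lambda>x. pos (vert_list P) (tgt D x))"
| "instance_input P D s t EdgeInPos e _ _ = at (edge_list P) e (\<lambda>x. pos (in_arr P (tgt D x)) x)"
| "instance_input P D s t InDeg v _ _ = at (vert_list P) v (\<lambda>x. length (in_arr P x))"
| "instance_input P D s t InEdge v i _ =
     at (vert_list P) v (\<lambda>x. at (in_arr P x) i (pos (edge_list P)))"
| "instance_input P D s t OutDeg v _ _ = at (vert_list P) v (\<lambda>x. length (out_arr P x))"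
| "instance_input P D s t OutEdge v i _ =
     at (vert_list P) v (\<lambda>x. at (out_arr P x) i (pos (edge_list P)))"
| "instance_input P D s t NumLabels e _ _ = at (edge_list P) e (\<lambda>x. length (lbl_list P x))"
| "instance_input P D s t Label e i _ =
     at (edge_list P) e (\<lambda>x. at (lbl_list P x) i (pos (alph_list P)))"
| "instance_input P D s t NumSuccs q a _ =
     at (state_list P) q (\<lambda>x. at (alph_list P) a (\<lambda>y. length (succ_list P x y)))"
| "instance_input P D s t SuccState q a i =
     at (state_list P) q (\<lambda>x. at (alph_list P) a (\<lambda>y. at (succ_list P x y) i (pos (state_list P))))"
| "instance_input P D s t NumInitial _ _ _ = length (initial_list P)"
| "instance_input P D s t InitialState i _ _ = at (initial_list P) i (pos (state_list P))"
| "instance_input P D s t NumFinal _ _ _ = length (final_list P)"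
| "instance_input P D s t FinalState i _ _ = at (final_list P) i (pos (state_list P))"


section \<open>The machine\<close>

text \<open>
  Unit-cost random access machine, programmed in a structured language. A program uses
  finitely many registers and finitely many two-dimensional tables, all of which initially
  contain \<open>0\<close>. The only arithmetic is incrementing and decrementing, so a run of \<open>T\<close> steps
  produces numbers exceeding those of the input by \<open>O(T)\<close> only, and a unit-time table access
  \<open>(i, j)\<close> is an access to an address of two machine words.
  \<open>Data\<close> tables are meant to hold the precomputed data structures.
\<close>

datatype aexp =
    Const nat
  | Reg nat
  | Inc aexp
  | Dec aexp
  | Input query aexp aexp aexp
  | Data nat aexp aexp
  | Work nat aexp aexp

datatype bexp = Eq aexp aexp | Lt aexp aexp | Neg bexp | Conj bexp bexp

datatype com =
    Skip
  | Assign nat aexp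
  | StoreData nat aexp aexp aexp
  | StoreWork nat aexp aexp aexp
  | Seq com com
  | Cond bexp com com
  | While bexp com

record state =
  reg :: "nat \<Rightarrow> nat"
  data :: "nat \<Rightarrow> nat \<Rightarrow> nat \<Rightarrow> nat"
  work :: "nat \<Rightarrow> nat \<Rightarrow> nat \<Rightarrow> nat"

definition init_state :: state where
  "init_state = \<lparr>reg = \<lambda>_. 0, data = \<lambda>_ _ _. 0, work = \<lambda>_ _ _. 0\<rparr>"

type_synonym input = "query \<Rightarrow> nat \<Rightarrow> nat \<Rightarrow> nat \<Rightarrow> nat"

primrec aval :: "input \<Rightarrow> state \<Rightarrow> aexp \<Rightarrow> nat" where
  "aval I \<sigma> (Const n) = n"
| "aval I \<sigma> (Reg r) = reg \<sigma> r"
| "aval I \<sigma> (Inc a) = Suc (aval I \<sigma> a)"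
| "aval I \<sigma> (Dec a) = aval I \<sigma> a - 1"
| "aval I \<sigma> (Input x a b c) = I x (aval I \<sigma> a) (aval I \<sigma> b) (aval I \<sigma> c)"
| "aval I \<sigma> (Data k a b) = data \<sigma> k (aval I \<sigma> a) (aval I \<sigma> b)"
| "aval I \<sigma> (Work k a b) = work \<sigma> k (aval I \<sigma> a) (aval I \<sigma> b)"

primrec bval :: "input \<Rightarrow> state \<Rightarrow> bexp \<Rightarrow> bool" where
  "bval I \<sigma> (Eq a b) \<longleftrightarrow> aval I \<sigma> a = aval I \<sigma> b"
| "bval I \<sigma> (Lt a b) \<longleftrightarrow> aval I \<sigma> a < aval I \<sigma> b"
| "bval I \<sigma> (Neg b) \<longleftrightarrow> \<not> bval I \<sigma> b"
| "bval I \<sigma> (Conj b c) \<longleftrightarrow> bval I \<sigma> b \<and> bval I \<sigma> c"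

definition upd :: "(nat \<Rightarrow> nat \<Rightarrow> nat \<Rightarrow> nat) \<Rightarrow> nat \<Rightarrow> nat \<Rightarrow> nat \<Rightarrow> nat \<Rightarrow> (nat \<Rightarrow> nat \<Rightarrow> nat \<Rightarrow> nat)" where
  "upd m k i j x = m(k := (m k)(i := (m k i)(j := x)))"

text \<open>
  \<open>run I c \<sigma> T \<sigma>'\<close>: on input \<open>I\<close>, program \<open>c\<close> started in \<open>\<sigma>\<close> stops in \<open>\<sigma>'\<close> after
  \<open>T\<close> steps. The expressions of a fixed program have bounded size, so evaluating one
  counts as one step.
\<close>

inductive run :: "input \<Rightarrow> com \<Rightarrow> state \<Rightarrow> nat \<Rightarrow> state \<Rightarrow> bool" for I :: input where
  Skip: "run I Skip \<sigma> 1 \<sigma>"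
| Assign: "run I (Assign r a) \<sigma> 1 (\<sigma>\<lparr>reg := (reg \<sigma>)(r := aval I \<sigma> a)\<rparr>)"
| StoreData: "run I (StoreData k a b c) \<sigma> 1
    (\<sigma>\<lparr>data := upd (data \<sigma>) k (aval I \<sigma> a) (aval I \<sigma> b) (aval I \<sigma> c)\<rparr>)"
| StoreWork: "run I (StoreWork k a b c) \<sigma> 1
    (\<sigma>\<lparr>work := upd (work \<sigma>) k (aval I \<sigma> a) (aval I \<sigma> b) (aval I \<sigma> c)\<rparr>)"
| Seq: "run I c \<sigma> T \<sigma>' \<Longrightarrow> run I d \<sigma>' U \<sigma>'' \<Longrightarrow> run I (Seq c d) \<sigma> (T + U) \<sigma>''"
| CondTrue: "bval I \<sigma> b \<Longrightarrow> run I c \<sigma> T \<sigma>' \<Longrightarrow> run I (Cond b c d) \<sigma> (Suc T) \<sigma>'"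
| CondFalse: "\<not> bval I \<sigma> b \<Longrightarrow> run I d \<sigma> T \<sigma>' \<Longrightarrow> run I (Cond b c d) \<sigma> (Suc T) \<sigma>'"
| WhileTrue: "bval I \<sigma> b \<Longrightarrow> run I c \<sigma> T \<sigma>' \<Longrightarrow> run I (While b c) \<sigma>' U \<sigma>'' \<Longrightarrow>
    run I (While b c) \<sigma> (Suc (T + U)) \<sigma>''"
| WhileFalse: "\<not> bval I \<sigma> b \<Longrightarrow> run I (While b c) \<sigma> 1 \<sigma>"

primrec preserves_data :: "com \<Rightarrow> bool" where
  "preserves_data Skip \<longleftrightarrow> True"
| "preserves_data (Assign r a) \<longleftrightarrow> True"
| "preserves_data (StoreData k a b c) \<longleftrightarrow> False"
| "preserves_data (StoreWork k a b c) \<longleftrightarrow> True"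
| "preserves_data (Seq c d) \<longleftrightarrow> preserves_data c \<and> preserves_data d"
| "preserves_data (Cond b c d) \<longleftrightarrow> preserves_data c \<and> preserves_data d"
| "preserves_data (While b c) \<longleftrightarrow> preserves_data c"

lemma run_deterministic:
  "run I c \<sigma> T \<sigma>' \<Longrightarrow> run I c \<sigma> U \<sigma>'' \<Longrightarrow> U = T \<and> \<sigma>'' = \<sigma>'"
proof (induction arbitrary: U \<sigma>'' rule: run.induct)
  case (Seq c \<sigma> T \<sigma>' d V \<sigma>2)
  from Seq.prems show ?case by cases (use Seq.IH in blast)
next
  case (CondTrue \<sigma> b c T \<sigma>' d)
  from CondTrue.prems show ?case by cases (use CondTrue in blast)+
next
  case (CondFalse \<sigma> b d T \<sigma>' c)
  from CondFalse.prems show ?case by cases (use CondFalse in blast)+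
next
  case (WhileTrue \<sigma> b c T \<sigma>' V \<sigma>2)
  from WhileTrue.prems show ?case by cases (use WhileTrue in blast)+
qed (auto elim: run.cases)

lemma preserves_data_run: "run I c \<sigma> T \<sigma>' \<Longrightarrow> preserves_data c \<Longrightarrow> data \<sigma>' = data \<sigma>"
  by (induction rule: run.induct) auto


section \<open>Memoryless enumeration\<close>

text \<open>
  Output convention. When a program stops, register 0 contains \<open>0\<close> if there is no (further)
  output. Otherwise it contains \<open>k + 1\<close>, where \<open>k\<close> is the length of the walk that is output,
  and rows 0 and 1 of \<open>Work\<close> table 0 contain its vertices and its edges.
\<close>

definition no_output :: "state \<Rightarrow> bool" where
  "no_output \<sigma> \<longleftrightarrow> reg \<sigma> 0 = 0"

definition outputs ::
  "('v, 'e, 'a, 'q) presentation \<Rightarrow> state \<Rightarrow> ('v, 'e) walk \<Rightarrow> bool" where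
  "outputs P \<sigma> w \<longleftrightarrow> (case w of (vs, es) \<Rightarrow> reg \<sigma> 0 = Suc (length es) \<and>
     (\<forall>i < length vs. work \<sigma> 0 0 i = pos (vert_list P) (vs ! i)) \<and>
     (\<forall>i < length es. work \<sigma> 0 1 i = pos (edge_list P) (es ! i)))"

text \<open>
  A memoryless enumeration algorithm is a pair of programs. \<open>pre\<close> runs until the first output,
  within the preprocessing time. \<open>nxt\<close> never modifies the \<open>Data\<close> tables and is run once for
  each further output, and a last time to detect the end of the enumeration; each of these runs
  respects the delay. That \<open>nxt\<close> works directly from the previous output and the
  precomputed data is expressed by quantifying over all states \<open>\<sigma>\<close> that agree on these two:
  the rest of the memory, whose contents are arbitrary, cannot transmit information from one
  run to the next, and initialising it is part of the delay.

  A bound \<open>O(f)\<close> on a number of steps is to be instantiated with \<open>C * (f + 1)\<close>, as \<open>f\<close> may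
  be \<open>0\<close> and a run takes at least one step. For \<open>f > 0\<close> this is at most \<open>2 * C * f\<close>. The
  bound \<open>f = \<lambda> * nfa_size A\<close> is \<open>0\<close> only if \<open>\<lambda> = 0\<close> (given a matching walk); then there is just
  one output, and the only run of \<open>nxt\<close> is the one that detects the end.
\<close>

definition memoryless_enumeration ::
  "input \<Rightarrow> (state \<Rightarrow> 'w \<Rightarrow> bool) \<Rightarrow> com \<Rightarrow> com \<Rightarrow> 'w set \<Rightarrow> nat \<Rightarrow> nat \<Rightarrow> bool" where
  "memoryless_enumeration I out pre nxt W prep_time delay \<longleftrightarrow>
     preserves_data nxt \<and>
     (\<exists>ws. distinct ws \<and> set ws = W \<and>
       (\<exists>T \<sigma>\<^sub>0. run I pre init_state T \<sigma>\<^sub>0 \<and> T \<le> prep_time \<and>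
          (if ws = [] then no_output \<sigma>\<^sub>0 else out \<sigma>\<^sub>0 (hd ws)) \<and>
          (\<forall>i < length ws. \<forall>\<sigma>. data \<sigma> = data \<sigma>\<^sub>0 \<and> out \<sigma> (ws ! i) \<longrightarrow>
             (\<exists>U \<sigma>'. run I nxt \<sigma> U \<sigma>' \<and> U \<le> delay \<and>
                (if Suc i < length ws then out \<sigma>' (ws ! Suc i) else no_output \<sigma>')))))"

end

theory Submission
  imports Defs
begin

text \<open>
  A breadth-first search in the product of \<open>D\<close> and \<open>A\<close> labels every reachable pair \<open>(v, q)\<close> with its
  distance. A shortest walk is built backwards from \<open>t\<close>: the edges chosen so far determine the
  current vertex \<open>v\<close> and the set \<open>S\<close> of all states \<open>q\<close> such that \<open>(v, q)\<close> lies on a shortest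
  accepting run through them, and an edge may be chosen next iff it yields a nonempty set. As all pairs
  \<open>(v, q)\<close> with \<open>q\<close> in \<open>S\<close> have the same distance, each branch of this tree ends in a
  walk, and distinct branches are distinct walks however many runs they have. Precomputed
  lists of tight transitions per edge, and for every edge and state the position of the next usable
  edge at the same vertex, make each level of the tree cost \<open>O(|A|)\<close>. The successor of a walk
  is found by recomputing the sets along it, remembering the last vertex with an untried usable edge, and
  descending from there.

  The leftmost branch would cost \<open>O(\<lambda> |A|)\<close>, which is not bounded by
  \<open>O(|D| |A|)\<close>. The first output is instead read off parent pointers in \<open>O(\<lambda>)\<close> steps, and
  the tree is traversed cyclically from there until that walk, which is stored, comes up again.
\<close>


section \<open>A logic for time-bounded total correctness\<close>

text \<open>Two bounds shape the constructions. The delay must not depend on the size of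
  \<open>D\<close>, so incoming arrays are never scanned during the enumeration. A set
  \<open>S\<close> of states can use an edge iff one of its members can; hence the next usable edge
  for \<open>S\<close> is the minimum, over \<open>q\<close> in \<open>S\<close>, of the next usable
  edge for \<open>q\<close> alone, and a table indexed by edges and single states serves all of the
  exponentially many possible sets. Crossing an edge costs a constant per state and per transition
  of \<open>A\<close>, because the labels of an edge are distinct. In the preprocessing, \<lambda>
  can be of order |V| * |Q|, so a descent that handles a set of states at each of \<lambda> levels
  may cost |V| * |Q| * |A|, too much by a factor |Q|; \<lambda> pointer steps stay within |V| * |Q|.
  Distances are not defined as minima over paths. The labels are characterised by local conditions,
  and minimality is derived from these. As \<open>nxt_prog\<close> starts with arbitrary registers
  and work tables, every row that holds a set of states is cleared before it is filled.\<close>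

definition triple :: "input \<Rightarrow> state \<Rightarrow> com \<Rightarrow> nat \<Rightarrow> (state \<Rightarrow> bool) \<Rightarrow> bool" where
  "triple I \<sigma> c t Q \<longleftrightarrow> (\<exists>T \<sigma>'. run I c \<sigma> T \<sigma>' \<and> T \<le> t \<and> Q \<sigma>')"

primrec reg_mods :: "com \<Rightarrow> nat set" where
  "reg_mods Skip = {}"
| "reg_mods (Assign r a) = {r}"
| "reg_mods (StoreData k a b c) = {}"
| "reg_mods (StoreWork k a b c) = {}"
| "reg_mods (Seq c d) = reg_mods c \<union> reg_mods d"
| "reg_mods (Cond b c d) = reg_mods c \<union> reg_mods d"
| "reg_mods (While b c) = reg_mods c"

primrec data_mods :: "com \<Rightarrow> nat set" where
  "data_mods Skip = {}"
| "data_mods (Assign r a) = {}"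
| "data_mods (StoreData k a b c) = {k}"
| "data_mods (StoreWork k a b c) = {}"
| "data_mods (Seq c d) = data_mods c \<union> data_mods d"
| "data_mods (Cond b c d) = data_mods c \<union> data_mods d"
| "data_mods (While b c) = data_mods c"

primrec work_mods :: "com \<Rightarrow> nat set" where
  "work_mods Skip = {}"
| "work_mods (Assign r a) = {}"
| "work_mods (StoreData k a b c) = {}"
| "work_mods (StoreWork k a b c) = {k}"
| "work_mods (Seq c d) = work_mods c \<union> work_mods d"
| "work_mods (Cond b c d) = work_mods c \<union> work_mods d"
| "work_mods (While b c) = work_mods c"

text \<open>Frame condition read off the syntax. The rules below supply it for free, so invariants
  need not list what a program leaves alone. Its grain is a whole register or table;
  \<open>stable\<close> refines it to a single row.\<close>

definition agree :: "com \<Rightarrow> state \<Rightarrow> state \<Rightarrow> bool" where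
  "agree c \<sigma> \<tau> \<longleftrightarrow> (\<forall>r. r \<notin> reg_mods c \<longrightarrow> reg \<tau> r = reg \<sigma> r) \<and>
     (\<forall>k. k \<notin> data_mods c \<longrightarrow> data \<tau> k = data \<sigma> k) \<and>
     (\<forall>k. k \<notin> work_mods c \<longrightarrow> work \<tau> k = work \<sigma> k)"

lemma agree_refl [simp]: "agree c \<sigma> \<sigma>"
  by (simp add: agree_def)

lemma agree_trans: "agree c \<sigma> \<tau> \<Longrightarrow> agree c \<tau> \<rho> \<Longrightarrow> agree c \<sigma> \<rho>"
  by (simp add: agree_def)

lemma run_agree: "run I c \<sigma> T \<tau> \<Longrightarrow> agree c \<sigma> \<tau>"
  by (induction rule: run.induct) (auto simp: agree_def upd_def)

lemma triple_mono:
  "triple I \<sigma> c t Q \<Longrightarrow> t \<le> t' \<Longrightarrow> (\<And>\<tau>. agree c \<sigma> \<tau> \<Longrightarrow> Q \<tau> \<Longrightarrow> Q' \<tau>) \<Longrightarrow> triple I \<sigma> c t' Q'"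
  unfolding triple_def by (meson le_trans run_agree)

lemma triple_Seq:
  assumes "triple I \<sigma> c t R"
    and "\<And>\<tau>. R \<tau> \<Longrightarrow> agree c \<sigma> \<tau> \<Longrightarrow> triple I \<tau> d u Q"
    and "t + u \<le> v"
  shows "triple I \<sigma> (Seq c d) v Q"
proof -
  obtain T \<tau> where c: "run I c \<sigma> T \<tau>" "T \<le> t" "R \<tau>"
    using assms(1) by (auto simp: triple_def)
  with assms(2) run_agree obtain U \<rho> where "run I d \<tau> U \<rho>" "U \<le> u" "Q \<rho>"
    unfolding triple_def by blast
  with c run.Seq assms(3) show ?thesis
    unfolding triple_def by (meson add_mono le_trans)
qed

lemma triple_Cond:
  assumes "bval I \<sigma> b \<Longrightarrow> triple I \<sigma> c t Q" and "\<not> bval I \<sigma> b \<Longrightarrow> triple I \<sigma> d t Q"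
    and "Suc t \<le> u"
  shows "triple I \<sigma> (Cond b c d) u Q"
proof (cases "bval I \<sigma> b")
  case True
  then show ?thesis
    using assms(1,3) unfolding triple_def by (meson CondTrue Suc_le_mono le_trans)
next
  case False
  then show ?thesis
    using assms(2,3) unfolding triple_def by (meson CondFalse Suc_le_mono le_trans)
qed

text \<open>The invariant carries the number \<open>m\<close> of steps still affordable. Each
  iteration pays for its test and its \<open>t\<close> steps out of \<open>m\<close>, which makes
  the induction well-founded and allows bodies of varying cost; the extra step is the failing test.
  \<open>\<sigma>\<close> stays the state at loop entry while \<open>\<tau>\<close> moves, so frames
  always refer to the entry.\<close>

lemma triple_While_aux:
  assumes "\<And>m \<tau>. Inv m \<tau> \<Longrightarrow> bval I \<tau> b \<Longrightarrow> agree (While b c) \<sigma> \<tau> \<Longrightarrow>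
      \<exists>t. triple I \<tau> c t (\<lambda>\<tau>'. \<exists>m'. Inv m' \<tau>' \<and> Suc t + m' \<le> m)"
  shows "Inv n \<tau> \<Longrightarrow> agree (While b c) \<sigma> \<tau> \<Longrightarrow>
    triple I \<tau> (While b c) (Suc n) (\<lambda>\<tau>'. (\<exists>m\<le>n. Inv m \<tau>') \<and> \<not> bval I \<tau>' b)"
proof (induction n arbitrary: \<tau> rule: less_induct)
  case (less n)
  show ?case
  proof (cases "bval I \<tau> b")
    case True
    from assms[OF less.prems(1) True less.prems(2)] obtain t T \<tau>' m' where
      r: "run I c \<tau> T \<tau>'" "T \<le> t" "Inv m' \<tau>'" "Suc t + m' \<le> n"
      unfolding triple_def by blast
    then have "agree (While b c) \<tau> \<tau>'"
      using run_agree[OF r(1)] by (simp add: agree_def)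
    with less.prems(2) have "agree (While b c) \<sigma> \<tau>'"
      by (rule agree_trans)
    with less.IH[of m' \<tau>'] r obtain U \<rho> m where
      "run I (While b c) \<tau>' U \<rho>" "U \<le> Suc m'" "m \<le> m'" "Inv m \<rho>" "\<not> bval I \<rho> b"
      unfolding triple_def by fastforce
    with r WhileTrue[OF True r(1)] show ?thesis
      unfolding triple_def
      by (intro exI[of _ "Suc (T + U)"] exI[of _ \<rho>] conjI exI[of _ m]) auto
  next
    case False
    with less.prems show ?thesis
      unfolding triple_def using run.WhileFalse by fastforce
  qed
qed

lemma triple_While:
  assumes "\<And>m \<tau>. Inv m \<tau> \<Longrightarrow> bval I \<tau> b \<Longrightarrow> agree (While b c) \<sigma> \<tau> \<Longrightarrow>
      \<exists>t. triple I \<tau> c t (\<lambda>\<tau>'. \<exists>m'. Inv m' \<tau>' \<and> Suc t + m' \<le> m)"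
    and "Inv n \<sigma>"
  shows "triple I \<sigma> (While b c) (Suc n) (\<lambda>\<tau>'. (\<exists>m\<le>n. Inv m \<tau>') \<and> \<not> bval I \<tau>' b)"
  by (rule triple_While_aux[where \<sigma> = \<sigma>]) (use assms in auto)

section \<open>Loop-free programs by symbolic execution\<close>

primrec straight :: "com \<Rightarrow> bool" where
  "straight Skip = True"
| "straight (Assign r a) = True"
| "straight (StoreData k a b c) = True"
| "straight (StoreWork k a b c) = True"
| "straight (Seq c d) = (straight c \<and> straight d)"
| "straight (Cond b c d) = (straight c \<and> straight d)"
| "straight (While b c) = False"

primrec exec :: "input \<Rightarrow> com \<Rightarrow> state \<Rightarrow> state" where
  "exec I Skip \<sigma> = \<sigma>"
| "exec I (Assign r a) \<sigma> = \<sigma>\<lparr>reg := (reg \<sigma>)(r := aval I \<sigma> a)\<rparr>"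
| "exec I (StoreData k a b c) \<sigma> =
    \<sigma>\<lparr>data := upd (data \<sigma>) k (aval I \<sigma> a) (aval I \<sigma> b) (aval I \<sigma> c)\<rparr>"
| "exec I (StoreWork k a b c) \<sigma> =
    \<sigma>\<lparr>work := upd (work \<sigma>) k (aval I \<sigma> a) (aval I \<sigma> b) (aval I \<sigma> c)\<rparr>"
| "exec I (Seq c d) \<sigma> = exec I d (exec I c \<sigma>)"
| "exec I (Cond b c d) \<sigma> = (if bval I \<sigma> b then exec I c \<sigma> else exec I d \<sigma>)"
| "exec I (While b c) \<sigma> = \<sigma>"

text \<open>An upper bound: a conditional is charged for both branches, which avoids maxima in the
  constants.\<close>

primrec steps :: "com \<Rightarrow> nat" where
  "steps Skip = 1"
| "steps (Assign r a) = 1"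
| "steps (StoreData k a b c) = 1"
| "steps (StoreWork k a b c) = 1"
| "steps (Seq c d) = steps c + steps d"
| "steps (Cond b c d) = Suc (steps c + steps d)"
| "steps (While b c) = 1"

lemma straight_run: "straight c \<Longrightarrow> \<exists>T\<le>steps c. run I c \<sigma> T (exec I c \<sigma>)"
proof (induction c arbitrary: \<sigma>)
  case (Seq c d)
  then obtain T U where "T \<le> steps c" "run I c \<sigma> T (exec I c \<sigma>)" "U \<le> steps d"
    "run I d (exec I c \<sigma>) U (exec I d (exec I c \<sigma>))"
    by (metis straight.simps(5))
  then show ?case
    by (intro exI[of _ "T + U"]) (auto intro: run.Seq)
next
  case (Cond b c d)
  then obtain T U where "T \<le> steps c" "run I c \<sigma> T (exec I c \<sigma>)" "U \<le> steps d"
    "run I d \<sigma> U (exec I d \<sigma>)"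
    by (metis straight.simps(6))
  then show ?case
    using CondTrue[of I \<sigma> b c T _ d] CondFalse[of I \<sigma> b d U _ c]
    by (cases "bval I \<sigma> b") (fastforce intro: exI[of _ "Suc T"] exI[of _ "Suc U"])+
qed (auto intro!: exI[of _ "Suc 0"] intro: run.intros[simplified])

lemma triple_straight:
  "straight c \<Longrightarrow> steps c \<le> t \<Longrightarrow> Q (exec I c \<sigma>) \<Longrightarrow> triple I \<sigma> c t Q"
  unfolding triple_def using straight_run by (meson le_trans)

lemma triple_straight_Seq:
  "straight c \<Longrightarrow> steps c + u \<le> t \<Longrightarrow> triple I (exec I c \<sigma>) d u Q \<Longrightarrow> triple I \<sigma> (Seq c d) t Q"
  by (rule triple_Seq[where R = "\<lambda>\<tau>. \<tau> = exec I c \<sigma>" and t = "steps c"])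
    (auto intro: triple_straight)

abbreviation Seq_syntax (infixr \<open>;;\<close> 60) where "c ;; d \<equiv> Seq c d"

section \<open>Counting loops\<close>

definition For :: "nat \<Rightarrow> aexp \<Rightarrow> com \<Rightarrow> com" where
  "For r b c = Assign r (Const 0) ;; While (Lt (Reg r) b) (c ;; Assign r (Inc (Reg r)))"

lemma For_mods [simp]:
  "reg_mods (For r b c) = insert r (reg_mods c)"
  "data_mods (For r b c) = data_mods c"
  "work_mods (For r b c) = work_mods c"
  "preserves_data (For r b c) = preserves_data c"
  by (auto simp: For_def)

definition set_reg :: "nat \<Rightarrow> nat \<Rightarrow> state \<Rightarrow> state" where
  "set_reg r x \<sigma> = \<sigma>\<lparr>reg := (reg \<sigma>)(r := x)\<rparr>"

lemma set_reg_simps [simp]: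
  "reg (set_reg r x \<sigma>) = (reg \<sigma>)(r := x)"
  "data (set_reg r x \<sigma>) = data \<sigma>"
  "work (set_reg r x \<sigma>) = work \<sigma>"
  by (auto simp: set_reg_def)

text \<open>The bound \<open>b\<close> is evaluated anew at every test, hence the hypothesis that
  invariant and frame fix its value. An iteration pays 2 beyond its body, for the test and the
  increment; the initial 2 are the assignment and the failing test.\<close>

lemma triple_For:
  assumes init: "Inv 0 (set_reg r 0 \<sigma>)"
    and bound: "\<And>i \<tau>. Inv i \<tau> \<Longrightarrow> agree (For r b c) \<sigma> \<tau> \<Longrightarrow> aval I \<tau> b = N"
    and r: "r \<notin> reg_mods c"
    and step: "\<And>i \<tau>. i < N \<Longrightarrow> Inv i \<tau> \<Longrightarrow> reg \<tau> r = i \<Longrightarrow> agree (For r b c) \<sigma> \<tau> \<Longrightarrow>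
       triple I \<tau> c (t i) (\<lambda>\<tau>'. Inv (Suc i) (set_reg r (Suc i) \<tau>'))"
    and time: "2 + (\<Sum>i<N. t i + 2) \<le> u"
  shows "triple I \<sigma> (For r b c) u (\<lambda>\<tau>. Inv N \<tau> \<and> reg \<tau> r = N)"
proof -
  let ?J = "\<lambda>m \<tau>. \<exists>i\<le>N. Inv i \<tau> \<and> reg \<tau> r = i \<and> agree (For r b c) \<sigma> \<tau> \<and> m = (\<Sum>i=i..<N. t i + 2)"
  have "triple I (exec I (Assign r (Const 0)) \<sigma>) (While (Lt (Reg r) b) (c ;; Assign r (Inc (Reg r))))
    (Suc (\<Sum>i<N. t i + 2)) (\<lambda>\<tau>. (\<exists>m\<le>(\<Sum>i<N. t i + 2). ?J m \<tau>) \<and> \<not> bval I \<tau> (Lt (Reg r) b))"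
  proof (rule triple_While, goal_cases)
    case (1 m \<tau>)
    then obtain i where i: "i < N" "Inv i \<tau>" "reg \<tau> r = i" "agree (For r b c) \<sigma> \<tau>"
      "m = (\<Sum>i=i..<N. t i + 2)"
      using bound by auto
    have m: "m = t i + 2 + (\<Sum>i=Suc i..<N. t i + 2)"
      using i by (simp add: sum.atLeast_Suc_lessThan)
    have "triple I \<tau> (c ;; Assign r (Inc (Reg r))) (t i + 1) (\<lambda>\<tau>'. \<exists>m'. ?J m' \<tau>' \<and> Suc (t i + 1) + m' \<le> m)"
    proof (rule triple_Seq[where u = 1, OF step[OF i(1-4)]], goal_cases)
      case (1 \<tau>')
      have a: "reg \<tau>' r = i"
        using 1(2) r i(3) by (simp add: agree_def)
      have ag: "agree (For r b c) \<sigma> (set_reg r (Suc i) \<tau>')"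
        using 1(2) i(4) by (simp add: agree_def)
      have e: "exec I (Assign r (Inc (Reg r))) \<tau>' = set_reg r (Suc i) \<tau>'"
        using a by (simp add: set_reg_def)
      show ?case
      proof (rule triple_straight, goal_cases)
        case 3
        show ?case
          unfolding e using 1 ag i(1) m by (auto intro!: exI[of _ "Suc i"])
      qed auto
    qed simp
    then show ?case
      by blast
  next
    case 2
    show ?case
      using init by (intro exI[of _ 0]) (auto simp: atLeast0LessThan agree_def set_reg_def)
  qed
  then have "triple I (exec I (Assign r (Const 0)) \<sigma>) (While (Lt (Reg r) b) (c ;; Assign r (Inc (Reg r))))
    (Suc (\<Sum>i<N. t i + 2)) (\<lambda>\<tau>. Inv N \<tau> \<and> reg \<tau> r = N)"
  proof (rule triple_mono[where t = "Suc (\<Sum>i<N. t i + 2)"], goal_cases)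
    case (2 \<tau>)
    then obtain i where "i \<le> N" "Inv i \<tau>" "reg \<tau> r = i" "agree (For r b c) \<sigma> \<tau>" "\<not> i < aval I \<tau> b"
      by auto
    moreover from this have "i = N"
      using bound by fastforce
    ultimately show ?case by simp
  qed auto
  then show ?thesis
    unfolding For_def using time by (intro triple_straight_Seq) auto
qed

text \<open>The invariant depends on the list processed so far instead of the counter. Nested loops
  then compose: the lists of the inner loops concatenate to \<open>succs\<close>,
  \<open>arcs\<close> and \<open>children\<close>, which are defined in exactly this form.\<close>

lemma triple_For_concat:
  assumes init: "Inv xs (set_reg r 0 \<sigma>)"
    and bound: "\<And>ys \<tau>. Inv ys \<tau> \<Longrightarrow> agree (For r b c) \<sigma> \<tau> \<Longrightarrow> aval I \<tau> b = N"
    and r: "r \<notin> reg_mods c"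
    and step: "\<And>i ys \<tau>. i < N \<Longrightarrow> Inv ys \<tau> \<Longrightarrow> reg \<tau> r = i \<Longrightarrow> agree (For r b c) \<sigma> \<tau> \<Longrightarrow>
       triple I \<tau> c (t i) (\<lambda>\<tau>'. Inv (ys @ f i) (set_reg r (Suc i) \<tau>'))"
    and time: "2 + (\<Sum>i<N. t i + 2) \<le> u"
  shows "triple I \<sigma> (For r b c) u (\<lambda>\<tau>. Inv (xs @ concat (map f [0..<N])) \<tau>)"
proof -
  have "triple I \<sigma> (For r b c) u
    (\<lambda>\<tau>. Inv (xs @ concat (map f [0..<N])) \<tau> \<and> reg \<tau> r = N)"
    by (rule triple_For[where Inv = "\<lambda>i \<tau>. Inv (xs @ concat (map f [0..<i])) \<tau>" and t = t])
      (use assms in \<open>auto simp flip: append_assoc\<close>)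
  then show ?thesis
    by (rule triple_mono) auto
qed

section \<open>Instances on indices\<close>

locale raw_input =
  fixes I :: input
begin

abbreviation "nV \<equiv> I NumVerts 0 0 0"
abbreviation "nE \<equiv> I NumEdges 0 0 0"
abbreviation "nL \<equiv> I NumLetters 0 0 0"
abbreviation "nQ \<equiv> I NumStates 0 0 0"
abbreviation "sV \<equiv> I Source 0 0 0"
abbreviation "tV \<equiv> I Target 0 0 0"
abbreviation "esrc e \<equiv> I EdgeSrc e 0 0"
abbreviation "etgt e \<equiv> I EdgeTgt e 0 0"
abbreviation "indeg v \<equiv> I InDeg v 0 0"
abbreviation "inedge v i \<equiv> I InEdge v i 0"
abbreviation "outdeg v \<equiv> I OutDeg v 0 0"
abbreviation "outedge v i \<equiv> I OutEdge v i 0"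
abbreviation "nlab e \<equiv> I NumLabels e 0 0"
abbreviation "lab e l \<equiv> I Label e l 0"
abbreviation "nsuc p a \<equiv> I NumSuccs p a 0"
abbreviation "suc p a m \<equiv> I SuccState p a m"
abbreviation "ninit \<equiv> I NumInitial 0 0 0"
abbreviation "ini i \<equiv> I InitialState i 0 0"
abbreviation "nfin \<equiv> I NumFinal 0 0 0"
abbreviation "fin i \<equiv> I FinalState i 0 0"

text \<open>Entries come in the order of the nested loops over labels and successors. A state occurs
  once per label that leads to it, so the length counts loop iterations, not states.\<close>

definition succs :: "nat \<Rightarrow> nat \<Rightarrow> nat list" where
  "succs e p = concat (map (\<lambda>l. map (suc p (lab e l)) [0..<nsuc p (lab e l)]) [0..<nlab e])"

definition arcs :: "nat \<Rightarrow> (nat \<times> nat) list" where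
  "arcs e = concat (map (\<lambda>p. map (Pair p) (succs e p)) [0..<nQ])"

definition children :: "nat \<times> nat \<Rightarrow> (nat \<times> nat) list" where
  "children x = concat (map (\<lambda>j. map (Pair (etgt (outedge (fst x) j))) (succs (outedge (fst x) j) (snd x)))
     [0..<outdeg (fst x)])"

end

text \<open>What a presentation guarantees, with vertices, edges, letters and states replaced by
  numbers. The injectivity assumptions serve the bounds by |A|: no transition is counted twice at an
  edge, and there are at most \<open>nQ\<close> initial and \<open>nQ\<close> final states.\<close>

locale indexed_instance = raw_input +
  assumes sV: "sV < nV" and tV: "tV < nV"
    and esrc: "e < nE \<Longrightarrow> esrc e < nV" and etgt: "e < nE \<Longrightarrow> etgt e < nV"
    and inedge: "v < nV \<Longrightarrow> bij_betw (inedge v) {..<indeg v} {e. e < nE \<and> etgt e = v}"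
    and outedge: "v < nV \<Longrightarrow> bij_betw (outedge v) {..<outdeg v} {e. e < nE \<and> esrc e = v}"
    and lab: "e < nE \<Longrightarrow> l < nlab e \<Longrightarrow> lab e l < nL"
    and inj_lab: "e < nE \<Longrightarrow> inj_on (lab e) {..<nlab e}"
    and suc: "p < nQ \<Longrightarrow> a < nL \<Longrightarrow> m < nsuc p a \<Longrightarrow> suc p a m < nQ"
    and ini: "i < ninit \<Longrightarrow> ini i < nQ" and inj_ini: "inj_on ini {..<ninit}"
    and fin: "i < nfin \<Longrightarrow> fin i < nQ" and inj_fin: "inj_on fin {..<nfin}"
begin

lemma outedge_in: "v < nV \<Longrightarrow> j < outdeg v \<Longrightarrow> outedge v j < nE \<and> esrc (outedge v j) = v"
  using bij_betwE[OF outedge[of v]] by simp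

lemma inedge_in: "v < nV \<Longrightarrow> j < indeg v \<Longrightarrow> inedge v j < nE \<and> etgt (inedge v j) = v"
  using bij_betwE[OF inedge[of v]] by simp

lemma outedge_ex:
  assumes "e < nE"
  obtains j where "j < outdeg (esrc e)" "outedge (esrc e) j = e"
proof -
  have "e \<in> {f. f < nE \<and> esrc f = esrc e}"
    using assms by simp
  also have "\<dots> = outedge (esrc e) ` {..<outdeg (esrc e)}"
    using bij_betw_imp_surj_on[OF outedge[OF esrc[OF assms]]] by (rule sym)
  finally obtain j where "e = outedge (esrc e) j" "j \<in> {..<outdeg (esrc e)}"
    by (rule imageE)
  then show thesis
    using that[of j] by simp
qed

lemma inedge_ex:
  assumes "e < nE"
  obtains j where "j < indeg (etgt e)" "inedge (etgt e) j = e"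
proof -
  have "e \<in> {f. f < nE \<and> etgt f = etgt e}"
    using assms by simp
  also have "\<dots> = inedge (etgt e) ` {..<indeg (etgt e)}"
    using bij_betw_imp_surj_on[OF inedge[OF etgt[OF assms]]] by (rule sym)
  finally obtain j where "e = inedge (etgt e) j" "j \<in> {..<indeg (etgt e)}"
    by (rule imageE)
  then show thesis
    using that[of j] by simp
qed

lemma set_arcs: "(p, q) \<in> set (arcs e) \<longleftrightarrow> p < nQ \<and> q \<in> set (succs e p)"
  by (auto simp: arcs_def)

lemma succs_less: "e < nE \<Longrightarrow> p < nQ \<Longrightarrow> q \<in> set (succs e p) \<Longrightarrow> q < nQ"
  unfolding succs_def using lab[of e] suc[of p] by fastforce

lemma set_children:
  assumes "v < nV"
  shows "(w, q) \<in> set (children (v, p)) \<longleftrightarrow>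
    (\<exists>e<nE. esrc e = v \<and> etgt e = w \<and> q \<in> set (succs e p))" (is "?L \<longleftrightarrow> ?R")
proof
  assume ?L
  then obtain j where "j < outdeg v" "w = etgt (outedge v j)" "q \<in> set (succs (outedge v j) p)"
    by (auto simp: children_def)
  with outedge_in[OF assms] show ?R
    by (intro exI[of _ "outedge v j"]) simp
next
  assume ?R
  then obtain e where e: "e < nE" "esrc e = v" "etgt e = w" "q \<in> set (succs e p)"
    by auto
  obtain j where "j < outdeg (esrc e)" "outedge (esrc e) j = e"
    using outedge_ex[OF e(1)] .
  with e show ?L
    by (auto simp: children_def intro!: bexI[of _ j])
qed

lemma children_less:
  "x \<in> {..<nV} \<times> {..<nQ} \<Longrightarrow> y \<in> set (children x) \<Longrightarrow> y \<in> {..<nV} \<times> {..<nQ}"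
proof -
  assume a: "x \<in> {..<nV} \<times> {..<nQ}" "y \<in> set (children x)"
  then obtain v p w q where xy: "x = (v, p)" "y = (w, q)" "v < nV" "p < nQ"
    by (cases y) auto
  with a(2) obtain e where "e < nE" "etgt e = w" "q \<in> set (succs e p)"
    using set_children[of v w q p] by auto
  then show ?thesis
    using xy etgt[of e] succs_less[of e p q] by auto
qed

end


section \<open>Breadth-first search\<close>

text \<open>A label \<open>d v q\<close> is \<open>0\<close> if \<open>(v, q)\<close> is unreached, and the distance plus one otherwise.\<close>

abbreviation label :: "(nat \<Rightarrow> nat \<Rightarrow> nat) \<Rightarrow> nat \<times> nat \<Rightarrow> nat" where
  "label d x \<equiv> d (fst x) (snd x)"

fun visit :: "nat \<Rightarrow> nat \<times> nat \<Rightarrow> (nat \<Rightarrow> nat \<Rightarrow> nat) \<times> (nat \<times> nat) list \<Rightarrow>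
    (nat \<Rightarrow> nat \<Rightarrow> nat) \<times> (nat \<times> nat) list" where
  "visit k (w, q) (d, xs) = (if d w q = 0 then (d(w := (d w)(q := k)), xs @ [(w, q)]) else (d, xs))"

text \<open>A label is final once its pair is in the queue; facts about expanded pairs therefore
  survive all later steps.\<close>

definition extends :: "(nat \<Rightarrow> nat \<Rightarrow> nat) \<times> (nat \<times> nat) list \<Rightarrow>
    (nat \<Rightarrow> nat \<Rightarrow> nat) \<times> (nat \<times> nat) list \<Rightarrow> bool" where
  "extends s s' \<longleftrightarrow> (\<exists>zs. snd s' = snd s @ zs) \<and>
     (\<forall>z\<in>set (snd s). label (fst s') z = label (fst s) z)"

lemma extends_refl: "extends s s"
  by (simp add: extends_def)

lemma extends_trans:
  assumes "extends s s'" "extends s' s''"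
  shows "extends s s''"
proof -
  obtain zs zs' where zs: "snd s' = snd s @ zs" "snd s'' = snd s' @ zs'"
    using assms by (auto simp: extends_def)
  have "label (fst s'') z = label (fst s) z" if "z \<in> set (snd s)" for z
  proof -
    have "z \<in> set (snd s')"
      using that zs by simp
    with that assms show ?thesis
      unfolding extends_def by metis
  qed
  with zs show ?thesis
    by (simp add: extends_def)
qed

context indexed_instance
begin

text \<open>Correctness of labels is expressed locally: 1 exactly at the initial pairs, and every
  larger label is explained by a predecessor whose label is smaller by one.\<close>

definition queue_inv :: "(nat \<Rightarrow> nat \<Rightarrow> nat) \<Rightarrow> (nat \<times> nat) list \<Rightarrow> bool" where
  "queue_inv d xs \<longleftrightarrow> set xs = {x. label d x \<noteq> 0} \<and> distinct xs \<and>
     set xs \<subseteq> {..<nV} \<times> {..<nQ} \<and> sorted (map (label d) xs) \<and>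
     (\<forall>x. label d x = 1 \<longleftrightarrow> x \<in> {sV} \<times> ini ` {..<ninit}) \<and>
     (\<forall>y. label d y > 1 \<longrightarrow> (\<exists>x. y \<in> set (children x) \<and> label d y = Suc (label d x) \<and> label d x \<noteq> 0))"

text \<open>\<open>h\<close> is the head of the queue, and the pairs before it are expanded. From
  the head on only two consecutive labels occur, which is why appending the larger one keeps the
  queue sorted.\<close>

definition bfs_inv :: "nat \<Rightarrow> (nat \<Rightarrow> nat \<Rightarrow> nat) \<Rightarrow> (nat \<times> nat) list \<Rightarrow> bool" where
  "bfs_inv h d xs \<longleftrightarrow> queue_inv d xs \<and> h \<le> length xs \<and>
     (h < length xs \<longrightarrow> (\<forall>y\<in>set xs. label d y \<le> Suc (label d (xs ! h)))) \<and>
     (\<forall>i<h. \<forall>y\<in>set (children (xs ! i)). label d y \<noteq> 0 \<and> label d y \<le> Suc (label d (xs ! i)))"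

text \<open>\<open>Suc (label d x)\<close> is at least every label in the queue, so appending
  preserves the order. It is not 1, so the initial pairs stay as they are. Predecessors already
  recorded have nonzero labels, so none of them is the pair that is relabelled.\<close>

lemma visit_step:
  assumes inv: "queue_inv d xs" and x: "x \<in> set xs" and y: "y \<in> set (children x)"
    and le: "\<forall>z\<in>set xs. label d z \<le> Suc (label d x)"
    and s: "visit (Suc (label d x)) y (d, xs) = (d', xs')"
  shows "queue_inv d' xs' \<and> extends (d, xs) (d', xs') \<and> (\<forall>z\<in>set xs'. label d' z \<le> Suc (label d' x)) \<and>
    label d' y \<noteq> 0"
proof (cases "label d y = 0")
  case False
  then show ?thesis
    using assms by (cases y) (auto simp: extends_refl)
next
  case True
  obtain w q where [simp]: "y = (w, q)" by (cases y)
  have s': "d' = d(w := (d w)(q := Suc (label d x)))" "xs' = xs @ [y]"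
    using True s by auto
  have L: "label d' z = (if z = y then Suc (label d x) else label d z)" for z
    by (cases z) (auto simp: s')
  have x0: "label d x \<noteq> 0" "x \<in> {..<nV} \<times> {..<nQ}" and y_notin: "y \<notin> set xs" and xy: "x \<noteq> y"
    using inv x True by (auto simp: queue_inv_def)
  have one: "label d z = 1 \<longleftrightarrow> z \<in> {sV} \<times> ini ` {..<ninit}"
    and pred: "label d z > 1 \<longrightarrow> (\<exists>x. z \<in> set (children x) \<and> label d z = Suc (label d x) \<and> label d x \<noteq> 0)"
    for z
    using inv unfolding queue_inv_def by blast+
  have "queue_inv d' xs'"
    unfolding queue_inv_def
  proof (intro conjI allI impI)
    show "set xs' = {x. label d' x \<noteq> 0}"
      using inv by (auto simp: L s'(2) queue_inv_def)
    show "distinct xs'"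
      using inv y_notin by (auto simp: s'(2) queue_inv_def)
    show "set xs' \<subseteq> {..<nV} \<times> {..<nQ}"
      using inv children_less[OF x0(2) y] by (auto simp: s'(2) queue_inv_def)
    have eq: "map (label d') xs' = map (label d) xs @ [Suc (label d x)]"
      unfolding s'(2) using y_notin L by auto
    show "sorted (map (label d') xs')"
      unfolding eq using inv le by (simp add: queue_inv_def sorted_append)
    show "label d' z = 1 \<longleftrightarrow> z \<in> {sV} \<times> ini ` {..<ninit}" for z
    proof (cases "z = y")
      case True
      then show ?thesis
        using x0(1) \<open>label d y = 0\<close> one[of y] unfolding L by simp
    qed (simp only: L one if_False)
    show "\<exists>x. z \<in> set (children x) \<and> label d' z = Suc (label d' x) \<and> label d' x \<noteq> 0"
      if "1 < label d' z" for z
    proof (cases "z = y")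
      case True
      then show ?thesis using y x0(1) xy by (intro exI[of _ x]) (simp only: L if_True if_False simp_thms)
    next
      case False
      then have "1 < label d z"
        using \<open>1 < label d' z\<close> unfolding L by simp
      with pred obtain u where u: "z \<in> set (children u)" "label d z = Suc (label d u)" "label d u \<noteq> 0"
        by blast
      then have "u \<noteq> y"
        using \<open>label d y = 0\<close> by blast
      with u False show ?thesis
        by (intro exI[of _ u]) (simp only: L if_False simp_thms)
    qed
  qed
  moreover have "extends (d, xs) (d', xs')"
    using y_notin L by (auto simp: extends_def s')
  ultimately show ?thesis
    using le xy L by (auto simp: s')
qed

lemma visit_all:
  assumes "queue_inv d xs" "x \<in> set xs" "set ys \<subseteq> set (children x)"
    "\<forall>z\<in>set xs. label d z \<le> Suc (label d x)"
    "fold (visit (Suc (label d x))) ys (d, xs) = (d', xs')"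
  shows "queue_inv d' xs' \<and> extends (d, xs) (d', xs') \<and> (\<forall>z\<in>set xs'. label d' z \<le> Suc (label d' x)) \<and>
    (\<forall>y\<in>set ys. label d' y \<noteq> 0)"
  using assms
proof (induction ys arbitrary: d' xs' rule: rev_induct)
  case Nil
  then show ?case by (auto simp: extends_refl)
next
  case (snoc y ys)
  obtain d1 xs1 where 1: "fold (visit (Suc (label d x))) ys (d, xs) = (d1, xs1)"
    by fastforce
  have IH: "queue_inv d1 xs1" "extends (d, xs) (d1, xs1)" "\<forall>z\<in>set xs1. label d1 z \<le> Suc (label d1 x)"
    "\<forall>y\<in>set ys. label d1 y \<noteq> 0"
    using snoc.IH[OF snoc.prems(1,2) _ snoc.prems(4) 1] snoc.prems(3) by auto
  have x: "x \<in> set xs1" "label d1 x = label d x"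
    using IH(2) snoc.prems(2) by (auto simp: extends_def)
  have v: "visit (Suc (label d1 x)) y (d1, xs1) = (d', xs')"
    using snoc.prems(5) 1 x(2) by simp
  have st: "queue_inv d' xs'" "extends (d1, xs1) (d', xs')" "\<forall>z\<in>set xs'. label d' z \<le> Suc (label d' x)"
    "label d' y \<noteq> 0"
    using visit_step[OF IH(1) x(1) _ IH(3) v] snoc.prems(3) by auto
  have "label d' z \<noteq> 0" if "z \<in> set ys" for z
  proof -
    have "z \<in> set xs1"
      using IH(1,4) that by (auto simp: queue_inv_def)
    then show ?thesis
      using st(2) IH(4) that by (auto simp: extends_def)
  qed
  with st show ?case
    using extends_trans[OF IH(2) st(2)] by auto
qed

lemma bfs_step:
  assumes inv: "bfs_inv h d xs" and h: "h < length xs"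
    and f: "fold (visit (Suc (label d (xs ! h)))) (children (xs ! h)) (d, xs) = (d', xs')"
  shows "bfs_inv (Suc h) d' xs' \<and> extends (d, xs) (d', xs')"
proof -
  let ?x = "xs ! h"
  have all: "queue_inv d' xs'" "extends (d, xs) (d', xs')" "\<forall>z\<in>set xs'. label d' z \<le> Suc (label d' ?x)"
    "\<forall>y\<in>set (children ?x). label d' y \<noteq> 0"
    using visit_all[OF _ _ _ _ f] inv h by (auto simp: bfs_inv_def)
  obtain zs where zs: "xs' = xs @ zs"
    using all(2) by (auto simp: extends_def)
  have same: "xs' ! i = xs ! i" "label d' (xs ! i) = label d (xs ! i)" if "i < length xs" for i
    using that all(2) by (auto simp: nth_append zs extends_def)
  have "\<forall>y\<in>set (children (xs' ! i)). label d' y \<noteq> 0 \<and> label d' y \<le> Suc (label d' (xs' ! i))"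
    if "i < Suc h" for i
  proof (cases "i = h")
    case True
    then show ?thesis
      using all h same by (auto simp: queue_inv_def)
  next
    case False
    then have i: "i < h" "i < length xs" using that h by auto
    have "label d' y = label d y" if "y \<in> set (children (xs ! i))" for y
    proof -
      have "y \<in> set xs"
        using inv i that by (simp add: bfs_inv_def queue_inv_def)
      then show ?thesis
        using all(2) by (auto simp: extends_def)
    qed
    then show ?thesis
      using inv i same by (simp add: bfs_inv_def)
  qed
  moreover have "label d' y \<le> Suc (label d' (xs' ! Suc h))" if "Suc h < length xs'" "y \<in> set xs'" for y
  proof -
    \<comment> \<open>In a sorted queue the next head has a label no smaller than the current one,
      so the bound relative to \<open>xs ! h\<close> carries over to it.\<close>
    have "label d' (xs' ! h) \<le> label d' (xs' ! Suc h)"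
      using all(1) that(1) sorted_nth_mono[of "map (label d') xs'" h "Suc h"]
      by (auto simp: queue_inv_def)
    then show ?thesis
      using all(3) that(2) same[OF h] by fastforce
  qed
  ultimately show ?thesis
    using all h zs by (auto simp: bfs_inv_def)
qed

definition bfs_start :: "(nat \<Rightarrow> nat \<Rightarrow> nat) \<times> (nat \<times> nat) list" where
  "bfs_start = fold (visit 1) (map (Pair sV) (map ini [0..<ninit])) (\<lambda>_ _. 0, [])"

lemma visit_all_unseen:
  "distinct ys \<Longrightarrow> fold (visit 1) (map (Pair v) ys) (\<lambda>_ _. 0, []) =
    (\<lambda>w q. if w = v \<and> q \<in> set ys then 1 else 0, map (Pair v) ys)"
  by (induction ys rule: rev_induct) (auto simp: fun_eq_iff)

lemma bfs_start:
  assumes "bfs_start = (d, xs)"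
  shows "bfs_inv 0 d xs"
proof -
  have dist: "distinct (map ini [0..<ninit])"
    using inj_ini by (simp add: distinct_map atLeast0LessThan)
  have "d = (\<lambda>w q. if w = sV \<and> q \<in> ini ` {..<ninit} then 1 else 0)"
    and s: "xs = map (Pair sV) (map ini [0..<ninit])"
    using assms visit_all_unseen[OF dist, of sV]
    unfolding bfs_start_def set_map set_upt atLeast0LessThan by auto
  have label: "label d x = (if x \<in> {sV} \<times> ini ` {..<ninit} then 1 else 0)" for x
    by (cases x) (simp add: \<open>d = _\<close>)
  have set: "set xs = {sV} \<times> ini ` {..<ninit}"
    unfolding s set_map set_upt atLeast0LessThan by blast
  have "distinct xs"
    unfolding s distinct_map[of "Pair sV"] using dist by (simp add: inj_on_def)
  moreover have "map (label d) xs = map (\<lambda>_. 1) xs"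
    by (rule map_cong[OF refl]) (simp only: set label if_True)
  then have "sorted (map (label d) xs)"
    by (simp add: map_replicate_const)
  moreover have "set xs \<subseteq> {..<nV} \<times> {..<nQ}"
    using sV ini unfolding set by blast
  ultimately have "queue_inv d xs"
    unfolding queue_inv_def by (simp only: set label) (simp split: if_splits)
  have le: "label d y \<le> Suc n" for y n
    by (simp add: label)
  show ?thesis
    unfolding bfs_inv_def using \<open>queue_inv d xs\<close> le by simp
qed

end

text \<open>Local characterisation of shortest distances in the product: \<open>d_step\<close> is
  the triangle inequality together with closure, and \<open>d_pred\<close> says that each label is
  attained. They force a nonzero \<open>d v q\<close> to be the distance from the initial pairs plus
  one. The enumeration is justified from these conditions alone.\<close>

locale distances = indexed_instance +
  fixes d :: "nat \<Rightarrow> nat \<Rightarrow> nat"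
  assumes d_1: "d v q = 1 \<longleftrightarrow> v = sV \<and> q \<in> ini ` {..<ninit}"
    and d_dom: "d v q \<noteq> 0 \<Longrightarrow> v < nV \<and> q < nQ"
    and d_step: "e < nE \<Longrightarrow> (p, q) \<in> set (arcs e) \<Longrightarrow> d (esrc e) p \<noteq> 0 \<Longrightarrow>
      d (etgt e) q \<noteq> 0 \<and> d (etgt e) q \<le> Suc (d (esrc e) p)"
    and d_pred: "1 < d v q \<Longrightarrow> \<exists>e<nE. etgt e = v \<and>
      (\<exists>p. (p, q) \<in> set (arcs e) \<and> d v q = Suc (d (esrc e) p) \<and> d (esrc e) p \<noteq> 0)"

text \<open>With the head at the end of the queue every labelled pair has been expanded, which is
  the closure condition \<open>d_step\<close>.\<close>

lemma (in indexed_instance) bfs_inv_distances: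
  assumes inv: "bfs_inv (length xs) d xs"
  shows "distances I d"
proof (rule distances.intro[OF indexed_instance_axioms], rule distances_axioms.intro)
  have q: "queue_inv d xs"
    using inv unfolding bfs_inv_def by (rule conjunct1)
  note q' = q[unfolded queue_inv_def]
  note q_set = q'[THEN conjunct1]
    and q_sub = q'[THEN conjunct2, THEN conjunct2, THEN conjunct1]
    and q_1 = q'[THEN conjunct2, THEN conjunct2, THEN conjunct2, THEN conjunct2, THEN conjunct1]
    and q_pred = q'[THEN conjunct2, THEN conjunct2, THEN conjunct2, THEN conjunct2, THEN conjunct2]
  note closed = inv[unfolded bfs_inv_def, THEN conjunct2, THEN conjunct2, THEN conjunct2]
  have dom: "v < nV \<and> q < nQ" if "d v q \<noteq> 0" for v q
  proof -
    have "(v, q) \<in> set xs"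
      using that by (simp add: q_set)
    then show ?thesis
      using q_sub by auto
  qed
  then show "d v q \<noteq> 0 \<Longrightarrow> v < nV \<and> q < nQ" for v q .
  show "d v q = 1 \<longleftrightarrow> v = sV \<and> q \<in> ini ` {..<ninit}" for v q
    using q_1[rule_format, of "(v, q)"] by simp
  show "d (etgt e) q \<noteq> 0 \<and> d (etgt e) q \<le> Suc (d (esrc e) p)"
    if "e < nE" "(p, q) \<in> set (arcs e)" "d (esrc e) p \<noteq> 0" for e p q
  proof -
    have "(esrc e, p) \<in> set xs"
      using that(3) by (simp add: q_set)
    then obtain i where i: "i < length xs" "xs ! i = (esrc e, p)"
      by (auto simp: in_set_conv_nth)
    have ch: "(etgt e, q) \<in> set (children (esrc e, p))"
      using that set_children[OF esrc[OF that(1)]] by (auto simp: set_arcs)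
    from closed[rule_format, OF i(1), of "(etgt e, q)"] show ?thesis
      using ch i(2) by simp
  qed
  show "\<exists>e<nE. etgt e = v \<and> (\<exists>p. (p, q) \<in> set (arcs e) \<and> d v q = Suc (d (esrc e) p) \<and> d (esrc e) p \<noteq> 0)"
    if d: "1 < d v q" for v q
  proof -
    from q_pred[rule_format, of "(v, q)"] d
    have "\<exists>x. (v, q) \<in> set (children x) \<and> d v q = Suc (label d x) \<and> label d x \<noteq> 0"
      by simp
    then obtain w p where w: "(v, q) \<in> set (children (w, p))" "d v q = Suc (d w p)" "d w p \<noteq> 0"
      by auto
    from this(3) have wp: "w < nV" "p < nQ"
      using dom[of w p] by auto
    then obtain e where "e < nE" "esrc e = w" "etgt e = v" "q \<in> set (succs e p)"
      using set_children[OF wp(1), of v q p] w(1) by auto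
    with w wp show ?thesis
      by (intro exI[of _ e]) (auto simp: set_arcs)
  qed
qed

section \<open>The tree of shortest walks\<close>

text \<open>Positions are shifted by one so that a table of numbers can use 0 for none.\<close>

definition next_pos :: "(nat \<Rightarrow> bool) \<Rightarrow> nat \<Rightarrow> nat \<Rightarrow> nat" where
  "next_pos P n i = (if \<exists>j. i \<le> j \<and> j < n \<and> P j then Suc (LEAST j. i \<le> j \<and> j < n \<and> P j) else 0)"

lemma next_pos_hit: "i < n \<Longrightarrow> P i \<Longrightarrow> next_pos P n i = Suc i"
  unfolding next_pos_def by (auto intro!: Least_equality)

text \<open>Together with \<open>next_pos_hit\<close> and \<open>next_pos_end\<close> this is the
  recursion from right to left by which the tables are filled.\<close>

lemma next_pos_miss:
  assumes "\<not> P i"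
  shows "next_pos P n i = next_pos P n (Suc i)"
proof -
  have eq: "i \<le> j \<and> j < n \<and> P j \<longleftrightarrow> Suc i \<le> j \<and> j < n \<and> P j" for j
    using assms by (cases "i = j") auto
  show ?thesis
    by (simp only: next_pos_def eq)
qed

lemma next_pos_end: "n \<le> i \<Longrightarrow> next_pos P n i = 0"
  by (auto simp: next_pos_def)

lemma next_pos_zero: "next_pos P n i = 0 \<longleftrightarrow> (\<forall>j. i \<le> j \<and> j < n \<longrightarrow> \<not> P j)"
  by (auto simp: next_pos_def)

lemma next_pos_Suc:
  assumes "next_pos P n i = Suc j"
  shows "i \<le> j" "j < n" "P j"
proof -
  have ex: "\<exists>j. i \<le> j \<and> j < n \<and> P j" and j: "j = (LEAST j. i \<le> j \<and> j < n \<and> P j)"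
    using assms by (auto simp: next_pos_def split: if_splits)
  from LeastI_ex[OF ex] show "i \<le> j" "j < n" "P j"
    by (simp_all add: j)
qed

lemma next_pos_le: "i \<le> j \<Longrightarrow> j < n \<Longrightarrow> P j \<Longrightarrow> next_pos P n i \<noteq> 0 \<and> next_pos P n i \<le> Suc j"
  unfolding next_pos_def by (auto intro: Least_le)

text \<open>\<open>f\<close> maps each element to the following one and the last element to
  \<open>z\<close>. Leaving \<open>z\<close> open allows the chains of neighbouring subtrees to be
  glued together.\<close>

fun links :: "('x \<Rightarrow> 'x option) \<Rightarrow> 'x list \<Rightarrow> 'x option \<Rightarrow> bool" where
  "links f [] z = True"
| "links f [x] z = (f x = z)"
| "links f (x # y # xs) z = (f x = Some y \<and> links f (y # xs) z)"

lemma links_append: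
  "links f xs (if ys = [] then z else Some (hd ys)) \<Longrightarrow> links f ys z \<Longrightarrow> links f (xs @ ys) z"
proof (induction f xs "if ys = [] then z else Some (hd ys)" rule: links.induct)
  case (2 f x)
  then show ?case by (cases ys) auto
qed auto

text \<open>Mirrors the recursion of \<open>next_walk\<close>: stay below the edge \<open>e\<close>
  while the subtree has a successor, and leave it with \<open>z\<close> afterwards.\<close>

lemma links_map_Cons:
  "links f xs None \<Longrightarrow> (\<And>x. x \<in> set xs \<Longrightarrow> g (e # x) = (case f x of Some y \<Rightarrow> Some (e # y) | None \<Rightarrow> z)) \<Longrightarrow>
    links g (map ((#) e) xs) z"
  by (induction f xs "None :: 'a list option" rule: links.induct) auto

lemma links_nth:
  "links f xs None \<Longrightarrow> i < length xs \<Longrightarrow> f (xs ! i) = (if Suc i < length xs then Some (xs ! Suc i) else None)"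
proof (induction f xs "None :: 'a option" arbitrary: i rule: links.induct)
  case (3 f x y xs)
  then show ?case by (cases i) auto
qed auto

text \<open>
  The enumeration may start anywhere in the list if it wraps around at its end: it is over when
  it comes back to its first element.
\<close>

lemma links_rotate:
  assumes "links f ws None" "distinct ws" "w \<in> set ws"
  obtains ws' where "distinct ws'" "set ws' = set ws" "ws' \<noteq> []" "hd ws' = w"
    "\<And>i. i < length ws' \<Longrightarrow> (case f (ws' ! i) of Some x \<Rightarrow> x | None \<Rightarrow> hd ws) = ws' ! (Suc i mod length ws')"
proof -
  obtain n where n: "n < length ws" "ws ! n = w"
    using assms(3) by (auto simp: in_set_conv_nth)
  let ?l = "length ws"
  have ne: "ws \<noteq> []" "0 < ?l"
    using assms(3) n(1) by auto
  have cyc: "(case f (ws ! i) of Some x \<Rightarrow> x | None \<Rightarrow> hd ws) = ws ! (Suc i mod ?l)" if "i < ?l" for i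
  proof (cases "Suc i < ?l")
    case True
    then show ?thesis using links_nth[OF assms(1) that] by simp
  next
    case False
    then have "Suc i = ?l" using that by simp
    then show ?thesis using links_nth[OF assms(1) that] ne by (simp add: hd_conv_nth)
  qed
  show thesis
  proof (rule that[of "rotate n ws"])
    show "hd (rotate n ws) = w"
      using n ne by (simp add: hd_rotate_conv_nth)
    fix i
    assume i: "i < length (rotate n ws)"
    then have "rotate n ws ! i = ws ! ((n + i) mod ?l)"
      by (simp add: nth_rotate)
    moreover have "rotate n ws ! (Suc i mod ?l) = ws ! ((n + Suc i mod ?l) mod ?l)"
      using ne by (simp add: nth_rotate)
    moreover have "(n + Suc i mod ?l) mod ?l = Suc ((n + i) mod ?l) mod ?l"
      by (simp add: mod_simps)
    ultimately show "(case f (rotate n ws ! i) of Some x \<Rightarrow> x | None \<Rightarrow> hd ws) =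
        rotate n ws ! (Suc i mod length (rotate n ws))"
      using cyc[of "(n + i) mod ?l"] ne by simp
  qed (use assms(2) ne in auto)
qed

lemma distinct_concat_map:
  "distinct js \<Longrightarrow> (\<And>j. j \<in> set js \<Longrightarrow> distinct (f j)) \<Longrightarrow>
    (\<And>i j. i \<in> set js \<Longrightarrow> j \<in> set js \<Longrightarrow> i \<noteq> j \<Longrightarrow> set (f i) \<inter> set (f j) = {}) \<Longrightarrow>
    distinct (concat (map f js))"
proof (induction js)
  case (Cons j js)
  have "set (f j) \<inter> set (f i) = {}" if "i \<in> set js" for i
    using Cons.prems(1) that by (intro Cons.prems(3)) auto
  moreover have "distinct (concat (map f js))"
    using Cons.prems by (intro Cons.IH) auto
  ultimately show ?case
    using Cons.prems(2)[of j] by auto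
qed simp

context indexed_instance
begin

text \<open>Edges are listed from \<open>t\<close> to \<open>s\<close>.\<close>

primrec accepted :: "nat list \<Rightarrow> nat \<Rightarrow> nat \<Rightarrow> bool" where
  "accepted [] v q \<longleftrightarrow> v = sV \<and> q \<in> ini ` {..<ninit}"
| "accepted (e # es) v q \<longleftrightarrow> e < nE \<and> etgt e = v \<and> (\<exists>p. (p, q) \<in> set (arcs e) \<and> accepted es (esrc e) p)"

abbreviation finals :: "nat set" where
  "finals \<equiv> fin ` {..<nfin}"

definition matching :: "nat list \<Rightarrow> bool" where
  "matching es \<longleftrightarrow> (\<exists>q\<in>finals. accepted es tV q)"

text \<open>Only the specification speaks of the position of the current edge. The program reaches
  the next usable position through table 7, which is indexed by the edge itself.\<close>

definition ipos :: "nat \<Rightarrow> nat" where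
  "ipos e = (THE i. i < indeg (etgt e) \<and> inedge (etgt e) i = e)"

lemma ipos_inedge:
  assumes "v < nV" "i < indeg v"
  shows "ipos (inedge v i) = i"
proof -
  have v: "etgt (inedge v i) = v"
    using inedge_in[OF assms] by simp
  have "inj_on (inedge v) {..<indeg v}"
    using inedge[OF assms(1)] by (rule bij_betw_imp_inj_on)
  then have "j = i" if "j < indeg v" "inedge v j = inedge v i" for j
    using that assms(2) by (auto dest: inj_onD)
  then show ?thesis
    unfolding ipos_def v using assms(2) by (intro the_equality) auto
qed

end

section \<open>The tree of usable edges and its depth-first order\<close>

context distances
begin

definition pairs :: "nat \<Rightarrow> (nat \<times> nat) list" where
  "pairs e = filter (\<lambda>(p, q). d (esrc e) p \<noteq> 0 \<and> d (etgt e) q = Suc (d (esrc e) p)) (arcs e)"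

text \<open>A backward subset construction along tight transitions. All runs over one edge sequence
  are followed at once, which is what excludes duplicates.\<close>

definition step :: "nat \<Rightarrow> nat set \<Rightarrow> nat set" where
  "step e S = {p. \<exists>q\<in>S. (p, q) \<in> set (pairs e)}"

definition good :: "nat \<Rightarrow> nat set \<Rightarrow> nat \<Rightarrow> bool" where
  "good v S j \<longleftrightarrow> step (inedge v j) S \<noteq> {}"

text \<open>A node of the tree with \<open>k\<close> edges still to come. Labels are distances plus
  one, hence \<open>Suc k\<close>.\<close>

definition live :: "nat \<Rightarrow> nat \<Rightarrow> nat set \<Rightarrow> bool" where
  "live k v S \<longleftrightarrow> v < nV \<and> S \<noteq> {} \<and> (\<forall>q\<in>S. d v q = Suc k)"

text \<open>The leaves below a node in depth-first order. This is a specification: the list can be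
  exponentially long, and the programs only move from one element to the next.\<close>

primrec enum :: "nat \<Rightarrow> nat \<Rightarrow> nat set \<Rightarrow> nat list list" where
  "enum 0 v S = [[]]"
| "enum (Suc k) v S = concat (map (\<lambda>j. if good v S j
     then map ((#) (inedge v j)) (enum k (esrc (inedge v j)) (step (inedge v j) S)) else [])
     [0..<indeg v])"

definition via :: "nat \<Rightarrow> nat \<Rightarrow> nat set \<Rightarrow> nat \<Rightarrow> nat list" where
  "via k v S j = inedge v j # hd (enum k (esrc (inedge v j)) (step (inedge v j) S))"

definition resume :: "nat \<Rightarrow> nat \<Rightarrow> nat set \<Rightarrow> nat \<Rightarrow> nat list option" where
  "resume k v S i = (case next_pos (good v S) (indeg v) i of 0 \<Rightarrow> None | Suc j \<Rightarrow> Some (via k v S j))"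

text \<open>The vertex farthest from \<open>t\<close> with an untried usable edge decides, so the
  rest of the walk is tried before \<open>resume\<close> is called at the present vertex.\<close>

primrec next_walk :: "nat list \<Rightarrow> nat \<Rightarrow> nat set \<Rightarrow> nat list option" where
  "next_walk [] v S = None"
| "next_walk (e # es) v S = (case next_walk es (esrc e) (step e S) of
     Some fs \<Rightarrow> Some (e # fs) | None \<Rightarrow> resume (length es) v S (Suc (ipos e)))"

lemma set_pairs:
  "(p, q) \<in> set (pairs e) \<longleftrightarrow>
    (p, q) \<in> set (arcs e) \<and> d (esrc e) p \<noteq> 0 \<and> d (etgt e) q = Suc (d (esrc e) p)"
  by (auto simp: pairs_def)

lemma pairs_less: "e < nE \<Longrightarrow> (p, q) \<in> set (pairs e) \<Longrightarrow> p < nQ \<and> q < nQ"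
  using d_dom[of "etgt e" q] by (auto simp: set_pairs set_arcs)

lemma live_step:
  assumes "live (Suc k) v S" "e < nE" "etgt e = v" "step e S \<noteq> {}"
  shows "live k (esrc e) (step e S)"
  using assms(1,3,4) esrc[OF assms(2)] by (auto simp: live_def step_def set_pairs)

lemma live_inedge:
  assumes "live (Suc k) v S" "j < indeg v" "good v S j"
  shows "live k (esrc (inedge v j)) (step (inedge v j) S)"
proof (rule live_step[OF assms(1)])
  have "v < nV"
    using assms(1) by (simp add: live_def)
  from inedge_in[OF this assms(2)] show "inedge v j < nE" "etgt (inedge v j) = v"
    by auto
qed (use assms(3) in \<open>simp add: good_def\<close>)

text \<open>By \<open>d_pred\<close> a label above 1 is attained through a tight transition, so the
  tree has no dead ends.\<close>

lemma live_good:
  assumes "live (Suc k) v S"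
  shows "\<exists>j<indeg v. good v S j"
proof -
  obtain q where q: "q \<in> S" "d v q = Suc (Suc k)"
    using assms by (auto simp: live_def)
  then obtain e p where e: "e < nE" "etgt e = v" "(p, q) \<in> set (arcs e)" "d v q = Suc (d (esrc e) p)"
      "d (esrc e) p \<noteq> 0"
    using d_pred[of v q] by auto
  obtain j where j: "j < indeg v" "inedge v j = e"
    using inedge_ex[OF e(1)] e(2) by auto
  have "p \<in> step e S"
    using q(1) e by (auto simp: step_def set_pairs)
  then show ?thesis
    using j by (auto simp: good_def)
qed

lemma enum_nonempty: "live k v S \<Longrightarrow> enum k v S \<noteq> []"
proof (induction k arbitrary: v S)
  case (Suc k)
  obtain j where "j < indeg v" "good v S j"
    using live_good[OF Suc.prems] by auto
  moreover from this have "enum k (esrc (inedge v j)) (step (inedge v j) S) \<noteq> []"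
    by (intro Suc.IH live_inedge[OF Suc.prems])
  ultimately have "inedge v j # hd (enum k (esrc (inedge v j)) (step (inedge v j) S)) \<in> set (enum (Suc k) v S)"
    by (auto intro!: bexI[of _ j])
  then show ?case
    by (metis empty_iff list.set(1))
qed simp

lemma accepted_label: "accepted es v q \<Longrightarrow> d v q \<noteq> 0 \<and> d v q \<le> Suc (length es)"
proof (induction es arbitrary: v q)
  case Nil
  then have "d v q = 1" using d_1 by simp
  then show ?case by simp
next
  case (Cons e es)
  then obtain p where p: "e < nE" "etgt e = v" "(p, q) \<in> set (arcs e)" "accepted es (esrc e) p"
    by auto
  show ?case
    using Cons.IH[OF p(4)] d_step[OF p(1,3)] p(2) by auto
qed

lemma length_enum: "es \<in> set (enum k v S) \<Longrightarrow> length es = k"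
  by (induction k arbitrary: v S es) (auto split: if_splits)

lemma set_enum:
  "live k v S \<Longrightarrow> es \<in> set (enum k v S) \<longleftrightarrow> length es = k \<and> (\<exists>q\<in>S. accepted es v q)"
proof (induction k arbitrary: v S es)
  case 0
  have "accepted [] v q" if "q \<in> S" for q
    using 0 that d_1[of v q] by (simp add: live_def)
  then show ?case
    using 0 by (auto simp: live_def)
next
  case (Suc k)
  have v: "v < nV"
    using Suc.prems by (simp add: live_def)
  show ?case
  proof (cases es)
    case Nil
    then show ?thesis by auto
  next
    case (Cons e fs)
    have IH: "fs \<in> set (enum k (esrc e) (step e S)) \<longleftrightarrow> length fs = k \<and> (\<exists>p\<in>step e S. accepted fs (esrc e) p)"
      if "e < nE" "etgt e = v" "step e S \<noteq> {}"
      using Suc.IH[OF live_step[OF Suc.prems that]] .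
    show ?thesis
    proof
      assume "es \<in> set (enum (Suc k) v S)"
      then obtain j where j: "j < indeg v" "good v S j" "e = inedge v j" "fs \<in> set (enum k (esrc e) (step e S))"
        using Cons by (auto split: if_splits)
      then have e: "e < nE" "etgt e = v" "step e S \<noteq> {}"
        using inedge_in[OF v j(1)] by (auto simp: good_def)
      with IH j(4) obtain p where p: "length fs = k" "p \<in> step e S" "accepted fs (esrc e) p"
        by auto
      then obtain q where "q \<in> S" "(p, q) \<in> set (arcs e)"
        by (auto simp: step_def set_pairs)
      then show "length es = Suc k \<and> (\<exists>q\<in>S. accepted es v q)"
        using p e Cons by (auto intro!: bexI[of _ q] exI[of _ p])
    next
      assume "length es = Suc k \<and> (\<exists>q\<in>S. accepted es v q)"
      then obtain p q where pq: "length fs = k" "q \<in> S" "e < nE" "etgt e = v" "(p, q) \<in> set (arcs e)"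
        "accepted fs (esrc e) p"
        using Cons by auto
      have "d v q = Suc (Suc k)"
        using Suc.prems pq(2) by (simp add: live_def)
      \<comment> \<open>The rest \<open>fs\<close> reaches \<open>(esrc e, p)\<close> with
        \<open>k\<close> edges, so the label there is at most \<open>Suc k\<close>, and
        \<open>d_step\<close> forbids a smaller one: the transition is tight.\<close>
      then have "(p, q) \<in> set (pairs e)"
        using accepted_label[OF pq(6)] d_step[OF pq(3,5)] pq by (auto simp: set_pairs)
      then have p: "p \<in> step e S"
        using pq(2) by (auto simp: step_def)
      then have fs: "fs \<in> set (enum k (esrc e) (step e S))"
        using IH pq by blast
      obtain j where j: "j < indeg v" "inedge v j = e"
        using inedge_ex[OF pq(3)] pq(4) by auto
      then have "good v S j"
        using p by (auto simp: good_def)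
      with j fs Cons show "es \<in> set (enum (Suc k) v S)"
        by (auto intro!: bexI[of _ j])
    qed
  qed
qed

text \<open>Walks below different positions start with different edges, because an incoming array
  lists no edge twice. Below one position the induction hypothesis applies.\<close>

lemma distinct_enum: "live k v S \<Longrightarrow> distinct (enum k v S)"
proof (induction k arbitrary: v S)
  case (Suc k)
  have v: "v < nV"
    using Suc.prems by (simp add: live_def)
  have inj: "inedge v i \<noteq> inedge v j" if "i < indeg v" "j < indeg v" "i \<noteq> j" for i j
    using ipos_inedge[OF v that(1)] ipos_inedge[OF v that(2)] that(3) by auto
  show ?case
    unfolding enum.simps
  proof (rule distinct_concat_map, goal_cases)
    case (2 j)
    then show ?case
      using Suc.IH[OF live_inedge[OF Suc.prems, of j]] by (auto simp: distinct_map)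
  next
    case (3 i j)
    then show ?case
      using inj[of i j] by auto
  qed simp
qed simp

lemma resume_hit: "i < indeg v \<Longrightarrow> good v S i \<Longrightarrow> resume k v S i = Some (via k v S i)"
  by (simp add: resume_def next_pos_hit)

lemma resume_miss: "\<not> good v S i \<Longrightarrow> resume k v S i = resume k v S (Suc i)"
  by (simp add: resume_def next_pos_miss[of "good v S"])

text \<open>Both claims rest on the fact \<open>hd\<close>: the first leaf at positions
  \<open>i\<close> and above is \<open>resume\<close> at \<open>i\<close>. Thus the last leaf below
  one position is linked to the first leaf beyond it.\<close>

lemma links_enum: "live k v S \<Longrightarrow> links (\<lambda>es. next_walk es v S) (enum k v S) None"
  and resume_enum: "live (Suc k) v S \<Longrightarrow> resume k v S 0 = Some (hd (enum (Suc k) v S))"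
proof -
  define F where "F k v S j = (if good v S j
     then map ((#) (inedge v j)) (enum k (esrc (inedge v j)) (step (inedge v j) S)) else [])" for k v S j
  have enum_F: "enum (Suc k) v S = concat (map (F k v S) [0..<indeg v])" for k v S
    by (simp only: enum.simps F_def[abs_def])
  have hd: "resume k v S i = (if concat (map (F k v S) [i..<indeg v]) = [] then None
      else Some (hd (concat (map (F k v S) [i..<indeg v]))))"
    if l: "live (Suc k) v S" and "i \<le> indeg v" for i k v S
    using that(2)
  proof (induction rule: inc_induct)
    case base
    then show ?case by (simp add: resume_def next_pos_end)
  next
    case (step i)
    show ?case
    proof (cases "good v S i")
      case True
      have ne: "enum k (esrc (inedge v i)) (local.step (inedge v i) S) \<noteq> []"
        using enum_nonempty[OF live_inedge[OF l step(2) True]] .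
      then show ?thesis
        using resume_hit[OF step(2) True] step(2) True
        by (simp add: upt_conv_Cons F_def via_def hd_map)
    next
      case False
      then have "F k v S i = []"
        by (simp add: F_def)
      then show ?thesis
        using step.IH step(2) resume_miss[OF False, of k]
        by (simp add: upt_conv_Cons del: concat_eq_Nil_conv)
    qed
  qed
  show "links (\<lambda>es. next_walk es v S) (enum k v S) None" if "live k v S"
    using that
  proof (induction k arbitrary: v S)
    case (Suc k)
    have v: "v < nV"
      using Suc.prems by (simp add: live_def)
    have "links (\<lambda>es. next_walk es v S) (concat (map (F k v S) [i..<indeg v])) None" if "i \<le> indeg v" for i
      using that
    proof (induction rule: inc_induct)
      case (step i)
      let ?e = "inedge v i"
      have "links (\<lambda>es. next_walk es v S) (F k v S i) (resume k v S (Suc i))" if g: "good v S i"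
      proof -
        \<comment> \<open>Leaving the subtree of \<open>?e\<close> means resuming behind
          \<open>i\<close>, as \<open>ipos ?e\<close> is \<open>i\<close>. The leaves all have
          length \<open>k\<close>, which is the level that \<open>next_walk\<close> passes to
          \<open>resume\<close>.\<close>
        have "links (\<lambda>es. next_walk es v S) (map ((#) ?e) (enum k (esrc ?e) (local.step ?e S)))
          (resume k v S (Suc i))"
          by (rule links_map_Cons[OF Suc.IH[OF live_inedge[OF Suc.prems step(2) g]]])
            (simp add: ipos_inedge[OF v step(2)] length_enum split: option.splits)
        then show ?thesis
          using g by (simp add: F_def)
      qed
      moreover have "F k v S i = []" if "\<not> good v S i"
        using that by (simp add: F_def)
      ultimately have "links (\<lambda>es. next_walk es v S) (F k v S i) (resume k v S (Suc i))"
        by (cases "good v S i") auto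
      then have "links (\<lambda>es. next_walk es v S) (F k v S i @ concat (map (F k v S) [Suc i..<indeg v])) None"
        using step.IH step(2) hd[OF Suc.prems, of "Suc i"] by (intro links_append) auto
      then show ?case
        using step(2) by (simp add: upt_conv_Cons)
    qed simp
    from this[of 0] show ?case
      by (simp only: enum_F le0)
  qed simp
  show "resume k v S 0 = Some (hd (enum (Suc k) v S))" if "live (Suc k) v S"
    using hd[OF that, of 0] enum_nonempty[OF that] by (simp only: enum_F le0 if_False)
qed

lemma hd_enum:
  assumes "live (Suc k) v S"
  obtains j where "next_pos (good v S) (indeg v) 0 = Suc j" "j < indeg v" "good v S j"
    "hd (enum (Suc k) v S) = via k v S j"
proof -
  have "resume k v S 0 = Some (hd (enum (Suc k) v S))"
    by (rule resume_enum[OF assms])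
  then obtain j where "next_pos (good v S) (indeg v) 0 = Suc j" "hd (enum (Suc k) v S) = via k v S j"
    by (auto simp: resume_def split: nat.splits)
  with next_pos_Suc[OF this(1)] that show thesis
    by auto
qed

section \<open>The shortest length and the root of the tree\<close>

definition level :: "nat \<Rightarrow> bool" where
  "level l \<longleftrightarrow> (\<exists>q\<in>finals. d tV q = Suc l) \<and> (\<forall>q\<in>finals. d tV q \<noteq> 0 \<longrightarrow> Suc l \<le> d tV q)"

definition roots :: "nat \<Rightarrow> nat set" where
  "roots l = {q\<in>finals. d tV q = Suc l}"

lemma live_roots: "level l \<Longrightarrow> live l tV (roots l)"
  using tV by (auto simp: level_def live_def roots_def)

lemma level_matching: "level l \<Longrightarrow> matching es \<Longrightarrow> l \<le> length es"
proof -
  assume l: "level l" and "matching es"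
  then obtain q where q: "q \<in> finals" "accepted es tV q"
    by (auto simp: matching_def)
  then show "l \<le> length es"
    using accepted_label[OF q(2)] l[unfolded level_def, THEN conjunct2, rule_format, OF q(1)] by simp
qed

text \<open>A run over \<open>l\<close> edges ends at a label of at most \<open>Suc l\<close>, and
  \<open>level\<close> excludes smaller nonzero labels at final pairs. So every matching walk of
  length \<open>l\<close> is accepted from a root state.\<close>

lemma set_enum_roots:
  assumes "level l"
  shows "set (enum l tV (roots l)) = {es. matching es \<and> length es = l}"
proof -
  have "(\<exists>q\<in>roots l. accepted es tV q) \<longleftrightarrow> matching es" if "length es = l" for es
  proof
    assume "matching es"
    then obtain q where q: "q \<in> finals" "accepted es tV q"
      by (auto simp: matching_def)
    moreover have "Suc l \<le> d tV q"
      using accepted_label[OF q(2)] assms[unfolded level_def, THEN conjunct2, rule_format, OF q(1)] by simp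
    ultimately have "d tV q = Suc l"
      using accepted_label[OF q(2)] that by simp
    with q show "\<exists>q\<in>roots l. accepted es tV q"
      by (auto simp: roots_def)
  qed (auto simp: matching_def roots_def)
  then show ?thesis
    unfolding set_eq_iff set_enum[OF live_roots[OF assms]] mem_Collect_eq by blast
qed

lemma not_matching: "\<forall>q\<in>finals. d tV q = 0 \<Longrightarrow> \<not> matching es"
  unfolding matching_def using accepted_label[of es tV] by blast

text \<open>Following predecessors, all labels from \<open>Suc k\<close> down to 1 occur,
  necessarily at different pairs. This bounds \<lambda> and lets the preprocessing pay for the first
  walk.\<close>

lemma label_le:
  assumes "d v q = Suc k"
  shows "Suc k \<le> nV * nQ"
proof -
  have "\<exists>x. label d x = Suc m" if "m \<le> k" for m
    using that
  proof (induction rule: inc_induct)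
    case base
    show ?case
      using assms by (intro exI[of _ "(v, q)"]) simp
  next
    case (step m)
    then obtain w p where "d w p = Suc (Suc m)"
      by auto
    then obtain u r where "d u r = Suc m"
      using d_pred[of w p] by auto
    then show ?case
      by (intro exI[of _ "(u, r)"]) simp
  qed
  moreover have "x \<in> {..<nV} \<times> {..<nQ}" if "label d x = Suc m" for x m
    using d_dom[of "fst x" "snd x"] that by (cases x) auto
  ultimately have "\<exists>x\<in>{..<nV} \<times> {..<nQ}. Suc m = label d x" if "m \<le> k" for m
    using that by metis
  then have sub: "Suc ` {..k} \<subseteq> label d ` ({..<nV} \<times> {..<nQ})"
    by (auto simp only: image_iff atMost_iff)
  have "Suc k = card (Suc ` {..k})"
    by (simp add: card_image)
  also have "\<dots> \<le> card ({..<nV} \<times> {..<nQ})"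
    by (rule surj_card_le[OF _ sub]) simp
  finally show ?thesis
    by simp
qed

text \<open>Turns the recursion of \<open>next_walk\<close> into a loop from \<open>t\<close>
  towards \<open>s\<close>. The value for \<open>None\<close>, initially \<open>z\<close>, is the
  answer known so far; it is replaced whenever the current vertex has a later usable edge.\<close>

lemma scan_step:
  assumes "j < length es"
  shows "(case next_walk (drop j es) v S of Some x \<Rightarrow> take j es @ x | None \<Rightarrow> z) =
    (case next_walk (drop (Suc j) es) (esrc (es ! j)) (step (es ! j) S) of
      Some x \<Rightarrow> take (Suc j) es @ x
    | None \<Rightarrow> (case next_pos (good v S) (indeg v) (Suc (ipos (es ! j))) of
        0 \<Rightarrow> z | Suc i \<Rightarrow> take j es @ via (length es - Suc j) v S i))"
  unfolding Cons_nth_drop_Suc[OF assms, symmetric] take_Suc_conv_app_nth[OF assms]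
  by (simp add: resume_def split: option.splits nat.splits)

end

section \<open>The search program\<close>

abbreviation (input) "rV \<equiv> 2 :: nat"
abbreviation (input) "rP \<equiv> 3 :: nat"
abbreviation (input) "rE \<equiv> 4 :: nat"
abbreviation (input) "rQ \<equiv> 5 :: nat"
abbreviation (input) "rL \<equiv> 6 :: nat"
abbreviation (input) "rA \<equiv> 7 :: nat"
abbreviation (input) "rM \<equiv> 8 :: nat"
abbreviation (input) "rJ \<equiv> 9 :: nat"
abbreviation (input) "rH \<equiv> 10 :: nat"
abbreviation (input) "rT \<equiv> 11 :: nat"
abbreviation (input) "rD \<equiv> 12 :: nat"
abbreviation (input) "rW \<equiv> 13 :: nat"
abbreviation (input) "rI \<equiv> 14 :: nat"
abbreviation (input) "rX \<equiv> 15 :: nat"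
abbreviation (input) "rC \<equiv> 16 :: nat"
abbreviation (input) "rB \<equiv> 17 :: nat"
abbreviation (input) "rN \<equiv> 18 :: nat"

abbreviation "in0 x \<equiv> Input x (Const 0) (Const 0) (Const 0)"
abbreviation "in1 x a \<equiv> Input x a (Const 0) (Const 0)"
abbreviation "in2 x a b \<equiv> Input x a b (Const 0)"

text \<open>The body is a parameter, since both the search and the tabulation of tight transitions
  loop over the successors of a state along an edge.\<close>

definition for_succs :: "com \<Rightarrow> com" where
  "for_succs c = For rL (in1 NumLabels (Reg rE))
     (Assign rA (in2 Label (Reg rE) (Reg rL)) ;;
      For rM (in2 NumSuccs (Reg rP) (Reg rA))
       (Assign rQ (Input SuccState (Reg rP) (Reg rA) (Reg rM)) ;; c))"

lemma for_succs_mods [simp]: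
  "reg_mods (for_succs c) = {rL, rA, rM, rQ} \<union> reg_mods c"
  "data_mods (for_succs c) = data_mods c"
  "work_mods (for_succs c) = work_mods c"
  by (auto simp: for_succs_def)

text \<open>A label costs 5 steps: reading it, 2 for setting up and ending the inner loop, 2 for the
  outer iteration. A successor costs 3 besides \<open>t\<close>. The hypothesis \<open>frame\<close>
  makes the invariant insensitive to the registers of the loops themselves.\<close>

lemma (in raw_input) triple_for_succs:
  assumes inv: "Inv xs \<sigma>"
    and frame: "\<And>ys r x \<tau>. r \<in> {rL, rA, rM, rQ} \<Longrightarrow> Inv ys \<tau> \<Longrightarrow> Inv ys (set_reg r x \<tau>)"
    and mods: "reg_mods c \<inter> {rE, rP, rL, rA, rM, rQ} = {}"
    and e: "reg \<sigma> rE = e" and p: "reg \<sigma> rP = p"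
    and step: "\<And>ys q \<tau>. Inv ys \<tau> \<Longrightarrow> q \<in> set (succs e p) \<Longrightarrow> reg \<tau> rQ = q \<Longrightarrow>
      agree (for_succs c) \<sigma> \<tau> \<Longrightarrow> triple I \<tau> c t (Inv (ys @ [q]))"
    and time: "2 + 5 * nlab e + (t + 3) * length (succs e p) \<le> u"
  shows "triple I \<sigma> (for_succs c) u (Inv (xs @ succs e p))"
  unfolding for_succs_def succs_def
proof (rule triple_For_concat[where N = "nlab e" and t = "\<lambda>l. 3 + (t + 3) * nsuc p (lab e l)"], goal_cases)
  case 1
  show ?case by (rule frame[OF _ inv]) simp
next
  case (2 ys \<tau>)
  then show ?case using e mods by (simp add: agree_def)
next
  case 3
  then show ?case using mods by auto
next
  case (4 l ys \<tau>)
  have ag: "agree (for_succs c) \<sigma> \<tau>"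
    using 4(4) by (simp add: for_succs_def)
  have ep: "reg \<tau> rE = e" "reg \<tau> rP = p"
    using ag e p mods by (auto simp: agree_def)
  let ?a = "lab e l"
  let ?\<rho> = "set_reg rA ?a \<tau>"
  have \<rho>: "exec I (Assign rA (in2 Label (Reg rE) (Reg rL))) \<tau> = ?\<rho>"
    using ep 4(3) by (simp add: set_reg_def)
  show ?case
  proof (rule triple_straight_Seq[where u = "2 + (t + 3) * nsuc p ?a"], unfold \<rho>)
    have "triple I ?\<rho> (For rM (in2 NumSuccs (Reg rP) (Reg rA))
         (Assign rQ (Input SuccState (Reg rP) (Reg rA) (Reg rM)) ;; c)) (2 + (t + 3) * nsuc p ?a)
         (Inv (ys @ concat (map (\<lambda>m. [suc p ?a m]) [0..<nsuc p ?a])))"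
    proof (rule triple_For_concat[where N = "nsuc p ?a" and t = "\<lambda>_. t + 1"], goal_cases)
      case 1
      show ?case using 4(2) by (auto intro!: frame)
    next
      case (2 zs \<rho>)
      then show ?case using ep mods by (simp add: agree_def)
    next
      case 3
      then show ?case using mods by auto
    next
      case (4 m zs \<rho>)
      have regs: "reg \<rho> rE = e" "reg \<rho> rP = p" "reg \<rho> rA = ?a"
        using 4(4) ep mods by (auto simp: agree_def)
      let ?q = "suc p ?a m"
      have \<rho>: "exec I (Assign rQ (Input SuccState (Reg rP) (Reg rA) (Reg rM))) \<rho> = set_reg rQ ?q \<rho>"
        using regs 4(3) by (simp add: set_reg_def)
      have ag': "agree (for_succs c) \<sigma> (set_reg rQ ?q \<rho>)"
        using ag 4(4) by (simp add: agree_def)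
      have q: "?q \<in> set (succs e p)"
        using 4(1) \<open>l < nlab e\<close> by (auto simp: succs_def intro!: bexI[of _ l])
      have "triple I (set_reg rQ ?q \<rho>) c t (Inv (zs @ [?q]))"
        using 4(2) by (intro step[OF _ q _ ag'] frame) auto
      then have "triple I (set_reg rQ ?q \<rho>) c t (\<lambda>\<tau>'. Inv (zs @ [?q]) (set_reg rM (Suc m) \<tau>'))"
        by (rule triple_mono) (auto intro: frame)
      then show ?case
        by (intro triple_straight_Seq[where u = t]) (simp_all add: \<rho> del: exec.simps)
    qed (simp add: algebra_simps)
    then show "triple I ?\<rho> (For rM (in2 NumSuccs (Reg rP) (Reg rA))
         (Assign rQ (Input SuccState (Reg rP) (Reg rA) (Reg rM)) ;; c)) (2 + (t + 3) * nsuc p ?a)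
        (\<lambda>\<tau>'. Inv (ys @ map (suc p ?a) [0..<nsuc p ?a]) (set_reg rL (Suc l) \<tau>'))"
      by (rule triple_mono) (auto simp: concat_map_singleton intro: frame)
  qed simp_all
next
  case 5
  have "length (succs e p) = (\<Sum>l<nlab e. nsuc p (lab e l))"
    by (simp add: succs_def length_concat comp_def interv_sum_list_conv_sum_set_nat atLeast0LessThan)
  moreover have "2 + (\<Sum>l<nlab e. 3 + (t + 3) * nsuc p (lab e l) + 2) =
      2 + 5 * nlab e + (t + 3) * (\<Sum>l<nlab e. nsuc p (lab e l))"
    by (simp add: sum.distrib sum_distrib_left)
  ultimately show ?case
    using time by simp
qed

definition visit_prog :: com where
  "visit_prog = Cond (Eq (Data 0 (Reg rW) (Reg rQ)) (Const 0))
     (StoreData 0 (Reg rW) (Reg rQ) (Reg rD) ;;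
      StoreWork 2 (Const 0) (Reg rT) (Reg rW) ;;
      StoreWork 2 (Const 1) (Reg rT) (Reg rQ) ;;
      Assign rT (Inc (Reg rT))) Skip"

definition expand_prog :: com where
  "expand_prog = For rJ (in1 OutDeg (Reg rV))
     ((Assign rE (in2 OutEdge (Reg rV) (Reg rJ)) ;; Assign rW (in1 EdgeTgt (Reg rE))) ;;
      for_succs visit_prog)"

definition bfs_prog :: com where
  "bfs_prog = (Assign rT (Const 0) ;; Assign rW (in0 Source) ;; Assign rD (Const 1)) ;;
     For rI (in0 NumInitial) (Assign rQ (in1 InitialState (Reg rI)) ;; visit_prog) ;;
     Assign rH (Const 0) ;;
     While (Lt (Reg rH) (Reg rT))
       ((Assign rV (Work 2 (Const 0) (Reg rH)) ;; Assign rP (Work 2 (Const 1) (Reg rH)) ;;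
         Assign rD (Inc (Data 0 (Reg rV) (Reg rP)))) ;;
        expand_prog ;; Assign rH (Inc (Reg rH)))"

text \<open>Refinement relation between memory and the functional state of the search; cells beyond
  the end of the queue are left open.\<close>

definition bfs_state :: "state \<Rightarrow> (nat \<Rightarrow> nat \<Rightarrow> nat) \<times> (nat \<times> nat) list \<Rightarrow> bool" where
  "bfs_state \<sigma> s \<longleftrightarrow> data \<sigma> 0 = fst s \<and> reg \<sigma> rT = length (snd s) \<and>
     (\<forall>i<length (snd s). work \<sigma> 2 0 i = fst (snd s ! i) \<and> work \<sigma> 2 1 i = snd (snd s ! i))"

lemma bfs_state_set_reg [simp]: "r \<noteq> rT \<Longrightarrow> bfs_state (set_reg r x \<sigma>) s = bfs_state \<sigma> s"
  by (simp add: bfs_state_def)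

lemma visit_prog_mods [simp]:
  "reg_mods visit_prog = {rT}" "data_mods visit_prog = {0}" "work_mods visit_prog = {2}"
  by (auto simp: visit_prog_def)

lemma triple_visit:
  assumes "bfs_state \<sigma> s" "w = reg \<sigma> rW" "q = reg \<sigma> rQ" "k = reg \<sigma> rD"
  shows "triple I \<sigma> visit_prog 6 (\<lambda>\<tau>. bfs_state \<tau> (visit k (w, q) s))"
proof (rule triple_straight)
  obtain d xs where s: "s = (d, xs)" by (cases s)
  show "bfs_state (exec I visit_prog \<sigma>) (visit k (w, q) s)"
    using assms by (auto simp: visit_prog_def bfs_state_def s upd_def nth_append less_Suc_eq)
qed (simp_all add: visit_prog_def)

context indexed_instance
begin

text \<open>Work for crossing edge \<open>e\<close> from state \<open>p\<close>: each label has to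
  be read, whether or not it leads anywhere.\<close>

definition cost :: "nat \<Rightarrow> nat \<Rightarrow> nat" where
  "cost e p = 1 + nlab e + length (succs e p)"

text \<open>Common currency of the preprocessing phases; \<open>total_cost_le\<close> converts it to
  |D| * |A|.\<close>

definition total_cost :: nat where
  "total_cost = nV * nQ + (\<Sum>e<nE. \<Sum>p<nQ. cost e p)"

lemma triple_expand:
  assumes "bfs_state \<sigma> s" "reg \<sigma> rV = v" "reg \<sigma> rP = p" "reg \<sigma> rD = k"
  shows "triple I \<sigma> expand_prog (2 + (\<Sum>j<outdeg v. 13 * cost (outedge v j) p))
       (\<lambda>\<tau>. bfs_state \<tau> (fold (visit k) (children (v, p)) s))"
proof -
  let ?Inv = "\<lambda>ys \<tau>. bfs_state \<tau> (fold (visit k) ys s)"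
  have "triple I \<sigma> expand_prog (2 + (\<Sum>j<outdeg v. 13 * cost (outedge v j) p))
       (?Inv ([] @ concat (map (\<lambda>j. map (Pair (etgt (outedge v j))) (succs (outedge v j) p)) [0..<outdeg v])))"
  unfolding expand_prog_def
  proof (rule triple_For_concat[where N = "outdeg v" and
        t = "\<lambda>j. 4 + 5 * nlab (outedge v j) + 9 * length (succs (outedge v j) p)"], goal_cases)
    case (4 j ys \<tau>)
    let ?e = "outedge v j"
    let ?w = "etgt ?e"
    let ?\<rho> = "set_reg rW ?w (set_reg rE ?e \<tau>)"
    have regs: "reg \<tau> rV = v" "reg \<tau> rP = p" "reg \<tau> rD = k"
      using 4(4) assms by (auto simp: agree_def)
    have \<rho>: "exec I (Assign rE (in2 OutEdge (Reg rV) (Reg rJ)) ;; Assign rW (in1 EdgeTgt (Reg rE))) \<tau> = ?\<rho>"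
      using regs 4(3) by (simp add: set_reg_def)
    have "triple I ?\<rho> (for_succs visit_prog) (2 + 5 * nlab ?e + (6 + 3) * length (succs ?e p))
      ((\<lambda>zs \<tau>. ?Inv (ys @ map (Pair ?w) zs) \<tau>) ([] @ succs ?e p))"
    proof (rule triple_for_succs[where t = 6], goal_cases)
      case (6 zs q \<rho>)
      have "reg \<rho> rW = ?w" "reg \<rho> rD = k"
        using 6(4) regs by (auto simp: agree_def)
      then show ?case
        using triple_visit[OF 6(1), of ?w q k] 6(3) by simp
    qed (use 4 regs in auto)
    then have "triple I ?\<rho> (for_succs visit_prog) (2 + 5 * nlab ?e + 9 * length (succs ?e p))
       (\<lambda>\<tau>'. ?Inv (ys @ map (Pair ?w) (succs ?e p)) (set_reg rJ (Suc j) \<tau>'))"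
      by (rule triple_mono) auto
    then show ?case
      by (intro triple_straight_Seq[where u = "2 + 5 * nlab ?e + 9 * length (succs ?e p)"])
        (simp_all only: \<rho>, simp_all)
  next
    case 5
    show ?case
      by (auto simp: cost_def intro!: sum_mono)
  qed (use assms in \<open>auto simp: agree_def\<close>)
  then show ?thesis
    by (simp add: children_def)
qed

text \<open>Every edge lies in exactly one outgoing array, so the search pays for it at most once
  per state.\<close>

lemma sum_out_edges: "(\<Sum>v<nV. \<Sum>j<outdeg v. f (outedge v j)) = (\<Sum>e<nE. f e)" for f :: "nat \<Rightarrow> nat"
proof -
  have "(\<Sum>j<outdeg v. f (outedge v j)) = (\<Sum>e\<in>{e\<in>{..<nE}. esrc e = v}. f e)" if "v < nV" for v
    using sum.reindex_bij_betw[OF outedge[OF that], of f] by simp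
  moreover have "(\<Sum>v<nV. \<Sum>e\<in>{e\<in>{..<nE}. esrc e = v}. f e) = (\<Sum>e<nE. f e)"
    using esrc by (intro sum.group) auto
  ultimately show ?thesis
    by simp
qed

lemma triple_bfs:
  assumes "data \<sigma> 0 = (\<lambda>_ _. 0)"
  shows "triple I \<sigma> bfs_prog (9 + 9 * nQ + 20 * total_cost) (\<lambda>\<tau>. distances I (data \<tau> 0))"
proof -
  let ?U = "{..<nV} \<times> {..<nQ}"
  let ?C = "\<lambda>x. 7 + (\<Sum>j<outdeg (fst x). 13 * cost (outedge (fst x) j) (snd x))"
  define init where "init = Assign rT (Const 0) ;; Assign rW (in0 Source) ;; Assign rD (Const 1)"
  define inits where "inits = For rI (in0 NumInitial) (Assign rQ (in1 InitialState (Reg rI)) ;; visit_prog)"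
  define pop where "pop = Assign rV (Work 2 (Const 0) (Reg rH)) ;; Assign rP (Work 2 (Const 1) (Reg rH)) ;;
         Assign rD (Inc (Data 0 (Reg rV) (Reg rP)))"
  define loop where "loop = While (Lt (Reg rH) (Reg rT)) (pop ;; expand_prog ;; Assign rH (Inc (Reg rH)))"
  have prog: "bfs_prog = init ;; inits ;; Assign rH (Const 0) ;; loop"
    by (simp add: bfs_prog_def init_def inits_def pop_def loop_def)
  have "triple I (exec I init \<sigma>) inits (2 + (\<Sum>i<ninit. 9))
    ((\<lambda>ys \<tau>. bfs_state \<tau> (fold (visit 1) ys (\<lambda>_ _. 0, [])))
      ([] @ concat (map (\<lambda>i. [(sV, ini i)]) [0..<ninit])))"
    unfolding inits_def
  proof (rule triple_For_concat[where N = ninit and t = "\<lambda>_. 7"], goal_cases)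
    case (4 i ys \<tau>)
    let ?\<rho> = "set_reg rQ (ini i) \<tau>"
    have regs: "reg \<tau> rW = sV" "reg \<tau> rD = 1"
      using 4(4) by (auto simp: agree_def init_def)
    have "triple I ?\<rho> visit_prog 6 (\<lambda>\<tau>. bfs_state \<tau> (visit 1 (sV, ini i) (fold (visit 1) ys (\<lambda>_ _. 0, []))))"
      using 4(2) regs by (intro triple_visit) auto
    then have "triple I ?\<rho> visit_prog 6 (\<lambda>\<tau>. bfs_state (set_reg rI (Suc i) \<tau>) (fold (visit 1) (ys @ [(sV, ini i)]) (\<lambda>_ _. 0, [])))"
      by (rule triple_mono) auto
    moreover have "exec I (Assign rQ (in1 InitialState (Reg rI))) \<tau> = ?\<rho>"
      using 4(3) by (simp add: set_reg_def)
    ultimately show ?case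
      by (intro triple_straight_Seq[where u = 6]) (simp_all del: exec.simps)
  qed (use assms in \<open>auto simp: bfs_state_def init_def\<close>)
  then have inits: "triple I (exec I init \<sigma>) inits (2 + 9 * ninit) (\<lambda>\<tau>. bfs_state \<tau> bfs_start)"
    by (rule triple_mono) (auto simp: bfs_start_def concat_map_singleton comp_def)
  obtain d0 xs0 where start: "bfs_start = (d0, xs0)"
    by fastforce
  \<comment> \<open>The budget is the cost of all pairs not yet taken from the queue, reached or
    not. It shrinks because the queue never repeats a pair.\<close>
  let ?Inv = "\<lambda>n \<tau>. \<exists>d xs. bfs_state \<tau> (d, xs) \<and> bfs_inv (reg \<tau> rH) d xs \<and>
    n = sum ?C (?U - set (take (reg \<tau> rH) xs))"
  have loop: "triple I \<tau> loop (1 + sum ?C ?U) (\<lambda>\<tau>. distances I (data \<tau> 0))"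
    if \<tau>: "bfs_state \<tau> bfs_start" "reg \<tau> rH = 0" for \<tau>
  proof -
    have "triple I \<tau> loop (Suc (sum ?C ?U)) (\<lambda>\<tau>. (\<exists>m\<le>sum ?C ?U. ?Inv m \<tau>) \<and> \<not> bval I \<tau> (Lt (Reg rH) (Reg rT)))"
      unfolding loop_def
    proof (rule triple_While, goal_cases)
      case (1 n \<rho>)
      then obtain d xs where st: "bfs_state \<rho> (d, xs)" and inv: "bfs_inv (reg \<rho> rH) d xs"
        and n: "n = sum ?C (?U - set (take (reg \<rho> rH) xs))"
        by blast
      let ?h = "reg \<rho> rH"
      let ?x = "xs ! ?h"
      let ?s = "fold (visit (Suc (label d ?x))) (children ?x) (d, xs)"
      have h: "?h < length xs"
        using 1(2) st by (simp add: bfs_state_def)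
      let ?\<rho>' = "exec I pop \<rho>"
      have \<rho>': "bfs_state ?\<rho>' (d, xs)" "reg ?\<rho>' rV = fst ?x" "reg ?\<rho>' rP = snd ?x"
        "reg ?\<rho>' rD = Suc (label d ?x)" "reg ?\<rho>' rH = ?h"
        using st h by (auto simp: pop_def bfs_state_def)
      have e: "triple I ?\<rho>' expand_prog (2 + (\<Sum>j<outdeg (fst ?x). 13 * cost (outedge (fst ?x) j) (snd ?x)))
          (\<lambda>\<tau>. bfs_state \<tau> ?s)"
        using triple_expand[OF \<rho>'(1-4)] by simp
      obtain d' xs' where s': "?s = (d', xs')"
        by fastforce
      have inv': "bfs_inv (Suc ?h) d' xs'" and ext: "extends (d, xs) (d', xs')"
        using bfs_step[OF inv h s'] by auto
      have take: "take (Suc ?h) xs' = take ?h xs @ [?x]"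
        using ext h by (auto simp: extends_def take_Suc_conv_app_nth nth_append)
      have q: "distinct xs" "set xs \<subseteq> ?U"
        using inv unfolding bfs_inv_def queue_inv_def by blast+
      have x: "?x \<in> ?U - set (take ?h xs)"
        using q h nth_mem[OF h] distinct_take[OF q(1), of "Suc ?h"]
        by (auto simp: take_Suc_conv_app_nth)
      have "n = ?C ?x + sum ?C (?U - set (take (Suc ?h) xs'))"
        unfolding n take set_append Diff_Un using sum.remove[OF _ x, of ?C]
        by (simp add: Diff_Int_distrib2 Diff_Diff_Int Int_Diff Diff_eq Int_ac)
      moreover have "triple I \<rho> (pop ;; expand_prog ;; Assign rH (Inc (Reg rH)))
         (6 + (\<Sum>j<outdeg (fst ?x). 13 * cost (outedge (fst ?x) j) (snd ?x)))
         (\<lambda>\<tau>. bfs_state \<tau> ?s \<and> reg \<tau> rH = Suc ?h)"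
      proof (rule triple_straight_Seq)
        show "triple I ?\<rho>' (expand_prog ;; Assign rH (Inc (Reg rH)))
           (3 + (\<Sum>j<outdeg (fst ?x). 13 * cost (outedge (fst ?x) j) (snd ?x)))
           (\<lambda>\<tau>. bfs_state \<tau> ?s \<and> reg \<tau> rH = Suc ?h)"
        proof (rule triple_Seq[where u = 1, OF e], goal_cases)
          case (1 \<tau>)
          have "reg \<tau> rH = ?h"
            using 1(2) \<rho>'(5) by (simp add: agree_def expand_prog_def)
          then show ?case
            using 1(1) by (intro triple_straight) (auto simp: bfs_state_def)
        qed simp
      qed (simp_all add: pop_def)
      then have "triple I \<rho> (pop ;; expand_prog ;; Assign rH (Inc (Reg rH)))
         (6 + (\<Sum>j<outdeg (fst ?x). 13 * cost (outedge (fst ?x) j) (snd ?x)))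
         (\<lambda>\<tau>. ?Inv (sum ?C (?U - set (take (Suc ?h) xs'))) \<tau>)"
        by (rule triple_mono) (use s' inv' in auto)
      ultimately show ?case
        by (intro exI) (erule triple_mono, rule order_refl, rule exI, erule conjI, simp)
    next
      case 2
      show ?case
        using \<tau> start bfs_start[OF start] by auto
    qed
    then show ?thesis
    proof (rule triple_mono, goal_cases)
      case (2 \<rho>)
      then obtain d xs where "bfs_state \<rho> (d, xs)" "bfs_inv (reg \<rho> rH) d xs" "\<not> reg \<rho> rH < reg \<rho> rT"
        by auto
      moreover from this have "reg \<rho> rH = length xs"
        by (simp add: bfs_state_def bfs_inv_def)
      ultimately show ?case
        using bfs_inv_distances[of xs d] by (simp add: bfs_state_def)
    qed simp
  qed
  have "sum ?C ?U = (\<Sum>v<nV. \<Sum>p<nQ. 7 + (\<Sum>j<outdeg v. 13 * cost (outedge v j) p))"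
    by (simp add: sum.cartesian_product case_prod_beta)
  also have "\<dots> = 7 * (nV * nQ) + (\<Sum>p<nQ. \<Sum>v<nV. \<Sum>j<outdeg v. 13 * cost (outedge v j) p)"
    by (simp add: sum.distrib sum.swap[of _ "{..<nV}"])
  also have "(\<Sum>p<nQ. \<Sum>v<nV. \<Sum>j<outdeg v. 13 * cost (outedge v j) p) = (\<Sum>p<nQ. \<Sum>e<nE. 13 * cost e p)"
    using sum_out_edges[of "\<lambda>e. 13 * cost e p" for p] by simp
  also have "\<dots> = 13 * (\<Sum>e<nE. \<Sum>p<nQ. cost e p)"
    by (simp add: sum_distrib_left sum.swap[of _ "{..<nQ}"])
  finally have total: "sum ?C ?U \<le> 20 * total_cost"
    by (simp add: total_cost_def)
  have ninit: "ninit \<le> nQ"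
    using card_inj_on_le[OF inj_ini, of "{..<nQ}"] ini by auto
  show ?thesis
    unfolding prog
  proof (rule triple_straight_Seq)
    show "triple I (exec I init \<sigma>) (inits ;; Assign rH (Const 0) ;; loop) (6 + 9 * nQ + 20 * total_cost)
      (\<lambda>\<tau>. distances I (data \<tau> 0))"
    proof (rule triple_Seq[where u = "2 + 20 * total_cost", OF inits], goal_cases)
      case (1 \<tau>)
      show ?case
      proof (rule triple_straight_Seq)
        show "triple I (exec I (Assign rH (Const 0)) \<tau>) loop (1 + 20 * total_cost) (\<lambda>\<tau>. distances I (data \<tau> 0))"
          by (rule triple_mono[OF loop]) (use 1 total in \<open>auto simp: bfs_state_def\<close>)
      qed simp_all
    qed (use ninit in simp)
  qed (simp_all add: init_def)
qed

end

section \<open>The precomputed tables\<close>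

text \<open>
  \<open>Data\<close> tables: 0 distance labels; 1, 2, 3 for each edge the number of its tight transitions
  (those from one level of the search to the next), their sources and their targets; 4 the indicator
  of these targets; 5, 6 the edge and the state preceding a pair; 7, 8 the position, plus one, of
  the next usable edge after a given edge, or of the first one, where \<open>0\<close> means none; 9 the
  edges of the first output. \<open>Work\<close> tables: 2 the queue; 3 the sets of states along a walk.
\<close>

definition pair_prog :: com where
  "pair_prog = Cond (Conj (Neg (Eq (Data 0 (Reg rV) (Reg rP)) (Const 0)))
       (Eq (Data 0 (Reg rW) (Reg rQ)) (Inc (Data 0 (Reg rV) (Reg rP)))))
     (StoreData 2 (Reg rE) (Reg rC) (Reg rP) ;;
      StoreData 3 (Reg rE) (Reg rC) (Reg rQ) ;;
      StoreData 4 (Reg rE) (Reg rQ) (Const 1) ;;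
      StoreData 5 (Reg rW) (Reg rQ) (Reg rE) ;;
      StoreData 6 (Reg rW) (Reg rQ) (Reg rP) ;;
      Assign rC (Inc (Reg rC))) Skip"

definition pairs_prog :: com where
  "pairs_prog = For rE (in0 NumEdges)
     ((Assign rV (in1 EdgeSrc (Reg rE)) ;; Assign rW (in1 EdgeTgt (Reg rE)) ;; Assign rC (Const 0)) ;;
      For rP (in0 NumStates) (for_succs pair_prog) ;;
      StoreData 1 (Reg rE) (Const 0) (Reg rC))"

text \<open>The incoming array is traversed from right to left. \<open>rX\<close> holds the nearest
  usable position to the right of the current one, plus one, so each entry takes constant
  time.\<close>

definition cell_prog :: com where
  "cell_prog = (Assign rX (Const 0) ;; Assign rI (in1 InDeg (Reg rV))) ;;
     While (Lt (Const 0) (Reg rI))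
       (Assign rI (Dec (Reg rI)) ;; Assign rE (in2 InEdge (Reg rV) (Reg rI)) ;;
        StoreData 7 (Reg rE) (Reg rQ) (Reg rX) ;;
        Cond (Eq (Data 4 (Reg rE) (Reg rQ)) (Const 0)) Skip (Assign rX (Inc (Reg rI)))) ;;
     StoreData 8 (Reg rV) (Reg rQ) (Reg rX)"

definition next_prog :: com where
  "next_prog = For rV (in0 NumVerts) (For rQ (in0 NumStates) cell_prog)"

lemma pair_prog_mods [simp]:
  "reg_mods pair_prog = {rC}" "data_mods pair_prog = {2, 3, 4, 5, 6}" "work_mods pair_prog = {}"
  by (auto simp: pair_prog_def)

lemma cell_prog_mods [simp]:
  "reg_mods cell_prog = {rX, rI, rE}" "data_mods cell_prog = {7, 8}" "work_mods cell_prog = {}"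
  by (auto simp: cell_prog_def)

context distances
begin

text \<open>The states that can use the edge as singletons: the analogue of \<open>good\<close> for
  one state.\<close>

definition targets :: "nat \<Rightarrow> nat set" where
  "targets e = snd ` set (pairs e)"

definition edge_ok :: "state \<Rightarrow> nat \<Rightarrow> bool" where
  "edge_ok \<sigma> e \<longleftrightarrow> data \<sigma> 1 e 0 = length (pairs e) \<and>
     (\<forall>k<length (pairs e). data \<sigma> 2 e k = fst (pairs e ! k) \<and> data \<sigma> 3 e k = snd (pairs e ! k)) \<and>
     (\<forall>q. data \<sigma> 4 e q \<noteq> 0 \<longleftrightarrow> q \<in> targets e)"

text \<open>Any tight transition into the pair is acceptable, so later ones may overwrite earlier
  ones.\<close>

definition parent_ok :: "state \<Rightarrow> nat \<Rightarrow> nat \<Rightarrow> bool" where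
  "parent_ok \<sigma> v q \<longleftrightarrow> data \<sigma> 5 v q < nE \<and> etgt (data \<sigma> 5 v q) = v \<and>
     (data \<sigma> 6 v q, q) \<in> set (pairs (data \<sigma> 5 v q))"

definition edges_done :: "nat \<Rightarrow> state \<Rightarrow> bool" where
  "edges_done e \<sigma> \<longleftrightarrow> (\<forall>f<e. edge_ok \<sigma> f \<and> (\<forall>q\<in>targets f. parent_ok \<sigma> (etgt f) q))"

text \<open>Indicators are set but never reset, so table 4 must be empty beforehand; it is so
  initially, and the search does not write to it.\<close>

definition flags_clear :: "nat \<Rightarrow> state \<Rightarrow> bool" where
  "flags_clear e \<sigma> \<longleftrightarrow> (\<forall>f\<ge>e. \<forall>q. data \<sigma> 4 f q = 0)"

definition partial_edge :: "nat \<Rightarrow> (nat \<times> nat) list \<Rightarrow> state \<Rightarrow> bool" where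
  "partial_edge e zs \<sigma> \<longleftrightarrow> reg \<sigma> rC = length zs \<and>
     (\<forall>k<length zs. data \<sigma> 2 e k = fst (zs ! k) \<and> data \<sigma> 3 e k = snd (zs ! k)) \<and>
     (\<forall>q. data \<sigma> 4 e q \<noteq> 0 \<longleftrightarrow> q \<in> snd ` set zs) \<and> (\<forall>q\<in>snd ` set zs. parent_ok \<sigma> (etgt e) q) \<and>
     edges_done e \<sigma> \<and> flags_clear (Suc e) \<sigma>"

abbreviation is_pair :: "nat \<Rightarrow> nat \<times> nat \<Rightarrow> bool" where
  "is_pair e \<equiv> \<lambda>(p, q). d (esrc e) p \<noteq> 0 \<and> d (etgt e) q = Suc (d (esrc e) p)"

lemma partial_edge_set_reg [simp]: "r \<noteq> rC \<Longrightarrow> partial_edge e zs (set_reg r x \<sigma>) = partial_edge e zs \<sigma>"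
  by (simp add: partial_edge_def edges_done_def flags_clear_def edge_ok_def parent_ok_def)

lemma triple_pair:
  assumes inv: "partial_edge e zs \<sigma>" and d: "data \<sigma> 0 = d"
    and regs: "reg \<sigma> rE = e" "reg \<sigma> rV = esrc e" "reg \<sigma> rW = etgt e" "reg \<sigma> rP = p" "reg \<sigma> rQ = q"
    and pq: "(p, q) \<in> set (arcs e)" and e: "e < nE"
  shows "triple I \<sigma> pair_prog 8 (partial_edge e (zs @ filter (is_pair e) [(p, q)]))"
proof (rule triple_straight)
  let ?\<tau> = "exec I pair_prog \<sigma>"
  show "partial_edge e (zs @ filter (is_pair e) [(p, q)]) ?\<tau>"
  proof (cases "is_pair e (p, q)")
    case False
    then have "?\<tau> = \<sigma>"
      using d regs by (auto simp: pair_prog_def)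
    then show ?thesis
      using False inv by auto
  next
    case True
    then have mem: "(p, q) \<in> set (pairs e)"
      using pq by (simp add: set_pairs)
    have D: "data ?\<tau> (Suc 0) = data \<sigma> (Suc 0)"
      "data ?\<tau> 2 = (data \<sigma> 2)(e := (data \<sigma> 2 e)(length zs := p))"
      "data ?\<tau> 3 = (data \<sigma> 3)(e := (data \<sigma> 3 e)(length zs := q))"
      "data ?\<tau> 4 = (data \<sigma> 4)(e := (data \<sigma> 4 e)(q := 1))"
      "data ?\<tau> 5 = (data \<sigma> 5)(etgt e := (data \<sigma> 5 (etgt e))(q := e))"
      "data ?\<tau> 6 = (data \<sigma> 6)(etgt e := (data \<sigma> 6 (etgt e))(q := p))"
      "reg ?\<tau> rC = Suc (length zs)"
      using True d regs inv by (simp_all add: pair_prog_def upd_def partial_edge_def)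
    \<comment> \<open>An overwritten parent remains correct, since the new entry is the tight
      transition at hand.\<close>
    have par: "parent_ok ?\<tau> v r" if "parent_ok \<sigma> v r \<or> v = etgt e \<and> r = q" for v r
      using that mem e by (auto simp: parent_ok_def D)
    have edge: "edge_ok ?\<tau> f = edge_ok \<sigma> f" if "f \<noteq> e" for f
      using that by (simp add: edge_ok_def D)
    show ?thesis
      unfolding partial_edge_def
    proof (intro conjI)
      show "edges_done e ?\<tau>"
        using inv by (simp add: partial_edge_def edges_done_def edge par)
      show "flags_clear (Suc e) ?\<tau>"
        using inv by (simp add: partial_edge_def flags_clear_def D)
    qed (use True inv par in \<open>auto simp: partial_edge_def D nth_append less_Suc_eq\<close>)
  qed
qed (simp_all add: pair_prog_def)

lemma triple_pairs:
  assumes d: "data \<sigma> 0 = d" and clear: "flags_clear 0 \<sigma>" and Q: "0 < nQ"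
  shows "triple I \<sigma> pairs_prog (2 + 19 * total_cost) (\<lambda>\<tau>. data \<tau> 0 = d \<and> edges_done nE \<tau>)"
proof -
  let ?Inv = "\<lambda>i \<tau>. data \<tau> 0 = d \<and> edges_done i \<tau> \<and> flags_clear i \<tau>"
  let ?init = "Assign rV (in1 EdgeSrc (Reg rE)) ;; Assign rW (in1 EdgeTgt (Reg rE)) ;; Assign rC (Const 0)"
  let ?t = "\<lambda>e. \<Sum>p<nQ. 4 + 5 * nlab e + 11 * length (succs e p)"
  have "triple I \<sigma> pairs_prog (2 + 19 * total_cost) (\<lambda>\<tau>. ?Inv nE \<tau> \<and> reg \<tau> rE = nE)"
    unfolding pairs_prog_def
  proof (rule triple_For[where t = "\<lambda>e. 6 + ?t e"], goal_cases)
    case 1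
    show ?case using assms by (simp add: edges_done_def flags_clear_def)
  next
    case (4 e \<tau>)
    let ?\<rho> = "exec I ?init \<tau>"
    have \<rho>: "reg ?\<rho> rE = e" "reg ?\<rho> rV = esrc e" "reg ?\<rho> rW = etgt e" "data ?\<rho> = data \<tau>" "reg ?\<rho> rC = 0"
      using 4(3) by simp_all
    let ?J = "\<lambda>ys \<tau>. partial_edge e (filter (is_pair e) ys) \<tau>"
    have "triple I ?\<rho> (For rP (in0 NumStates) (for_succs pair_prog)) (2 + ?t e)
      (?J ([] @ concat (map (\<lambda>p. map (Pair p) (succs e p)) [0..<nQ])))"
    proof (rule triple_For_concat[where N = nQ and t = "\<lambda>p. 2 + 5 * nlab e + 11 * length (succs e p)"],
        goal_cases)
      case 1
      show ?case
        using 4(2) \<rho> by (simp add: partial_edge_def edges_done_def flags_clear_def edge_ok_def parent_ok_def)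
    next
      case (4 p ys \<tau>')
      have r: "reg \<tau>' rE = e" "reg \<tau>' rV = esrc e" "reg \<tau>' rW = etgt e" "data \<tau>' 0 = d"
        using 4(4) \<rho> \<open>?Inv e \<tau>\<close> by (auto simp: agree_def)
      have "triple I \<tau>' (for_succs pair_prog) (2 + 5 * nlab e + 11 * length (succs e p))
        ((\<lambda>zs \<tau>. ?J (ys @ map (Pair p) zs) \<tau>) ([] @ succs e p))"
      proof (rule triple_for_succs[where t = 8], goal_cases)
        case 1
        show ?case
          using 4(2) by simp
      next
        case (2 zs r x \<rho>')
        then have "r \<noteq> rC"
          by auto
        with 2(2) show ?case
          by (simp only: partial_edge_set_reg not_False_eq_True)
      next
        case (6 zs q \<rho>')
        have r': "reg \<rho>' rE = e" "reg \<rho>' rV = esrc e" "reg \<rho>' rW = etgt e" "reg \<rho>' rP = p" "data \<rho>' 0 = d"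
          using 6(4) r 4(3) by (auto simp: agree_def)
        have "(p, q) \<in> set (arcs e)"
          using 6(2) 4(1) by (simp add: set_arcs)
        then show ?case
          using triple_pair[OF 6(1) r'(5,1-4) 6(3) _ \<open>e < nE\<close>] by simp
      qed (use 4(3) r(1) in auto)
      then show ?case
        by (rule triple_mono) simp_all
    next
      case 5
      show ?case
        by (rule add_left_mono, rule sum_mono) simp
    qed (auto simp: agree_def)
    then have main: "triple I ?\<rho> (For rP (in0 NumStates) (for_succs pair_prog)) (2 + ?t e) (partial_edge e (pairs e))"
      by (simp add: pairs_def arcs_def)
    show ?case
    proof (rule triple_straight_Seq)
      show "triple I ?\<rho> (For rP (in0 NumStates) (for_succs pair_prog) ;; StoreData 1 (Reg rE) (Const 0) (Reg rC))
        (3 + ?t e) (\<lambda>\<tau>'. ?Inv (Suc e) (set_reg rE (Suc e) \<tau>'))"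
      proof (rule triple_Seq[where u = 1, OF main], goal_cases)
        case (1 \<rho>')
        have r': "reg \<rho>' rE = e" "data \<rho>' 0 = d"
          using 1(2) \<rho> 4(2) by (auto simp: agree_def)
        define \<omega> where "\<omega> = exec I (StoreData 1 (Reg rE) (Const 0) (Reg rC)) \<rho>'"
        have D: "data \<omega> (Suc 0) = (data \<rho>' (Suc 0))(e := (data \<rho>' (Suc 0) e)(0 := length (pairs e)))"
          "\<And>k. k \<noteq> Suc 0 \<Longrightarrow> data \<omega> k = data \<rho>' k"
          using r' 1(1) by (auto simp: upd_def partial_edge_def \<omega>_def)
        have par: "parent_ok \<omega> v q = parent_ok \<rho>' v q" for v q
          by (simp add: parent_ok_def D(2))
        have edge: "edge_ok \<omega> f = edge_ok \<rho>' f" if "f \<noteq> e" for f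
          using that by (simp add: edge_ok_def D)
        have "edge_ok \<omega> e"
          using 1(1) by (simp add: edge_ok_def D partial_edge_def targets_def)
        then have "edges_done (Suc e) \<omega>"
          using 1(1) by (auto simp: edges_done_def partial_edge_def targets_def par edge less_Suc_eq
             )
        moreover have "flags_clear (Suc e) \<omega>"
          using 1(1) by (simp add: flags_clear_def partial_edge_def D(2))
        ultimately have "?Inv (Suc e) (set_reg rE (Suc e) \<omega>)"
          using r' D(2)[of 0]
          by (simp add: edges_done_def flags_clear_def edge_ok_def parent_ok_def)
        then show ?case
          by (intro triple_straight) (simp_all del: exec.simps add: \<omega>_def)
      qed simp
    qed simp_all
  next
    case 5
    have "8 + ?t e \<le> 19 * (\<Sum>p<nQ. cost e p)" for e
    proof -
      \<comment> \<open>The 8 steps that an edge takes outside the iterations over states are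
        charged to the states, hence \<open>0 < nQ\<close>.\<close>
      have "8 \<le> (\<Sum>p<nQ. 8 :: nat)"
        using Q by simp
      then have "8 + ?t e \<le> (\<Sum>p<nQ. 8 :: nat) + ?t e"
        by simp
      also have "\<dots> \<le> (\<Sum>p<nQ. 19 * cost e p)"
        unfolding sum.distrib[symmetric] by (rule sum_mono) (simp add: cost_def)
      finally show ?thesis
        by (simp add: sum_distrib_left)
    qed
    then have "(\<Sum>e<nE. 6 + ?t e + 2) \<le> (\<Sum>e<nE. 19 * (\<Sum>p<nQ. cost e p))"
      by (intro sum_mono) simp
    then show ?case
      by (simp add: total_cost_def sum_distrib_left)
  qed auto
  then show ?thesis
    by (rule triple_mono) auto
qed

section \<open>Next usable edges, one state at a time\<close>

definition next_good :: "nat \<Rightarrow> nat \<Rightarrow> nat \<Rightarrow> nat" where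
  "next_good v q i = next_pos (\<lambda>j. q \<in> targets (inedge v j)) (indeg v) i"

definition suffix_ok :: "state \<Rightarrow> nat \<Rightarrow> nat \<Rightarrow> nat \<Rightarrow> bool" where
  "suffix_ok \<sigma> v q i \<longleftrightarrow> (\<forall>j. i \<le> j \<and> j < indeg v \<longrightarrow> data \<sigma> 7 (inedge v j) q = next_good v q (Suc j))"

definition cell_ok :: "state \<Rightarrow> nat \<Rightarrow> nat \<Rightarrow> bool" where
  "cell_ok \<sigma> v q \<longleftrightarrow> data \<sigma> 8 v q = next_good v q 0 \<and> suffix_ok \<sigma> v q 0"

text \<open>\<open>X\<close> collects the finished cells. They are not disturbed: table 7 is indexed
  by edge and state, and two vertices share no incoming edge.\<close>

lemma triple_cell:
  assumes flags: "\<And>e q. e < nE \<Longrightarrow> data \<sigma> 4 e q \<noteq> 0 \<longleftrightarrow> q \<in> targets e"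
    and regs: "reg \<sigma> rV = v" "reg \<sigma> rQ = q" and v: "v < nV"
    and cells: "\<And>w r. (w, r) \<in> X \<Longrightarrow> cell_ok \<sigma> w r" and X: "X \<subseteq> {..<nV} \<times> UNIV" "(v, q) \<notin> X"
  shows "triple I \<sigma> cell_prog (5 + 7 * indeg v) (\<lambda>\<tau>. \<forall>(w, r)\<in>insert (v, q) X. cell_ok \<tau> w r)"
proof -
  let ?init = "Assign rX (Const 0) ;; Assign rI (in1 InDeg (Reg rV))"
  let ?body = "Assign rI (Dec (Reg rI)) ;; Assign rE (in2 InEdge (Reg rV) (Reg rI)) ;;
        StoreData 7 (Reg rE) (Reg rQ) (Reg rX) ;;
        Cond (Eq (Data 4 (Reg rE) (Reg rQ)) (Const 0)) Skip (Assign rX (Inc (Reg rI)))"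
  let ?J = "\<lambda>\<tau>. reg \<tau> rI \<le> indeg v \<and> reg \<tau> rX = next_good v q (reg \<tau> rI) \<and>
    suffix_ok \<tau> v q (reg \<tau> rI) \<and> (\<forall>(w, r)\<in>X. cell_ok \<tau> w r)"
  let ?\<sigma> = "exec I ?init \<sigma>"
  have loop: "triple I ?\<sigma> (While (Lt (Const 0) (Reg rI)) ?body) (Suc (7 * indeg v))
    (\<lambda>\<tau>. (\<exists>m\<le>7 * indeg v. ?J \<tau> \<and> m = 7 * reg \<tau> rI) \<and> \<not> bval I \<tau> (Lt (Const 0) (Reg rI)))"
  proof (rule triple_While, goal_cases)
    case (1 m \<tau>)
    have r: "reg \<tau> rV = v" "reg \<tau> rQ = q" "data \<tau> 4 = data \<sigma> 4"
      using 1(3) regs by (auto simp: agree_def)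
    obtain i where i: "reg \<tau> rI = Suc i" "i < indeg v"
      using 1(1,2) by (cases "reg \<tau> rI") auto
    let ?e = "inedge v i"
    have e: "?e < nE" "etgt ?e = v"
      using inedge_in[OF v i(2)] by auto
    have fl: "data \<sigma> 4 ?e q = 0 \<longleftrightarrow> q \<notin> targets ?e"
      using flags[OF e(1), of q] by blast
    let ?\<rho> = "exec I ?body \<tau>"
    have D: "data ?\<rho> 7 = (data \<tau> 7)(?e := (data \<tau> 7 ?e)(q := next_good v q (Suc i)))"
      "data ?\<rho> 8 = data \<tau> 8" "reg ?\<rho> rI = i"
      "reg ?\<rho> rX = (if q \<in> targets ?e then Suc i else next_good v q (Suc i))"
      using r i 1(1) fl by (auto simp: upd_def)
    have "reg ?\<rho> rX = next_good v q i"
      using i(2) next_pos_hit[of i "indeg v" "\<lambda>j. q \<in> targets (inedge v j)"]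
        next_pos_miss[of "\<lambda>j. q \<in> targets (inedge v j)" i "indeg v"]
      by (simp add: D next_good_def del: exec.simps)
    moreover have "suffix_ok ?\<rho> v q i"
      unfolding suffix_ok_def
    proof (intro allI impI)
      fix j
      assume j: "i \<le> j \<and> j < indeg v"
      show "data ?\<rho> 7 (inedge v j) q = next_good v q (Suc j)"
      proof (cases "j = i")
        case False
        then have "inedge v j \<noteq> ?e"
          using ipos_inedge[OF v, of j] ipos_inedge[OF v i(2)] j by auto
        then show ?thesis
          using 1(1) i j False by (simp add: D suffix_ok_def del: exec.simps)
      qed (simp add: D del: exec.simps)
    qed
    moreover have "cell_ok ?\<rho> w r" if "(w, r) \<in> X" for w r
    proof -
      have w: "w < nV" "cell_ok \<tau> w r"
        using that X(1) 1(1) by auto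
      have "inedge w j \<noteq> ?e \<or> r \<noteq> q" if "j < indeg w" for j
        using inedge_in[OF w(1) that] e(2) X(2) \<open>(w, r) \<in> X\<close> by auto
      then show ?thesis
        using w(2) by (auto simp: cell_ok_def suffix_ok_def D simp del: exec.simps)
    qed
    ultimately have "?J ?\<rho>"
      using i(2) by (auto simp: D(3) simp del: exec.simps)
    then have "\<exists>m'. (?J ?\<rho> \<and> m' = 7 * reg ?\<rho> rI) \<and> Suc 6 + m' \<le> m"
      using 1(1) i(1) D(3) by (simp del: exec.simps)
    then show ?case
      by (intro exI[of _ 6], intro triple_straight) (simp, simp, assumption)
  next
    case 2
    show ?case
      using regs cells
      by (auto simp: suffix_ok_def cell_ok_def next_good_def next_pos_end)
  qed
  show ?thesis
    unfolding cell_prog_def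
  proof (rule triple_straight_Seq)
    show "triple I ?\<sigma> (While (Lt (Const 0) (Reg rI)) ?body ;; StoreData 8 (Reg rV) (Reg rQ) (Reg rX))
      (2 + 7 * indeg v) (\<lambda>\<tau>. \<forall>(w, r)\<in>insert (v, q) X. cell_ok \<tau> w r)"
    proof (rule triple_Seq[where u = 1, OF loop], goal_cases)
      case (1 \<tau>)
      have r: "reg \<tau> rV = v" "reg \<tau> rQ = q"
        using 1(2) regs by (auto simp: agree_def)
      have J: "reg \<tau> rI = 0" "?J \<tau>"
        using 1(1) by auto
      have "cell_ok (exec I (StoreData 8 (Reg rV) (Reg rQ) (Reg rX)) \<tau>) w r" if "(w, r) \<in> insert (v, q) X" for w r
        using that r J X(2) by (auto simp: cell_ok_def suffix_ok_def upd_def)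
      then show ?case
        by (intro triple_straight) auto
    qed simp
  qed simp_all
qed

lemma sum_in_degrees: "(\<Sum>v<nV. indeg v) = nE"
proof -
  have "indeg v = (\<Sum>e\<in>{e\<in>{..<nE}. etgt e = v}. 1)" if "v < nV" for v
    using bij_betw_same_card[OF inedge[OF that]] by simp
  moreover have "(\<Sum>v<nV. \<Sum>e\<in>{e\<in>{..<nE}. etgt e = v}. 1) = (\<Sum>e<nE. 1 :: nat)"
    using etgt by (intro sum.group) auto
  ultimately show ?thesis
    by simp
qed

text \<open>A cell costs the in-degree of its vertex, and the in-degrees add up to
  \<open>nE\<close>, once per state. The overhead of a vertex is charged to the states, so
  \<open>nQ\<close> has to be positive.\<close>

lemma triple_next:
  assumes flags: "\<And>e q. e < nE \<Longrightarrow> data \<sigma> 4 e q \<noteq> 0 \<longleftrightarrow> q \<in> targets e" and Q: "0 < nQ"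
  shows "triple I \<sigma> next_prog (2 + 11 * total_cost) (\<lambda>\<tau>. \<forall>v<nV. \<forall>q<nQ. cell_ok \<tau> v q)"
proof -
  let ?C = "\<lambda>X \<tau>. \<forall>(w, r)\<in>X. cell_ok \<tau> w r"
  have set_reg: "?C X (set_reg r x \<tau>) = ?C X \<tau>" for X r x \<tau>
    by (simp add: cell_ok_def suffix_ok_def)
  have "triple I \<sigma> next_prog (2 + 11 * total_cost)
    (\<lambda>\<tau>. ?C ({..<nV} \<times> {..<nQ}) \<tau> \<and> reg \<tau> rV = nV)"
    unfolding next_prog_def
  proof (rule triple_For[where t = "\<lambda>v. 2 + nQ * (7 + 7 * indeg v)" and
        Inv = "\<lambda>v. ?C ({..<v} \<times> {..<nQ})"], goal_cases)
    case (4 v \<tau>)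
    have "triple I \<tau> (For rQ (in0 NumStates) cell_prog) (2 + nQ * (7 + 7 * indeg v))
      (\<lambda>\<tau>. ?C ({..<v} \<times> {..<nQ} \<union> {v} \<times> {..<nQ}) \<tau> \<and> reg \<tau> rQ = nQ)"
    proof (rule triple_For[where t = "\<lambda>_. 5 + 7 * indeg v" and
        Inv = "\<lambda>q. ?C ({..<v} \<times> {..<nQ} \<union> {v} \<times> {..<q})"], goal_cases)
      case 1
      show ?case
        using 4(2) by (simp only: set_reg lessThan_0 Sigma_empty2 Un_empty_right)
    next
      case (4 q \<rho>)
      have fl: "data \<rho> 4 e q \<noteq> 0 \<longleftrightarrow> q \<in> targets e" if "e < nE" for e q
        using flags[OF that] 4(4) \<open>agree (For rV _ _) \<sigma> \<tau>\<close> by (simp add: agree_def)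
      have "triple I \<rho> cell_prog (5 + 7 * indeg v)
        (?C (insert (v, q) ({..<v} \<times> {..<nQ} \<union> {v} \<times> {..<q})))"
      proof (rule triple_cell, goal_cases)
        case (5 w r)
        then show ?case
          using 4(2) by blast
      qed (use fl 4 \<open>v < nV\<close> \<open>reg \<tau> rV = v\<close> in \<open>auto simp: agree_def\<close>)
      then show ?case
      proof (rule triple_mono, goal_cases)
        case (2 \<rho>')
        have "{..<v} \<times> {..<nQ} \<union> {v} \<times> {..<Suc q} = insert (v, q) ({..<v} \<times> {..<nQ} \<union> {v} \<times> {..<q})"
          by auto
        then show ?case
          using 2(2) by (simp only: set_reg)
      qed simp
    qed (auto simp: agree_def)
    then show ?case
    proof (rule triple_mono, goal_cases)
      case (2 \<rho>)
      have "{..<Suc v} \<times> {..<nQ} = {..<v} \<times> {..<nQ} \<union> {v} \<times> {..<nQ}"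
        by auto
      then show ?case
        using 2(2)[THEN conjunct1] by (simp only: set_reg)
    qed simp
  next
    case 5
    have "(\<Sum>v<nV. 2 + nQ * (7 + 7 * indeg v) + 2) = 4 * nV + 7 * (nV * nQ) + 7 * (nE * nQ)"
    proof -
      have "(\<Sum>v<nV. 2 + nQ * (7 + 7 * indeg v) + 2) = (\<Sum>v<nV. (4 + 7 * nQ) + 7 * nQ * indeg v)"
        by (rule sum.cong) (simp_all add: algebra_simps)
      also have "\<dots> = nV * (4 + 7 * nQ) + 7 * nQ * (\<Sum>v<nV. indeg v)"
        unfolding sum.distrib sum_distrib_left by (simp add: distrib_left)
      finally show ?thesis
        by (simp add: sum_in_degrees algebra_simps)
    qed
    moreover have "4 * nV \<le> 4 * (nV * nQ)"
      using Q by simp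
    moreover have "nE * nQ \<le> (\<Sum>e<nE. \<Sum>p<nQ. cost e p)"
    proof -
      have "(\<Sum>e<nE. \<Sum>p<nQ. 1) \<le> (\<Sum>e<nE. \<Sum>p<nQ. cost e p)"
        by (intro sum_mono) (simp add: cost_def)
      then show ?thesis by simp
    qed
    ultimately have "(\<Sum>v<nV. 2 + nQ * (7 + 7 * indeg v) + 2)
        \<le> 11 * (nV * nQ) + 7 * (\<Sum>e<nE. \<Sum>p<nQ. cost e p)"
      by linarith
    also have "\<dots> \<le> 11 * total_cost"
      by (simp add: total_cost_def)
    finally show ?case
      by (rule add_left_mono)
  qed auto
  then show ?thesis
    by (rule triple_mono) auto
qed

definition tables :: "(nat \<Rightarrow> nat \<Rightarrow> nat \<Rightarrow> nat) \<Rightarrow> bool" where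
  "tables D \<longleftrightarrow> D 0 = d \<and>
     (\<forall>e<nE. D 1 e 0 = length (pairs e) \<and>
       (\<forall>k<length (pairs e). D 2 e k = fst (pairs e ! k) \<and> D 3 e k = snd (pairs e ! k))) \<and>
     (\<forall>v q. 1 < d v q \<longrightarrow> D 5 v q < nE \<and> etgt (D 5 v q) = v \<and> (D 6 v q, q) \<in> set (pairs (D 5 v q))) \<and>
     (\<forall>v<nV. \<forall>q<nQ. D 8 v q = next_good v q 0 \<and>
       (\<forall>j<indeg v. D 7 (inedge v j) q = next_good v q (Suc j)))"

lemma triple_tables:
  assumes d: "data \<sigma> 0 = d" and clear: "flags_clear 0 \<sigma>" and Q: "0 < nQ"
  shows "triple I \<sigma> (pairs_prog ;; next_prog) (4 + 30 * total_cost) (\<lambda>\<tau>. tables (data \<tau>))"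
proof (rule triple_Seq[where u = "2 + 11 * total_cost",
      OF triple_pairs[OF assms] triple_mono[OF triple_next]], goal_cases)
  case (1 \<tau>)
  then show ?case
    using Q by (auto simp: edges_done_def edge_ok_def)
next
  case (4 \<tau> \<rho>)
  have keep: "data \<rho> k = data \<tau> k" if "k < 7" for k
    using 4(3) that by (auto simp: agree_def next_prog_def)
  \<comment> \<open>A label above 1 has a tight transition into its pair, so some edge has stored a
    parent there.\<close>
  have par: "parent_ok \<tau> v q" if q: "1 < d v q" for v q
  proof -
    obtain e p where "e < nE" "etgt e = v" "(p, q) \<in> set (pairs e)"
      using d_pred[OF q] by (auto simp: set_pairs)
    moreover from this have "q \<in> targets e"
      by (force simp: targets_def)
    moreover have "\<forall>f<nE. \<forall>q\<in>targets f. parent_ok \<tau> (etgt f) q"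
      using 4(1) by (simp add: edges_done_def)
    ultimately show ?thesis
      by blast
  qed
  have "\<forall>e<nE. edge_ok \<tau> e"
    using 4(1) by (simp add: edges_done_def)
  with par 4(1,4) show ?case
    by (simp add: tables_def keep parent_ok_def edge_ok_def cell_ok_def suffix_ok_def)
qed (use Q in simp_all)

end

section \<open>Preprocessing\<close>

text \<open>A minimum over the final states in which 0 counts as infinity. Labels are distances plus
  one, which is also the output convention for register 0.\<close>

definition level_prog :: com where
  "level_prog = Assign 0 (Const 0) ;;
     For rJ (in0 NumFinal)
       (Assign rQ (in1 FinalState (Reg rJ)) ;; Assign rX (Data 0 (in0 Target) (Reg rQ)) ;;
        Cond (Conj (Neg (Eq (Reg rX) (Const 0)))
            (Neg (Conj (Neg (Eq (Reg 0) (Const 0))) (Neg (Lt (Reg rX) (Reg 0))))))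
          (Assign 0 (Reg rX) ;; Assign rP (Reg rQ)) Skip)"

definition first_walk_prog :: com where
  "first_walk_prog = Cond (Eq (Reg 0) (Const 0)) Skip
     ((Assign rV (in0 Target) ;; Assign rQ (Reg rP) ;; Assign rI (Dec (Reg 0)) ;;
       StoreWork 0 (Const 0) (Reg rI) (Reg rV)) ;;
      While (Lt (Const 0) (Reg rI))
        (Assign rE (Data 5 (Reg rV) (Reg rQ)) ;; Assign rQ (Data 6 (Reg rV) (Reg rQ)) ;;
         Assign rV (in1 EdgeSrc (Reg rE)) ;; Assign rI (Dec (Reg rI)) ;;
         StoreWork 0 (Const 1) (Reg rI) (Reg rE) ;; StoreWork 0 (Const 0) (Reg rI) (Reg rV) ;;
         StoreData 9 (Reg rI) (Const 0) (Reg rE)))"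

text \<open>Without states \<open>nfa_size\<close> can be 0 and the time bound a constant, while
  loops over vertices and edges would still run. That case is answered at once: no final state,
  hence no walk.\<close>

definition pre_prog :: com where
  "pre_prog = Cond (Eq (in0 NumStates) (Const 0)) (Assign 0 (Const 0))
     (bfs_prog ;; (pairs_prog ;; next_prog) ;; level_prog ;; first_walk_prog)"

context indexed_instance
begin

text \<open>Counted from the end of the walk: index 0 is \<open>v\<close>, and index
  \<open>j + 1\<close> is the source of the edge \<open>es ! j\<close>.\<close>

definition vertex :: "nat \<Rightarrow> nat list \<Rightarrow> nat \<Rightarrow> nat" where
  "vertex v es j = (v # map esrc es) ! j"

text \<open>The part \<open>es\<close> of a walk of length \<open>l\<close>, listed from its end, is in the output area.\<close>

definition holds_part :: "nat \<Rightarrow> nat list \<Rightarrow> state \<Rightarrow> bool" where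
  "holds_part l es \<sigma> \<longleftrightarrow> length es \<le> l \<and>
     (\<forall>j\<le>length es. work \<sigma> 0 0 (l - j) = vertex tV es j) \<and>
     (\<forall>j<length es. work \<sigma> 0 1 (l - Suc j) = es ! j)"

definition holds :: "nat list \<Rightarrow> state \<Rightarrow> bool" where
  "holds es \<sigma> \<longleftrightarrow> reg \<sigma> 0 = Suc (length es) \<and> holds_part (length es) es \<sigma>"

text \<open>Edges alone identify a walk that ends in \<open>t\<close>, so the end of the enumeration
  is detected by comparing edges.\<close>

definition stored :: "nat list \<Rightarrow> (nat \<Rightarrow> nat \<Rightarrow> nat \<Rightarrow> nat) \<Rightarrow> bool" where
  "stored es D \<longleftrightarrow> (\<forall>j<length es. D 9 (length es - Suc j) 0 = es ! j)"

lemma vertex_append: "j \<le> length es \<Longrightarrow> vertex v (es @ fs) j = vertex v es j"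
  by (cases j) (auto simp: vertex_def nth_append)

lemma vertex_snoc: "vertex v (es @ [e]) (Suc (length es)) = esrc e"
  by (simp add: vertex_def nth_append)

lemma holds_part_snoc:
  assumes part: "holds_part l es \<sigma>" and len: "length es < l"
    and e: "work \<tau> 0 0 = (work \<sigma> 0 0)(l - Suc (length es) := esrc e)"
      "work \<tau> 0 (Suc 0) = (work \<sigma> 0 (Suc 0))(l - Suc (length es) := e)"
  shows "holds_part l (es @ [e]) \<tau>"
  unfolding holds_part_def
proof (intro conjI allI impI)
  show "length (es @ [e]) \<le> l"
    using len by simp
next
  fix j
  assume j: "j \<le> length (es @ [e])"
  show "work \<tau> 0 0 (l - j) = vertex tV (es @ [e]) j"
  proof (cases "j = Suc (length es)")
    case False
    then have "l - j \<noteq> l - Suc (length es)" "j \<le> length es"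
      using j len by auto
    then show ?thesis
      using part by (simp add: e holds_part_def vertex_append)
  qed (simp add: e vertex_snoc)
next
  fix j
  assume j: "j < length (es @ [e])"
  show "work \<tau> 0 1 (l - Suc j) = (es @ [e]) ! j"
  proof (cases "j = length es")
    case False
    then have "l - Suc j \<noteq> l - Suc (length es)" "j < length es"
      using j len by auto
    then show ?thesis
      using part by (simp add: e holds_part_def nth_append)
  qed (simp add: e)
qed

end

context distances
begin

lemma triple_level:
  assumes "data \<sigma> 0 = d"
  shows "triple I \<sigma> level_prog (3 + 9 * nQ) (\<lambda>\<tau>. reg \<tau> 0 = 0 \<and> (\<forall>q\<in>finals. d tV q = 0) \<or>
    (\<exists>l. reg \<tau> 0 = Suc l \<and> level l \<and> reg \<tau> rP \<in> roots l))"
proof -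
  let ?Inv = "\<lambda>i \<tau>. reg \<tau> 0 = 0 \<and> (\<forall>j<i. d tV (fin j) = 0) \<or>
    reg \<tau> 0 \<noteq> 0 \<and> (\<exists>j<i. reg \<tau> rP = fin j) \<and> d tV (reg \<tau> rP) = reg \<tau> 0 \<and>
      (\<forall>j<i. d tV (fin j) \<noteq> 0 \<longrightarrow> reg \<tau> 0 \<le> d tV (fin j))"
  let ?body = "Assign rQ (in1 FinalState (Reg rJ)) ;; Assign rX (Data 0 (in0 Target) (Reg rQ)) ;;
        Cond (Conj (Neg (Eq (Reg rX) (Const 0)))
            (Neg (Conj (Neg (Eq (Reg 0) (Const 0))) (Neg (Lt (Reg rX) (Reg 0))))))
          (Assign 0 (Reg rX) ;; Assign rP (Reg rQ)) Skip"
  have "triple I (exec I (Assign 0 (Const 0)) \<sigma>) (For rJ (in0 NumFinal) ?body) (2 + 8 * nfin)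
    (\<lambda>\<tau>. ?Inv nfin \<tau> \<and> reg \<tau> rJ = nfin)"
  proof (rule triple_For[where t = "\<lambda>_. 6"], goal_cases)
    case (4 i \<tau>)
    let ?\<rho> = "exec I ?body \<tau>"
    have D: "data \<tau> 0 = d"
      using 4(4) assms by (simp add: agree_def)
    have r: "reg ?\<rho> 0 = (if d tV (fin i) \<noteq> 0 \<and> (reg \<tau> 0 = 0 \<or> d tV (fin i) < reg \<tau> 0)
        then d tV (fin i) else reg \<tau> 0)"
      "reg ?\<rho> rP = (if d tV (fin i) \<noteq> 0 \<and> (reg \<tau> 0 = 0 \<or> d tV (fin i) < reg \<tau> 0)
        then fin i else reg \<tau> rP)"
      using 4(3) D by auto
    have "?Inv (Suc i) ?\<rho>"
    proof (cases "d tV (fin i) \<noteq> 0 \<and> (reg \<tau> 0 = 0 \<or> d tV (fin i) < reg \<tau> 0)")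
      case True
      then have \<rho>: "reg ?\<rho> 0 = d tV (fin i)" "reg ?\<rho> rP = fin i"
        by (simp_all only: r if_True simp_thms)
      have "d tV (fin i) \<le> d tV (fin j)" if "j < Suc i" "d tV (fin j) \<noteq> 0" for j
      proof (cases "j = i")
        case False
        then have "j < i"
          using that(1) by simp
        with 4(2) that(2) have "reg \<tau> 0 \<noteq> 0 \<and> reg \<tau> 0 \<le> d tV (fin j)"
          by (cases "reg \<tau> 0 = 0") simp_all
        then show ?thesis
          using True by linarith
      qed simp
      then show ?thesis
        unfolding \<rho> using True by blast
    next
      case False
      then have \<rho>: "reg ?\<rho> 0 = reg \<tau> 0" "reg ?\<rho> rP = reg \<tau> rP"
        by (simp_all only: r if_False)
      show ?thesis
        unfolding \<rho> using 4(2) False by (auto simp: less_Suc_eq not_less)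
    qed
    then show ?case
      by (intro triple_straight) (simp_all del: exec.simps)
  qed simp_all
  then have main: "triple I \<sigma> level_prog (3 + 8 * nfin) (\<lambda>\<tau>. ?Inv nfin \<tau> \<and> reg \<tau> rJ = nfin)"
    unfolding level_prog_def by (intro triple_straight_Seq) simp_all
  have "nfin \<le> nQ"
    using card_inj_on_le[OF inj_fin, of "{..<nQ}"] fin by auto
  show ?thesis
  proof (rule triple_mono[OF main], goal_cases)
    case (2 \<tau>)
    show ?case
    proof (cases "reg \<tau> 0")
      case 0
      then show ?thesis
        using 2(2) by auto
    next
      case (Suc l)
      then have a: "\<exists>j<nfin. reg \<tau> rP = fin j" "d tV (reg \<tau> rP) = Suc l"
        "\<And>j. j < nfin \<Longrightarrow> d tV (fin j) \<noteq> 0 \<Longrightarrow> Suc l \<le> d tV (fin j)"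
        using 2(2) by simp_all
      then have "reg \<tau> rP \<in> roots l"
        by (auto simp: roots_def)
      moreover from this have "level l"
        unfolding level_def using a(3) by (auto simp: roots_def)
      ultimately show ?thesis
        using Suc by blast
    qed
  qed (use \<open>nfin \<le> nQ\<close> in simp)
qed

text \<open>The last conjunct says that whatever completes the current pair completes the whole
  walk. This spares the invariant the sequence of states passed so far.\<close>

definition first_inv :: "nat \<Rightarrow> nat list \<Rightarrow> state \<Rightarrow> bool" where
  "first_inv l es \<sigma> \<longleftrightarrow> holds_part l es \<sigma> \<and> reg \<sigma> rI = l - length es \<and>
     (\<forall>j<length es. data \<sigma> 9 (l - Suc j) 0 = es ! j) \<and>
     d (reg \<sigma> rV) (reg \<sigma> rQ) = Suc (l - length es) \<and>
     (\<forall>fs. accepted fs (reg \<sigma> rV) (reg \<sigma> rQ) \<longrightarrow> matching (es @ fs))"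

lemma triple_first_walk:
  assumes T: "tables (data \<sigma>)" and l: "reg \<sigma> 0 = Suc l" and lev: "level l" and P: "reg \<sigma> rP \<in> roots l"
  shows "triple I \<sigma> first_walk_prog (7 + 8 * (nV * nQ)) (\<lambda>\<tau>. tables (data \<tau>) \<and>
    (\<exists>es. length es = l \<and> matching es \<and> holds es \<tau> \<and> stored es (data \<tau>)))"
proof -
  let ?init = "Assign rV (in0 Target) ;; Assign rQ (Reg rP) ;; Assign rI (Dec (Reg 0)) ;;
       StoreWork 0 (Const 0) (Reg rI) (Reg rV)"
  let ?body = "Assign rE (Data 5 (Reg rV) (Reg rQ)) ;; Assign rQ (Data 6 (Reg rV) (Reg rQ)) ;;
         Assign rV (in1 EdgeSrc (Reg rE)) ;; Assign rI (Dec (Reg rI)) ;;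
         StoreWork 0 (Const 1) (Reg rI) (Reg rE) ;; StoreWork 0 (Const 0) (Reg rI) (Reg rV) ;;
         StoreData 9 (Reg rI) (Const 0) (Reg rE)"
  let ?\<sigma> = "exec I ?init \<sigma>"
  let ?J = "\<lambda>m \<tau>. \<exists>es. first_inv l es \<tau> \<and> m = 8 * (l - length es)"
  have dP: "d tV (reg \<sigma> rP) = Suc l" "reg \<sigma> rP \<in> finals"
    using P by (auto simp: roots_def)
  have loop: "triple I ?\<sigma> (While (Lt (Const 0) (Reg rI)) ?body) (Suc (8 * l))
    (\<lambda>\<tau>. (\<exists>m\<le>8 * l. ?J m \<tau>) \<and> \<not> bval I \<tau> (Lt (Const 0) (Reg rI)))"
  proof (rule triple_While, goal_cases)
    case (1 m \<tau>)
    then obtain es where inv: "first_inv l es \<tau>" and m: "m = 8 * (l - length es)"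
      by blast
    let ?v = "reg \<tau> rV"
    let ?q = "reg \<tau> rQ"
    let ?e = "data \<tau> 5 ?v ?q"
    let ?p = "data \<tau> 6 ?v ?q"
    define i where "i = l - Suc (length es)"
    have len: "length es < l" "reg \<tau> rI = Suc i" "l - length es = Suc i"
      using 1(2) inv by (auto simp: first_inv_def i_def)
    have d: "d ?v ?q = Suc (Suc i)"
      using inv len by (simp add: first_inv_def)
    have "data \<tau> 5 = data \<sigma> 5" "data \<tau> 6 = data \<sigma> 6"
      using 1(3) by (auto simp: agree_def)
    then have e: "?e < nE" "etgt ?e = ?v" "(?p, ?q) \<in> set (pairs ?e)"
      using T[unfolded tables_def, THEN conjunct2, THEN conjunct2, THEN conjunct1, rule_format, of ?v ?q] d
      by simp_all
    define \<rho> where "\<rho> = exec I ?body \<tau>"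
    have R: "reg \<rho> rV = esrc ?e" "reg \<rho> rQ = ?p" "reg \<rho> rI = i"
      "data \<rho> 9 = (data \<tau> 9)(i := (data \<tau> 9 i)(0 := ?e))"
      "work \<rho> 0 0 = (work \<tau> 0 0)(i := esrc ?e)"
      "work \<rho> 0 (Suc 0) = (work \<tau> 0 (Suc 0))(i := ?e)"
      using len by (simp_all add: \<rho>_def upd_def)
    have "first_inv l (es @ [?e]) \<rho>"
      unfolding first_inv_def
    proof (intro conjI allI impI)
      show "holds_part l (es @ [?e]) \<rho>"
        using inv len(1) R(5,6) by (intro holds_part_snoc[of l es \<tau>]) (auto simp: first_inv_def i_def)
      show "reg \<rho> rI = l - length (es @ [?e])"
        by (simp add: R i_def)
      show "d (reg \<rho> rV) (reg \<rho> rQ) = Suc (l - length (es @ [?e]))"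
        using e(3) d e(2) by (simp add: R set_pairs i_def)
    next
      fix j
      assume "j < length (es @ [?e])"
      then consider "j = length es" | "j < length es" "l - Suc j \<noteq> i"
        using len(1) by (auto simp: i_def less_Suc_eq)
      then show "data \<rho> 9 (l - Suc j) 0 = (es @ [?e]) ! j"
        using inv by cases (auto simp: R first_inv_def nth_append i_def)
    next
      fix fs
      assume "accepted fs (reg \<rho> rV) (reg \<rho> rQ)"
      then have "accepted (?e # fs) ?v ?q"
        using e by (auto simp: R set_pairs)
      then show "matching ((es @ [?e]) @ fs)"
        using inv by (simp add: first_inv_def)
    qed
    then have "\<exists>m'. ?J m' \<rho> \<and> Suc 7 + m' \<le> m"
      using m len by (intro exI[of _ "8 * i"] conjI exI[of _ "es @ [?e]"]) (auto simp: i_def)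
    then show ?case
      unfolding \<rho>_def by (intro exI[of _ 7], intro triple_straight) (simp, simp, assumption)
  next
    case 2
    have "matching fs" if "accepted fs tV (reg \<sigma> rP)" for fs
      using that dP(2) by (auto simp: matching_def)
    then have "first_inv l [] ?\<sigma>"
      using l dP by (simp add: first_inv_def holds_part_def vertex_def upd_def)
    then show ?case
      by (intro exI[of _ "[]"]) simp
  qed
  \<comment> \<open>Following the parents takes 8 steps per edge; this bound keeps the total within
    the preprocessing time.\<close>
  have l_le: "l \<le> nV * nQ"
    using label_le[OF dP(1)] by simp
  show ?thesis
    unfolding first_walk_prog_def
  proof (rule triple_Cond[where t = "5 + 8 * l"])
    show "triple I \<sigma> (?init ;; While (Lt (Const 0) (Reg rI)) ?body) (5 + 8 * l) (\<lambda>\<tau>. tables (data \<tau>) \<and>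
      (\<exists>es. length es = l \<and> matching es \<and> holds es \<tau> \<and> stored es (data \<tau>)))"
    proof (rule triple_straight_Seq[where u = "Suc (8 * l)", OF _ _ triple_mono[OF loop]], goal_cases)
      case (4 \<tau>)
      then obtain es where inv: "first_inv l es \<tau>" "\<not> 0 < reg \<tau> rI"
        by auto
      then have len: "length es = l"
        by (auto simp: first_inv_def holds_part_def)
      then have "d (reg \<tau> rV) (reg \<tau> rQ) = 1"
        using inv by (simp add: first_inv_def)
      then have acc: "accepted [] (reg \<tau> rV) (reg \<tau> rQ)"
        using d_1 by simp
      have "matching (es @ [])"
        using inv(1)[unfolded first_inv_def, THEN conjunct2, THEN conjunct2, THEN conjunct2, THEN conjunct2]
          acc by (simp only: simp_thms)
      then have "matching es"
        by simp
      moreover have keep: "data \<tau> k = data \<sigma> k" if "k < 9" for k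
        using 4(1) that by (simp add: agree_def)
      moreover have "tables (data \<tau>)"
        using T by (simp add: tables_def keep)
      moreover have "reg \<tau> 0 = Suc l"
        using 4(1) l by (simp add: agree_def)
      ultimately show ?case
        using inv(1) len by (auto simp: holds_def stored_def first_inv_def)
    qed simp_all
  qed (use l l_le in simp_all)
qed

end

context indexed_instance
begin

lemma triple_pre:
  "triple I init_state pre_prog (76 * total_cost + 25) (\<lambda>\<tau>.
     reg \<tau> 0 = 0 \<and> (\<forall>es. \<not> matching es) \<or>
     (\<exists>d l es. distances I d \<and> distances.tables I d (data \<tau>) \<and> distances.level I d l \<and>
       length es = l \<and> matching es \<and> holds es \<tau> \<and> stored es (data \<tau>)))"
  (is "triple I init_state _ ?t ?Q")
proof (cases "nQ = 0")
  case True
  then have "nfin = 0"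
    using fin[of 0] by (cases nfin) auto
  then have "\<not> matching es" for es
    by (simp add: matching_def)
  then show ?thesis
    unfolding pre_prog_def using True
    by (intro triple_Cond[where t = 1] triple_straight) simp_all
next
  case False
  \<comment> \<open>The source is a vertex, so terms in \<open>nQ\<close> are absorbed by
    \<open>total_cost\<close>. The constant 76 arises as 58 + 18, from 58 times
    \<open>total_cost\<close> and 18 times \<open>nQ\<close>.\<close>
  have nQ: "nQ \<le> total_cost"
  proof -
    have "0 < nV"
      using sV by simp
    then have "nQ \<le> nV * nQ"
      by simp
    also have "\<dots> \<le> total_cost"
      unfolding total_cost_def by (rule le_add1)
    finally show ?thesis .
  qed
  have VQ: "nV * nQ \<le> total_cost"
    by (simp add: total_cost_def)
  have lw: "triple I \<tau> (level_prog ;; first_walk_prog) (10 + 9 * nQ + 8 * (nV * nQ)) ?Q"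
    if d: "distances I d" and T: "distances.tables I d (data \<tau>)" for \<tau> d
  proof -
    interpret distances I d by (rule d)
    have "data \<tau> 0 = d"
      using T by (simp add: tables_def)
    from triple_level[OF this] show ?thesis
    proof (rule triple_Seq[where u = "7 + 8 * (nV * nQ)"], goal_cases)
      case (1 \<rho>)
      have D: "data \<rho> = data \<tau>"
        using 1(2) by (auto simp: agree_def level_prog_def)
      from 1(1) show ?case
      proof (elim disjE exE conjE)
        assume "reg \<rho> 0 = 0" "\<forall>q\<in>finals. d tV q = 0"
        then have "?Q \<rho>"
          using not_matching by simp
        then show "triple I \<rho> first_walk_prog (7 + 8 * (nV * nQ)) ?Q"
          unfolding first_walk_prog_def using \<open>reg \<rho> 0 = 0\<close>
          by (intro triple_Cond[where t = "1"] triple_straight) simp_all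
      next
        fix l
        assume l: "reg \<rho> 0 = Suc l" "level l" "reg \<rho> rP \<in> roots l"
        have "tables (data \<rho>)"
          using T D by simp
        from triple_first_walk[OF this l] show "triple I \<rho> first_walk_prog (7 + 8 * (nV * nQ)) ?Q"
          by (rule triple_mono) (use d l(2) in blast)+
      qed
    qed simp
  qed
  have tab: "triple I \<tau> ((pairs_prog ;; next_prog) ;; level_prog ;; first_walk_prog)
      (14 + 9 * nQ + 38 * total_cost) ?Q"
    if d: "distances I (data \<tau> 0)" and clear: "\<forall>e q. data \<tau> 4 e q = 0" for \<tau>
  proof -
    interpret distances I "data \<tau> 0" by (rule d)
    have "flags_clear 0 \<tau>"
      using clear by (simp add: flags_clear_def)
    from triple_tables[OF refl this] False
    have "triple I \<tau> (pairs_prog ;; next_prog) (4 + 30 * total_cost) (\<lambda>\<tau>'. tables (data \<tau>'))"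
      by simp
    then show ?thesis
      by (rule triple_Seq[OF _ lw[OF d]]) (use VQ in auto)
  qed
  have "triple I init_state (bfs_prog ;; (pairs_prog ;; next_prog) ;; level_prog ;; first_walk_prog)
    (23 + 18 * nQ + 58 * total_cost) ?Q"
  proof (rule triple_Seq[where u = "14 + 9 * nQ + 38 * total_cost", OF triple_bfs], goal_cases)
    case (2 \<tau>)
    have "data \<tau> 4 = data init_state 4"
      using 2(2) by (simp add: agree_def bfs_prog_def expand_prog_def)
    then show ?case
      using tab[OF 2(1)] by (simp add: init_state_def)
  qed (simp_all add: init_state_def)
  then show ?thesis
    unfolding pre_prog_def
    by (rule triple_Cond[rotated]) (use False nQ in simp_all)
qed

end

section \<open>From one walk to the next\<close>

text \<open>Work tables hold arbitrary values when \<open>nxt_prog\<close> starts, so the row is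
  cleared first. The root set and the later sets differ only in the list run through, the filter and
  the state entered.\<close>

definition fill_prog :: "aexp \<Rightarrow> bexp \<Rightarrow> aexp \<Rightarrow> aexp \<Rightarrow> com" where
  "fill_prog N b a x = For rQ (in0 NumStates) (StoreWork 3 a (Reg rQ) (Const 0)) ;;
     For rJ N (Cond b (StoreWork 3 a x (Const 1)) Skip)"

definition roots_prog :: com where
  "roots_prog = fill_prog (in0 NumFinal)
     (Eq (Data 0 (in0 Target) (in1 FinalState (Reg rJ))) (Reg 0)) (Reg rI) (in1 FinalState (Reg rJ))"

definition step_prog :: com where
  "step_prog = fill_prog (Data 1 (Reg rE) (Const 0))
     (Neg (Eq (Work 3 (Reg rI) (Data 3 (Reg rE) (Reg rJ))) (Const 0))) (Dec (Reg rI)) (Data 2 (Reg rE) (Reg rJ))"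

text \<open>The expression \<open>x\<close> mentions \<open>rQ\<close> and is evaluated for each
  state of the row. In \<open>x\<close> as well as in \<open>rX\<close>, 0 counts as
  infinity.\<close>

definition min_prog :: "aexp \<Rightarrow> com" where
  "min_prog x = Assign rX (Const 0) ;;
     For rQ (in0 NumStates) (Cond (Conj (Neg (Eq (Work 3 (Reg rI) (Reg rQ)) (Const 0)))
         (Conj (Neg (Eq x (Const 0))) (Neg (Conj (Neg (Eq (Reg rX) (Const 0))) (Neg (Lt x (Reg rX)))))))
       (Assign rX x) Skip)"

definition take_prog :: com where
  "take_prog = (Assign rE (in2 InEdge (Reg rV) (Dec (Reg rX))) ;; Assign rV (in1 EdgeSrc (Reg rE)) ;;
      StoreWork 0 (Const 1) (Dec (Reg rI)) (Reg rE) ;; StoreWork 0 (Const 0) (Dec (Reg rI)) (Reg rV)) ;;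
     step_prog ;; Assign rI (Dec (Reg rI))"

definition descend_prog :: com where
  "descend_prog = While (Lt (Const 0) (Reg rI)) (min_prog (Data 8 (Reg rV) (Reg rQ)) ;; take_prog)"

text \<open>The whole walk is scanned: later branching vertices overwrite \<open>rB\<close> and
  \<open>rN\<close>, so the one farthest from \<open>t\<close> survives.\<close>

definition scan_prog :: com where
  "scan_prog = While (Lt (Const 0) (Reg rI))
     ((Assign rV (Work 0 (Const 0) (Reg rI)) ;; Assign rE (Work 0 (Const 1) (Dec (Reg rI)))) ;;
      min_prog (Data 7 (Reg rE) (Reg rQ)) ;;
      Cond (Eq (Reg rX) (Const 0)) Skip (Assign rB (Reg rI) ;; Assign rN (Reg rX)) ;;
      step_prog ;; Assign rI (Dec (Reg rI)))"

definition compare_prog :: com where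
  "compare_prog = Assign rC (Const 0) ;;
     For rJ (Dec (Reg 0)) (Cond (Eq (Work 0 (Const 1) (Reg rJ)) (Data 9 (Reg rJ) (Const 0))) Skip (Assign rC (Const 1))) ;;
     Cond (Eq (Reg rC) (Const 0)) (Assign 0 (Const 0)) Skip"

text \<open>A walk of length 0 is the only output and has no edge to branch at, hence the test
  whether register 0 is 1. The value of \<open>rN\<close> set before the scan is the first usable
  edge at \<open>t\<close>, where the traversal wraps around.\<close>

definition nxt_prog :: com where
  "nxt_prog = Cond (Eq (Reg 0) (Const 1)) (Assign 0 (Const 0))
     ((Assign rI (Dec (Reg 0)) ;; Assign rB (Reg rI) ;; Assign rV (in0 Target)) ;;
      roots_prog ;; min_prog (Data 8 (Reg rV) (Reg rQ)) ;; Assign rN (Reg rX) ;;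
      scan_prog ;;
      (Assign rI (Reg rB) ;; Assign rV (Work 0 (Const 0) (Reg rI)) ;; Assign rX (Reg rN)) ;;
      take_prog ;; descend_prog ;; compare_prog)"

lemma agree_data_eq: "agree c \<sigma> \<tau> \<Longrightarrow> data_mods c = {} \<Longrightarrow> data \<tau> = data \<sigma>"
  by (simp add: agree_def fun_eq_iff)

lemma fill_prog_mods [simp]:
  "reg_mods (fill_prog N b a x) = {rQ, rJ}" "data_mods (fill_prog N b a x) = {}"
  "work_mods (fill_prog N b a x) = {3}" "preserves_data (fill_prog N b a x)"
  by (auto simp: fill_prog_def)

lemma step_prog_mods [simp]:
  "reg_mods step_prog = {rQ, rJ}" "data_mods step_prog = {}" "work_mods step_prog = {3}"
  "preserves_data step_prog"
  by (auto simp: step_prog_def)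

lemma min_prog_mods [simp]:
  "reg_mods (min_prog x) = {rQ, rX}" "data_mods (min_prog x) = {}" "work_mods (min_prog x) = {}"
  "preserves_data (min_prog x)"
  by (auto simp: min_prog_def)

lemma take_prog_mods [simp]:
  "reg_mods take_prog = {rQ, rJ, rE, rV, rI}" "data_mods take_prog = {}" "work_mods take_prog = {0, 3}"
  "preserves_data take_prog"
  by (auto simp: take_prog_def)

lemma descend_prog_mods [simp]:
  "reg_mods descend_prog = {rQ, rJ, rE, rV, rI, rX}" "data_mods descend_prog = {}"
  "work_mods descend_prog = {0, 3}" "preserves_data descend_prog"
  by (auto simp: descend_prog_def)

lemma scan_prog_mods [simp]:
  "reg_mods scan_prog = {rQ, rJ, rE, rV, rI, rX, rB, rN}" "data_mods scan_prog = {}"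
  "work_mods scan_prog = {3}" "preserves_data scan_prog"
  by (auto simp: scan_prog_def)

lemma compare_prog_mods [simp]:
  "reg_mods compare_prog = {rC, rJ, 0}" "data_mods compare_prog = {}"
  "work_mods compare_prog = {}" "preserves_data compare_prog"
  by (auto simp: compare_prog_def)

lemma preserves_data_nxt: "preserves_data nxt_prog"
  by (simp add: nxt_prog_def roots_prog_def)

lemma next_pos_eqI:
  assumes "i \<le> j" "j < n" "P j" "\<And>k. i \<le> k \<Longrightarrow> k < j \<Longrightarrow> \<not> P k"
  shows "next_pos P n i = Suc j"
proof -
  have "next_pos P n i \<noteq> 0 \<and> next_pos P n i \<le> Suc j"
    using assms(1-3) by (rule next_pos_le)
  then obtain k where k: "next_pos P n i = Suc k" "k \<le> j"
    by (cases "next_pos P n i") auto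
  then show ?thesis
    using next_pos_Suc[OF k(1)] assms(4)[of k] by (cases "k = j") auto
qed

lemma next_pos_less: "next_pos P n i = Suc j \<Longrightarrow> i \<le> k \<Longrightarrow> k < j \<Longrightarrow> \<not> P k"
  using next_pos_le[of i k n P] next_pos_Suc(2)[of P n i j] by fastforce

text \<open>A minimum with 0 as infinity: the step by which \<open>min_prog\<close> takes one more
  state into account.\<close>

lemma next_pos_disj:
  "next_pos (\<lambda>j. P j \<or> R j) n i = (if next_pos R n i \<noteq> 0 \<and> (next_pos P n i = 0 \<or> next_pos R n i < next_pos P n i)
     then next_pos R n i else next_pos P n i)"
proof (cases "next_pos R n i")
  case 0
  then have R: "\<not> R j" if "i \<le> j" "j < n" for j
    using that unfolding next_pos_zero by simp
  show ?thesis
  proof (cases "next_pos P n i")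
    case P0: 0
    then have "next_pos (\<lambda>j. P j \<or> R j) n i = 0"
      using R unfolding next_pos_zero by simp
    then show ?thesis using 0 P0 by simp
  next
    case (Suc j)
    have "next_pos (\<lambda>j. P j \<or> R j) n i = Suc j"
      using next_pos_Suc[OF Suc] next_pos_less[OF Suc] R by (intro next_pos_eqI) auto
    then show ?thesis using 0 Suc by simp
  qed
next
  case r: (Suc r)
  note R = next_pos_Suc[OF r] next_pos_less[OF r]
  show ?thesis
  proof (cases "next_pos P n i")
    case 0
    then have P: "\<not> P j" if "i \<le> j" "j < n" for j
      using that unfolding next_pos_zero by simp
    have "next_pos (\<lambda>j. P j \<or> R j) n i = Suc r"
      using R P by (intro next_pos_eqI) auto
    then show ?thesis using 0 r by simp
  next
    case p: (Suc p)
    note P = next_pos_Suc[OF p] next_pos_less[OF p]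
    have "next_pos (\<lambda>j. P j \<or> R j) n i = Suc (min p r)"
      using R P by (intro next_pos_eqI) (auto simp: min_def split: if_splits)
    then show ?thesis using p r by (auto simp: min_def)
  qed
qed

section \<open>The cost of one level of the tree\<close>

context indexed_instance
begin

definition nD :: nat where
  "nD = (\<Sum>p<nQ. \<Sum>a<nL. nsuc p a)"

text \<open>An edge carries no letter twice, so each letter contributes the successors of
  \<open>p\<close> at most once.\<close>

lemma length_succs: "e < nE \<Longrightarrow> length (succs e p) \<le> (\<Sum>a<nL. nsuc p a)"
proof -
  assume e: "e < nE"
  have "length (succs e p) = (\<Sum>l<nlab e. nsuc p (lab e l))"
    by (simp add: succs_def length_concat comp_def interv_sum_list_conv_sum_set_nat atLeast0LessThan)
  also have "\<dots> = sum (nsuc p) (lab e ` {..<nlab e})"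
    using sum.reindex[OF inj_lab[OF e], of "nsuc p"] by simp
  also have "\<dots> \<le> (\<Sum>a<nL. nsuc p a)"
    using lab[OF e] by (intro sum_mono2) auto
  finally show ?thesis .
qed

end

context distances
begin

text \<open>Here the delay becomes independent of \<open>D\<close>: crossing an edge takes at most
  one round per transition of \<open>A\<close>, however many labels the edge has.\<close>

lemma length_pairs: "e < nE \<Longrightarrow> length (pairs e) \<le> nD"
proof -
  assume e: "e < nE"
  have "length (pairs e) \<le> length (arcs e)"
    by (simp add: pairs_def)
  also have "\<dots> = (\<Sum>p<nQ. length (succs e p))"
    by (simp add: arcs_def length_concat comp_def interv_sum_list_conv_sum_set_nat atLeast0LessThan)
  also have "\<dots> \<le> nD"
    unfolding nD_def by (rule sum_mono) (rule length_succs[OF e])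
  finally show ?thesis .
qed

definition row_is :: "nat \<Rightarrow> nat set \<Rightarrow> state \<Rightarrow> bool" where
  "row_is i S \<sigma> \<longleftrightarrow> (\<forall>q<nQ. work \<sigma> 3 i q \<noteq> 0 \<longleftrightarrow> q \<in> S)"

text \<open>Sharper than \<open>agree\<close>: within table 3 only row \<open>i\<close> changes. The
  rows written earlier along a walk are read again when the enumeration returns to a branching
  vertex.\<close>

definition stable :: "nat \<Rightarrow> state \<Rightarrow> state \<Rightarrow> bool" where
  "stable i \<sigma> \<tau> \<longleftrightarrow> (\<forall>r. r \<notin> {rQ, rJ} \<longrightarrow> reg \<tau> r = reg \<sigma> r) \<and> data \<tau> = data \<sigma> \<and>
     (\<forall>k. k \<noteq> 3 \<longrightarrow> work \<tau> k = work \<sigma> k) \<and> (\<forall>k. k \<noteq> i \<longrightarrow> work \<tau> 3 k = work \<sigma> 3 k)"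

text \<open>The four expressions are evaluated in changing states, so their values are demanded in
  every state that differs from \<open>\<sigma>\<close> as \<open>stable\<close> permits. In
  \<open>step_prog\<close> the filter reads row \<open>i + 1\<close>, which filling row
  \<open>i\<close> leaves intact.\<close>

lemma triple_fill:
  assumes N: "\<And>\<tau>. stable i \<sigma> \<tau> \<Longrightarrow> aval I \<tau> N = n" and a: "\<And>\<tau>. stable i \<sigma> \<tau> \<Longrightarrow> aval I \<tau> a = i"
    and b: "\<And>\<tau> j. stable i \<sigma> \<tau> \<Longrightarrow> j < n \<Longrightarrow> reg \<tau> rJ = j \<Longrightarrow> bval I \<tau> b \<longleftrightarrow> P j"
    and x: "\<And>\<tau> j. stable i \<sigma> \<tau> \<Longrightarrow> j < n \<Longrightarrow> reg \<tau> rJ = j \<Longrightarrow> aval I \<tau> x = f j"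
  shows "triple I \<sigma> (fill_prog N b a x) (4 + 3 * nQ + 5 * n)
    (\<lambda>\<tau>. row_is i (f ` {j. j < n \<and> P j}) \<tau> \<and> stable i \<sigma> \<tau>)"
proof -
  have "triple I \<sigma> (For rQ (in0 NumStates) (StoreWork 3 a (Reg rQ) (Const 0))) (2 + 3 * nQ)
    (\<lambda>\<tau>. ((\<forall>q<nQ. work \<tau> 3 i q = 0) \<and> stable i \<sigma> \<tau>) \<and> reg \<tau> rQ = nQ)"
  proof (rule triple_For[where t = "\<lambda>_. 1" and Inv = "\<lambda>k \<tau>. (\<forall>q<k. work \<tau> 3 i q = 0) \<and> stable i \<sigma> \<tau>"], goal_cases)
    case 1
    show ?case by (simp add: stable_def)
  next
    case (4 k \<tau>)
    show ?case
      using 4(2,3) a[of \<tau>] by (intro triple_straight) (auto simp: stable_def upd_def less_Suc_eq)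
  qed simp_all
  then show ?thesis
    unfolding fill_prog_def
  proof (rule triple_Seq[where u = "2 + 5 * n"], goal_cases)
    case (1 \<rho>)
    have "triple I \<rho> (For rJ N (Cond b (StoreWork 3 a x (Const 1)) Skip)) (2 + 5 * n)
      (\<lambda>\<tau>. (row_is i (f ` {j. j < n \<and> P j}) \<tau> \<and> stable i \<sigma> \<tau>) \<and> reg \<tau> rJ = n)"
    proof (rule triple_For[where t = "\<lambda>_. 3" and Inv = "\<lambda>k \<tau>. row_is i (f ` {j. j < k \<and> P j}) \<tau> \<and> stable i \<sigma> \<tau>"],
        goal_cases)
      case 1
      show ?case using \<open>(_ \<and> _) \<and> _\<close> by (auto simp: row_is_def stable_def)
    next
      case (4 k \<tau>)
      have "{j. j < Suc k \<and> P j} = (if P k then insert k {j. j < k \<and> P j} else {j. j < k \<and> P j})"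
        by (auto simp: less_Suc_eq)
      then show ?case
        using 4(2) a[of \<tau>] b[OF _ 4(1,3)] x[OF _ 4(1,3)]
        by (intro triple_straight) (auto simp: row_is_def stable_def upd_def)
    qed (use N in auto)
    then show ?case
      by (rule triple_mono) auto
  qed simp
qed

lemma triple_roots:
  assumes T: "tables (data \<sigma>)" and l: "reg \<sigma> 0 = Suc l"
  shows "triple I \<sigma> roots_prog (4 + 8 * nQ) (row_is (reg \<sigma> rI) (roots l))"
proof -
  have "nfin \<le> nQ"
    using card_inj_on_le[OF inj_fin, of "{..<nQ}"] fin by auto
  moreover have "fin ` {j. j < nfin \<and> d tV (fin j) = Suc l} = roots l"
    by (auto simp: roots_def)
  moreover have "data \<sigma> 0 = d"
    using T by (simp add: tables_def)
  ultimately show ?thesis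
    unfolding roots_prog_def
    by (intro triple_mono[OF triple_fill[where n = nfin and i = "reg \<sigma> rI" and f = fin
            and P = "\<lambda>j. d tV (fin j) = Suc l"]])
      (simp_all add: stable_def l)
qed

lemma triple_step:
  assumes T: "tables (data \<sigma>)" and e: "reg \<sigma> rE = e" "e < nE"
    and i: "reg \<sigma> rI = Suc i" and row: "row_is (Suc i) S \<sigma>"
  shows "triple I \<sigma> step_prog (4 + 3 * nQ + 5 * nD)
    (\<lambda>\<tau>. row_is i (step e S) \<tau> \<and> (\<forall>k. k \<noteq> i \<longrightarrow> work \<tau> 3 k = work \<sigma> 3 k))"
proof -
  let ?n = "length (pairs e)"
  have D: "data \<sigma> (Suc 0) e 0 = ?n"
    "\<And>k. k < ?n \<Longrightarrow> data \<sigma> 2 e k = fst (pairs e ! k)" "\<And>k. k < ?n \<Longrightarrow> data \<sigma> 3 e k = snd (pairs e ! k)"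
    using T[unfolded tables_def, THEN conjunct2, THEN conjunct1, rule_format, OF e(2)] by auto
  have less: "snd (pairs e ! k) < nQ" if "k < ?n" for k
    using pairs_less[OF e(2), of "fst (pairs e ! k)" "snd (pairs e ! k)"] nth_mem[OF that] by simp
  have im: "(\<lambda>k. fst (pairs e ! k)) ` {k. k < ?n \<and> snd (pairs e ! k) \<in> S} = step e S"
  proof (intro set_eqI iffI)
    fix p
    assume "p \<in> (\<lambda>k. fst (pairs e ! k)) ` {k. k < ?n \<and> snd (pairs e ! k) \<in> S}"
    then obtain k where "p = fst (pairs e ! k)" "k < ?n" "snd (pairs e ! k) \<in> S"
      by auto
    then show "p \<in> step e S"
      using nth_mem[of k "pairs e"] by (auto simp: step_def intro!: bexI[of _ "snd (pairs e ! k)"])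
  next
    fix p
    assume "p \<in> step e S"
    then obtain q where "q \<in> S" "(p, q) \<in> set (pairs e)"
      by (auto simp: step_def)
    moreover from this(2) obtain k where "k < ?n" "pairs e ! k = (p, q)"
      by (auto simp: in_set_conv_nth)
    ultimately show "p \<in> (\<lambda>k. fst (pairs e ! k)) ` {k. k < ?n \<and> snd (pairs e ! k) \<in> S}"
      by (auto simp: image_iff intro!: exI[of _ k])
  qed
  have "triple I \<sigma> step_prog (4 + 3 * nQ + 5 * ?n)
    (\<lambda>\<tau>. row_is i ((\<lambda>k. fst (pairs e ! k)) ` {k. k < ?n \<and> snd (pairs e ! k) \<in> S}) \<tau> \<and> stable i \<sigma> \<tau>)"
    unfolding step_prog_def
    by (rule triple_fill) (use D less row in \<open>simp_all add: stable_def e i row_is_def\<close>)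
  then show ?thesis
    by (rule triple_mono) (use length_pairs[OF e(2)] in \<open>auto simp: im stable_def\<close>)
qed

lemma triple_min:
  assumes row: "row_is (reg \<sigma> rI) S \<sigma>" and S: "S \<subseteq> {..<nQ}"
    and x: "\<And>\<tau> q. q < nQ \<Longrightarrow> reg \<tau> rQ = q \<Longrightarrow> agree (min_prog x) \<sigma> \<tau> \<Longrightarrow> aval I \<tau> x = next_pos (P q) n i"
  shows "triple I \<sigma> (min_prog x) (3 + 5 * nQ) (\<lambda>\<tau>. reg \<tau> rX = next_pos (\<lambda>j. \<exists>q\<in>S. P q j) n i)"
proof -
  let ?P = "\<lambda>k j. \<exists>q\<in>S \<inter> {..<k}. P q j"
  let ?Inv = "\<lambda>k \<tau>. reg \<tau> rX = next_pos (?P k) n i"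
  let ?body = "Cond (Conj (Neg (Eq (Work 3 (Reg rI) (Reg rQ)) (Const 0)))
         (Conj (Neg (Eq x (Const 0))) (Neg (Conj (Neg (Eq (Reg rX) (Const 0))) (Neg (Lt x (Reg rX)))))))
       (Assign rX x) Skip"
  have "triple I (exec I (Assign rX (Const 0)) \<sigma>) (For rQ (in0 NumStates) ?body) (2 + 5 * nQ)
      (\<lambda>\<tau>. ?Inv nQ \<tau> \<and> reg \<tau> rQ = nQ)"
  proof (rule triple_For[where t = "\<lambda>_. 3" and Inv = ?Inv], goal_cases)
    case 1
    show ?case by (simp add: next_pos_def)
  next
    case (4 q \<tau>)
    have ag: "agree (min_prog x) \<sigma> \<tau>"
      using 4(4) by (simp add: agree_def min_prog_def)
    have w: "work \<tau> 3 (reg \<tau> rI) q \<noteq> 0 \<longleftrightarrow> q \<in> S"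
      using ag row 4(1) by (simp add: agree_def row_is_def)
    have x': "aval I \<tau> x = next_pos (P q) n i"
      by (rule x[OF 4(1,3) ag])
    have P: "?P (Suc q) = (if q \<in> S then (\<lambda>j. ?P q j \<or> P q j) else ?P q)"
      by (auto simp: fun_eq_iff less_Suc_eq)
    have "reg (exec I ?body \<tau>) rX = next_pos (?P (Suc q)) n i"
      using w x' 4(2,3) by (simp add: P next_pos_disj)
    then show ?case
      by (intro triple_straight) (simp_all del: exec.simps)
  qed simp_all
  moreover have "S \<inter> {..<nQ} = S"
    using S by blast
  ultimately show ?thesis
    unfolding min_prog_def by (intro triple_straight_Seq[where u = "2 + 5 * nQ"]) (auto intro: triple_mono)
qed

text \<open>Reduces usability by a set to the tables for single states.\<close>

lemma good_targets: "good v S = (\<lambda>j. \<exists>q\<in>S. q \<in> targets (inedge v j))"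
  by (force simp: good_def step_def targets_def fun_eq_iff)

lemma live_less: "live k v S \<Longrightarrow> S \<subseteq> {..<nQ}"
  using d_dom[of v] by (force simp: live_def)

lemma triple_min_first:
  assumes T: "tables (data \<sigma>)" and row: "row_is (reg \<sigma> rI) S \<sigma>" and live: "live k (reg \<sigma> rV) S"
  shows "triple I \<sigma> (min_prog (Data 8 (Reg rV) (Reg rQ))) (3 + 5 * nQ)
    (\<lambda>\<tau>. reg \<tau> rX = next_pos (good (reg \<sigma> rV) S) (indeg (reg \<sigma> rV)) 0)"
  unfolding good_targets
proof (rule triple_min[OF row live_less[OF live]])
  fix \<tau> q
  assume q: "q < nQ" "reg \<tau> rQ = q" and ag: "agree (min_prog (Data 8 (Reg rV) (Reg rQ))) \<sigma> \<tau>"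
  have v: "reg \<sigma> rV < nV"
    using live by (simp add: live_def)
  have "data \<sigma> 8 (reg \<sigma> rV) q = next_good (reg \<sigma> rV) q 0"
    using T[unfolded tables_def, THEN conjunct2, THEN conjunct2, THEN conjunct2, rule_format, OF v q(1)]
    by (rule conjunct1)
  then show "aval I \<tau> (Data 8 (Reg rV) (Reg rQ)) =
      next_pos (\<lambda>j. q \<in> targets (inedge (reg \<sigma> rV) j)) (indeg (reg \<sigma> rV)) 0"
    using ag q(2) by (simp add: agree_def next_good_def)
qed

text \<open>Register \<open>rI\<close> and the row are numbered by the edges still to come, which is
  also the index of the current vertex in the output area.\<close>

definition cursor :: "nat \<Rightarrow> nat list \<Rightarrow> nat set \<Rightarrow> state \<Rightarrow> bool" where
  "cursor l es S \<sigma> \<longleftrightarrow> holds_part l es \<sigma> \<and> reg \<sigma> rI = l - length es \<and>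
     row_is (l - length es) S \<sigma> \<and> live (l - length es) (reg \<sigma> rV) S"

lemma triple_take:
  assumes T: "tables (data \<sigma>)" and cur: "cursor l es S \<sigma>" and len: "length es < l"
    and X: "reg \<sigma> rX = Suc j" and v: "reg \<sigma> rV = v" and j: "j < indeg v" "good v S j"
  shows "triple I \<sigma> take_prog (9 + 3 * nQ + 5 * nD)
    (\<lambda>\<tau>. cursor l (es @ [inedge v j]) (step (inedge v j) S) \<tau> \<and> reg \<tau> rV = esrc (inedge v j))"
proof -
  define i where "i = l - Suc (length es)"
  let ?e = "inedge v j"
  let ?init = "Assign rE (in2 InEdge (Reg rV) (Dec (Reg rX))) ;; Assign rV (in1 EdgeSrc (Reg rE)) ;;
      StoreWork 0 (Const 1) (Dec (Reg rI)) (Reg rE) ;; StoreWork 0 (Const 0) (Dec (Reg rI)) (Reg rV)"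
  define \<rho> where "\<rho> = exec I ?init \<sigma>"
  have i: "l - length es = Suc i" "reg \<sigma> rI = Suc i"
    using cur len by (auto simp: i_def cursor_def)
  have live: "live (Suc i) v S"
    using cur i v by (simp add: cursor_def)
  have R: "reg \<rho> rE = ?e" "reg \<rho> rV = esrc ?e" "reg \<rho> rI = Suc i" "data \<rho> = data \<sigma>"
    "work \<rho> 3 = work \<sigma> 3"
    "work \<rho> 0 0 = (work \<sigma> 0 0)(i := esrc ?e)" "work \<rho> 0 (Suc 0) = (work \<sigma> 0 (Suc 0))(i := ?e)"
    using i X v by (simp_all add: \<rho>_def upd_def)
  have hp: "holds_part l (es @ [?e]) \<rho>"
    using cur len R(6,7) by (intro holds_part_snoc[of l es \<sigma>]) (auto simp: cursor_def i_def)
  have v_less: "v < nV"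
    using live by (simp add: live_def)
  have e: "?e < nE"
    using inedge_in[OF v_less j(1)] by simp
  have live': "live i (esrc ?e) (step ?e S)"
    by (rule live_inedge[OF live j])
  have row: "row_is (Suc i) S \<rho>"
    using cur i by (simp add: cursor_def row_is_def R)
  have st: "triple I \<rho> step_prog (4 + 3 * nQ + 5 * nD)
      (\<lambda>\<tau>. row_is i (step ?e S) \<tau> \<and> (\<forall>k. k \<noteq> i \<longrightarrow> work \<tau> 3 k = work \<rho> 3 k))"
    using T R row e by (intro triple_step) simp_all
  have "triple I \<rho> (step_prog ;; Assign rI (Dec (Reg rI))) (5 + 3 * nQ + 5 * nD)
    (\<lambda>\<tau>. cursor l (es @ [?e]) (step ?e S) \<tau> \<and> reg \<tau> rV = esrc ?e)"
  proof (rule triple_Seq[where u = 1, OF st], goal_cases)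
    case (1 \<tau>)
    have r: "reg \<tau> rI = Suc i" "reg \<tau> rV = esrc ?e" "work \<tau> 0 = work \<rho> 0"
      using 1(2) R by (simp_all add: agree_def)
    have "cursor l (es @ [?e]) (step ?e S) (exec I (Assign rI (Dec (Reg rI))) \<tau>)"
      using 1(1) r hp live' by (simp add: cursor_def i_def holds_part_def row_is_def)
    then show ?case
      using r by (intro triple_straight) simp_all
  qed simp
  then show ?thesis
    unfolding take_prog_def \<rho>_def by (rule triple_straight_Seq[rotated 2]) simp_all
qed

lemma triple_descend:
  assumes T: "tables (data \<sigma>)" and cur: "cursor l es S \<sigma>"
  shows "triple I \<sigma> descend_prog (1 + (l - length es) * (13 + 8 * nQ + 5 * nD))
    (holds_part l (es @ hd (enum (l - length es) (reg \<sigma> rV) S)))"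
proof -
  let ?K = "13 + 8 * nQ + 5 * nD"
  \<comment> \<open>The walk to be reached is fixed before the loop. By \<open>hd_enum\<close>,
    taking the first usable edge keeps its description valid.\<close>
  define goal where "goal = es @ hd (enum (l - length es) (reg \<sigma> rV) S)"
  let ?J = "\<lambda>m \<tau>. \<exists>fs S. cursor l fs S \<tau> \<and> goal = fs @ hd (enum (l - length fs) (reg \<tau> rV) S) \<and>
     m = (l - length fs) * ?K"
  have "triple I \<sigma> descend_prog (Suc ((l - length es) * ?K))
    (\<lambda>\<tau>. (\<exists>m\<le>(l - length es) * ?K. ?J m \<tau>) \<and> \<not> bval I \<tau> (Lt (Const 0) (Reg rI)))"
    unfolding descend_prog_def
  proof (rule triple_While, goal_cases)
    case (1 m \<tau>)
    then obtain fs S where cur: "cursor l fs S \<tau>" and g: "goal = fs @ hd (enum (l - length fs) (reg \<tau> rV) S)"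
      and m: "m = (l - length fs) * ?K"
      by blast
    define i where "i = l - Suc (length fs)"
    let ?v = "reg \<tau> rV"
    have len: "length fs < l" "l - length fs = Suc i"
      using 1(2) cur by (auto simp: i_def cursor_def)
    have live: "live (Suc i) ?v S"
      using cur len by (simp add: cursor_def)
    have T': "tables (data \<tau>)"
      using T agree_data_eq[OF 1(3)] by simp
    obtain j where j: "next_pos (good ?v S) (indeg ?v) 0 = Suc j" "j < indeg ?v" "good ?v S j"
      "hd (enum (Suc i) ?v S) = via i ?v S j"
      using hd_enum[OF live] .
    let ?e = "inedge ?v j"
    have "row_is (reg \<tau> rI) S \<tau>"
      using cur by (simp add: cursor_def)
    from triple_min_first[OF T' this live]
    have "triple I \<tau> (min_prog (Data 8 (Reg rV) (Reg rQ)) ;; take_prog) (12 + 8 * nQ + 5 * nD)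
      (\<lambda>\<tau>. cursor l (fs @ [?e]) (step ?e S) \<tau> \<and> reg \<tau> rV = esrc ?e)"
    proof (rule triple_Seq[where u = "9 + 3 * nQ + 5 * nD"], goal_cases)
      case (1 \<rho>)
      have "cursor l fs S \<rho>" "tables (data \<rho>)" "reg \<rho> rV = ?v"
        using 1(2) cur T' agree_data_eq[OF 1(2)]
        by (simp_all add: agree_def cursor_def holds_part_def row_is_def)
      then show ?case
        using 1(1) j len(1) by (intro triple_take) simp_all
    qed simp
    then have "triple I \<tau> (min_prog (Data 8 (Reg rV) (Reg rQ)) ;; take_prog) (12 + 8 * nQ + 5 * nD)
      (\<lambda>\<tau>. \<exists>m'. ?J m' \<tau> \<and> Suc (12 + 8 * nQ + 5 * nD) + m' \<le> m)"
    proof (rule triple_mono, goal_cases)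
      case (2 \<rho>)
      have "goal = (fs @ [?e]) @ hd (enum i (reg \<rho> rV) (step ?e S))"
        using g 2(2) unfolding len j(4) by (simp add: via_def)
      then show ?case
        using 2(2) m len
        by (intro exI[of _ "i * ?K"] conjI exI[of _ "fs @ [?e]"] exI[of _ "step ?e S"]) (simp_all add: i_def)
    qed simp
    then show ?case
      by blast
  next
    case 2
    show ?case
      using cur goal_def by blast
  qed
  then show ?thesis
    unfolding goal_def[symmetric]
  proof (rule triple_mono, goal_cases)
    case (2 \<tau>)
    then obtain fs S where fs: "cursor l fs S \<tau>" "goal = fs @ hd (enum (l - length fs) (reg \<tau> rV) S)"
      "\<not> 0 < reg \<tau> rI"
      by auto
    then have "length fs = l"
      by (auto simp: cursor_def holds_part_def)
    with fs show ?case
      by (simp add: cursor_def)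
  qed simp
qed

text \<open>The sets recomputed along a listed walk are nodes of the tree, so a descent may start
  again at any of them.\<close>

lemma enum_node:
  assumes "es \<in> set (enum k v S)" "live k v S" "j \<le> k"
  shows "live (k - j) (vertex v es j) (fold step (take j es) S) \<and>
    (j < k \<longrightarrow> es ! j < nE \<and> etgt (es ! j) = vertex v es j)"
  using assms
proof (induction k arbitrary: v S es j)
  case 0
  then show ?case by (simp add: vertex_def)
next
  case (Suc k)
  have v: "v < nV"
    using Suc.prems(2) by (simp add: live_def)
  obtain i fs where i: "i < indeg v" "good v S i" "es = inedge v i # fs"
    "fs \<in> set (enum k (esrc (inedge v i)) (step (inedge v i) S))"
    using Suc.prems(1) by (auto split: if_splits)
  show ?case
  proof (cases j)
    case 0
    then show ?thesis
      using Suc.prems(2) inedge_in[OF v i(1)] by (simp add: vertex_def i(3))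
  next
    case (Suc m)
    then show ?thesis
      using Suc.IH[OF i(4) live_inedge[OF Suc.prems(2) i(1,2)], of m] Suc.prems(3)
      by (simp add: i(3) vertex_def)
  qed
qed

text \<open>Closes the depth-first order into a cycle.\<close>

definition follow :: "nat \<Rightarrow> nat list \<Rightarrow> nat list" where
  "follow l es = (case next_walk es tV (roots l) of Some x \<Rightarrow> x | None \<Rightarrow> hd (enum l tV (roots l)))"

abbreviation node :: "nat \<Rightarrow> nat list \<Rightarrow> nat \<Rightarrow> nat set" where
  "node l es j \<equiv> fold step (take j es) (roots l)"

text \<open>
  Register \<open>rB\<close> holds the last branching position met so far and \<open>rN\<close> the next edge to be
  tried there. Initially this is the first edge at the root: a walk without successor is
  followed by the first one.
\<close>

definition scan_inv :: "nat \<Rightarrow> nat list \<Rightarrow> nat \<Rightarrow> state \<Rightarrow> bool" where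
  "scan_inv l es j \<sigma> \<longleftrightarrow> j \<le> l \<and> reg \<sigma> rI = l - j \<and> (\<forall>k\<le>j. row_is (l - k) (node l es k) \<sigma>) \<and>
     (\<exists>b i. b \<le> j \<and> b < l \<and> reg \<sigma> rB = l - b \<and> reg \<sigma> rN = Suc i \<and>
       i < indeg (vertex tV es b) \<and> good (vertex tV es b) (node l es b) i \<and>
       follow l es = (case next_walk (drop j es) (vertex tV es j) (node l es j) of
         Some x \<Rightarrow> take j es @ x
       | None \<Rightarrow> take b es @ via (l - Suc b) (vertex tV es b) (node l es b) i))"

text \<open>All rows met so far are kept, so the set of states at the branching vertex is still in
  its row when the scan has reached \<open>s\<close>.\<close>

lemma triple_scan:
  assumes T: "tables (data \<sigma>)" and lev: "level l" and es: "es \<in> set (enum l tV (roots l))"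
    and part: "holds_part l es \<sigma>" and inv: "scan_inv l es 0 \<sigma>"
  shows "triple I \<sigma> scan_prog (1 + l * (15 + 8 * nQ + 5 * nD)) (scan_inv l es l)"
proof -
  let ?K = "15 + 8 * nQ + 5 * nD"
  let ?init = "Assign rV (Work 0 (Const 0) (Reg rI)) ;; Assign rE (Work 0 (Const 1) (Dec (Reg rI)))"
  let ?keep = "Cond (Eq (Reg rX) (Const 0)) Skip (Assign rB (Reg rI) ;; Assign rN (Reg rX))"
  let ?J = "\<lambda>m \<tau>. \<exists>j. scan_inv l es j \<tau> \<and> m = (l - j) * ?K"
  have len: "length es = l"
    by (rule length_enum[OF es])
  have "triple I \<sigma> scan_prog (Suc (l * ?K))
    (\<lambda>\<tau>. (\<exists>m\<le>l * ?K. ?J m \<tau>) \<and> \<not> bval I \<tau> (Lt (Const 0) (Reg rI)))"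
    unfolding scan_prog_def
  proof (rule triple_While, goal_cases)
    case (1 m \<tau>)
    then obtain j where inv: "scan_inv l es j \<tau>" and m: "m = (l - j) * ?K"
      by blast
    define i where "i = l - Suc j"
    let ?v = "vertex tV es j"
    let ?S = "node l es j"
    let ?e = "es ! j"
    have I: "reg \<tau> rI = Suc i" "l - j = Suc i" "j < l"
      using inv 1(2) by (auto simp: scan_inv_def i_def)
    have T': "tables (data \<tau>)"
      using T 1(3) by (simp add: agree_data_eq)
    have live: "live (Suc i) ?v ?S" and e: "?e < nE" "etgt ?e = ?v"
      using enum_node[OF es live_roots[OF lev], of j] I by simp_all
    have v: "?v < nV"
      using live by (simp add: live_def)
    obtain c where c: "c < indeg ?v" "inedge ?v c = ?e"
      using inedge_ex[OF e(1)] e(2) by auto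
    have ipos: "ipos ?e = c"
      using ipos_inedge[OF v c(1)] c(2) by simp
    have "holds_part l es \<tau>"
      using part 1(3) by (simp add: holds_part_def agree_def)
    then have "work \<tau> 0 0 (l - j) = ?v" "work \<tau> 0 (Suc 0) (l - Suc j) = ?e"
      using I(3) len by (simp_all add: holds_part_def)
    then have w: "work \<tau> 0 0 (Suc i) = ?v" "work \<tau> 0 (Suc 0) i = ?e"
      using I(2) by (simp_all add: i_def)
    define \<rho> where "\<rho> = exec I ?init \<tau>"
    have R: "reg \<rho> rV = ?v" "reg \<rho> rE = ?e" "reg \<rho> rI = Suc i" "data \<rho> = data \<tau>" "work \<rho> = work \<tau>"
      "reg \<rho> rB = reg \<tau> rB" "reg \<rho> rN = reg \<tau> rN"
      using I w by (simp_all add: \<rho>_def)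
    have row: "row_is (reg \<rho> rI) ?S \<rho>"
      using inv I by (auto simp: scan_inv_def row_is_def R)
    have m1: "triple I \<rho> (min_prog (Data 7 (Reg rE) (Reg rQ))) (3 + 5 * nQ)
        (\<lambda>\<tau>. reg \<tau> rX = next_pos (good ?v ?S) (indeg ?v) (Suc c))"
      unfolding good_targets
    proof (rule triple_min[OF row live_less[OF live]])
      fix \<tau>' q
      assume q: "q < nQ" "reg \<tau>' rQ = q" and ag: "agree (min_prog (Data 7 (Reg rE) (Reg rQ))) \<rho> \<tau>'"
      have "data \<tau> 7 ?e q = next_good ?v q (Suc c)"
        using T'[unfolded tables_def, THEN conjunct2, THEN conjunct2, THEN conjunct2, rule_format, OF v q(1),
            THEN conjunct2, rule_format, OF c(1)] c(2) by simp
      then show "aval I \<tau>' (Data 7 (Reg rE) (Reg rQ)) =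
          next_pos (\<lambda>j. q \<in> targets (inedge ?v j)) (indeg ?v) (Suc c)"
        using ag q(2) R by (simp add: agree_def next_good_def)
    qed
    have rest: "triple I \<rho> (min_prog (Data 7 (Reg rE) (Reg rQ)) ;; ?keep ;; step_prog ;; Assign rI (Dec (Reg rI)))
        (12 + 8 * nQ + 5 * nD) (\<lambda>\<tau>. scan_inv l es (Suc j) \<tau>)"
    proof (rule triple_Seq[where u = "9 + 3 * nQ + 5 * nD", OF m1], goal_cases)
      case (1 \<tau>1)
      have r1: "reg \<tau>1 rE = ?e" "reg \<tau>1 rI = Suc i" "data \<tau>1 = data \<tau>" "work \<tau>1 = work \<tau>"
        "reg \<tau>1 rB = reg \<tau> rB" "reg \<tau>1 rN = reg \<tau> rN"
        using 1(2) R agree_data_eq[OF 1(2)] by (simp_all add: agree_def fun_eq_iff)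
      define \<tau>2 where "\<tau>2 = exec I ?keep \<tau>1"
      have r2: "reg \<tau>2 rE = ?e" "reg \<tau>2 rI = Suc i" "data \<tau>2 = data \<tau>" "work \<tau>2 = work \<tau>"
        "reg \<tau>2 rB = (if next_pos (good ?v ?S) (indeg ?v) (Suc c) = 0 then reg \<tau> rB else Suc i)"
        "reg \<tau>2 rN = (if next_pos (good ?v ?S) (indeg ?v) (Suc c) = 0 then reg \<tau> rN
           else next_pos (good ?v ?S) (indeg ?v) (Suc c))"
        using r1 1(1) by (simp_all add: \<tau>2_def)
      have "row_is (Suc i) ?S \<tau>2"
        using row by (simp add: row_is_def r2 R)
      then have st: "triple I \<tau>2 step_prog (4 + 3 * nQ + 5 * nD)
          (\<lambda>\<tau>. row_is i (step ?e ?S) \<tau> \<and> (\<forall>k. k \<noteq> i \<longrightarrow> work \<tau> 3 k = work \<tau>2 3 k))"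
        using T' r2 e by (intro triple_step) simp_all
      have "triple I \<tau>2 (step_prog ;; Assign rI (Dec (Reg rI))) (5 + 3 * nQ + 5 * nD) (\<lambda>\<tau>. scan_inv l es (Suc j) \<tau>)"
      proof (rule triple_Seq[where u = 1, OF st], goal_cases)
        case (1 \<tau>3)
        define \<tau>4 where "\<tau>4 = exec I (Assign rI (Dec (Reg rI))) \<tau>3"
        have r4: "reg \<tau>4 rI = i" "work \<tau>4 = work \<tau>3" "reg \<tau>4 rB = reg \<tau>2 rB" "reg \<tau>4 rN = reg \<tau>2 rN"
          using 1(2) r2 by (simp_all add: \<tau>4_def agree_def)
        have node: "node l es (Suc j) = step ?e ?S" and vert: "vertex tV es (Suc j) = esrc ?e"
          using I len by (simp_all add: take_Suc_conv_app_nth vertex_def)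
        have rows: "row_is (l - k) (node l es k) \<tau>4" if "k \<le> Suc j" for k
        proof (cases "k = Suc j")
          case True
          then show ?thesis
            using 1(1) by (simp only: node) (simp add: row_is_def r4 i_def)
        next
          case False
          then have k: "k \<le> j" "l - k \<noteq> i"
            using that I by (auto simp: i_def)
          then have "row_is (l - k) (node l es k) \<tau>"
            using inv by (simp add: scan_inv_def)
          then show ?thesis
            using 1(1) k(2) by (simp add: row_is_def r4 r2)
        qed
        obtain b i0 where b: "b \<le> j" "b < l" "reg \<tau> rB = l - b" "reg \<tau> rN = Suc i0"
          "i0 < indeg (vertex tV es b)" "good (vertex tV es b) (node l es b) i0"
          and f: "follow l es = (case next_walk (drop j es) ?v ?S of Some x \<Rightarrow> take j es @ x
            | None \<Rightarrow> take b es @ via (l - Suc b) (vertex tV es b) (node l es b) i0)"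
          using inv unfolding scan_inv_def by blast
        \<comment> \<open>Moves from \<open>j\<close> to \<open>Suc j\<close> by
          \<open>scan_step\<close>: the answer for \<open>None\<close> now depends on whether the
          vertex at \<open>j\<close> has a usable edge behind the current one.\<close>
        note f' = f[unfolded scan_step[OF \<open>j < l\<close>[folded len]] ipos, folded node vert, unfolded len]
        have "\<exists>b i. b \<le> Suc j \<and> b < l \<and> reg \<tau>4 rB = l - b \<and> reg \<tau>4 rN = Suc i \<and>
          i < indeg (vertex tV es b) \<and> good (vertex tV es b) (node l es b) i \<and>
          follow l es = (case next_walk (drop (Suc j) es) (vertex tV es (Suc j)) (node l es (Suc j)) of
            Some x \<Rightarrow> take (Suc j) es @ x
          | None \<Rightarrow> take b es @ via (l - Suc b) (vertex tV es b) (node l es b) i)"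
        \<comment> \<open>On 0 the recorded branching vertex is kept; otherwise position
          \<open>j\<close> becomes the new one.\<close>
        proof (cases "next_pos (good ?v ?S) (indeg ?v) (Suc c)")
          case 0
          then show ?thesis
            using f'[unfolded 0 nat.case] b by - (rule exI[of _ b], rule exI[of _ i0], simp add: r4 r2)
        next
          case (Suc i1)
          then show ?thesis
            using f'[unfolded Suc nat.case] next_pos_Suc[OF Suc] I
            by - (rule exI[of _ j], rule exI[of _ i1], simp add: r4 r2)
        qed
        then have "scan_inv l es (Suc j) \<tau>4"
          using rows I unfolding scan_inv_def by (simp add: r4 i_def)
        then show ?case
          unfolding \<tau>4_def by (rule triple_straight[rotated 2]) simp_all
      qed simp
      then show ?case
        unfolding \<tau>2_def by (rule triple_straight_Seq[rotated 2]) simp_all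
    qed simp
    have "triple I \<tau> (?init ;; min_prog (Data 7 (Reg rE) (Reg rQ)) ;; ?keep ;; step_prog ;; Assign rI (Dec (Reg rI)))
        (14 + 8 * nQ + 5 * nD) (\<lambda>\<tau>. scan_inv l es (Suc j) \<tau>)"
      using rest unfolding \<rho>_def by (rule triple_straight_Seq[rotated 2]) simp_all
    then have "triple I \<tau> (?init ;; min_prog (Data 7 (Reg rE) (Reg rQ)) ;; ?keep ;; step_prog ;; Assign rI (Dec (Reg rI)))
        (14 + 8 * nQ + 5 * nD) (\<lambda>\<tau>. \<exists>m'. ?J m' \<tau> \<and> Suc (14 + 8 * nQ + 5 * nD) + m' \<le> m)"
    proof (rule triple_mono, goal_cases)
      case (2 \<tau>')
      then show ?case
        using m I by (intro exI[of _ "i * ?K"] conjI exI[of _ "Suc j"]) (simp_all add: i_def)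
    qed simp
    then show ?case
      by blast
  next
    case 2
    show ?case
      using inv by (intro exI[of _ 0]) simp
  qed
  then show ?thesis
  proof (rule triple_mono, goal_cases)
    case (2 \<tau>)
    then obtain j where "scan_inv l es j \<tau>" "reg \<tau> rI = 0"
      by auto
    moreover from this have "j = l"
      by (auto simp: scan_inv_def)
    ultimately show ?case
      by simp
  qed simp
qed

lemma triple_compare:
  assumes l: "reg \<sigma> 0 = Suc l" and fs: "holds_part l fs \<sigma>" "length fs = l"
    and es: "stored es (data \<sigma>)" "length es = l"
  shows "triple I \<sigma> compare_prog (6 + 5 * l) (\<lambda>\<tau>. if fs = es then reg \<tau> 0 = 0 else holds fs \<tau>)"
proof -
  let ?body = "Cond (Eq (Work 0 (Const 1) (Reg rJ)) (Data 9 (Reg rJ) (Const 0))) Skip (Assign rC (Const 1))"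
  let ?P = "\<lambda>j. work \<sigma> 0 1 j = data \<sigma> 9 j 0"
  \<comment> \<open>Cells are indexed from \<open>s\<close>, the lists from \<open>t\<close>;
    \<open>l - Suc j\<close> exchanges the two.\<close>
  have eq: "(\<forall>j<l. ?P j) \<longleftrightarrow> fs = es"
  proof
    assume *: "\<forall>j<l. ?P j"
    show "fs = es"
    proof (rule nth_equalityI)
      fix j
      assume j: "j < length fs"
      then have "?P (l - Suc j)"
        using * fs(2) by simp
      then show "fs ! j = es ! j"
        using fs es j by (simp add: holds_part_def stored_def)
    qed (simp add: fs es)
  next
    assume e: "fs = es"
    show "\<forall>j<l. ?P j"
    proof (intro allI impI)
      fix j
      assume "j < l"
      then have "l - Suc j < l" "j = l - Suc (l - Suc j)"
        by auto
      then show "?P j"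
        using fs es e unfolding holds_part_def stored_def by metis
    qed
  qed
  have "triple I (exec I (Assign rC (Const 0)) \<sigma>) (For rJ (Dec (Reg 0)) ?body) (2 + 5 * l)
    (\<lambda>\<tau>. (reg \<tau> rC = 0 \<longleftrightarrow> (\<forall>j<l. ?P j)) \<and> reg \<tau> rJ = l)"
  proof (rule triple_For[where t = "\<lambda>_. 3" and Inv = "\<lambda>k \<tau>. reg \<tau> rC = 0 \<longleftrightarrow> (\<forall>j<k. ?P j)"], goal_cases)
    case (4 k \<tau>)
    then show ?case
      by (intro triple_straight) (auto simp: agree_def less_Suc_eq)
  qed (use l in \<open>auto simp: agree_def\<close>)
  then have "triple I (exec I (Assign rC (Const 0)) \<sigma>)
      (For rJ (Dec (Reg 0)) ?body ;; Cond (Eq (Reg rC) (Const 0)) (Assign 0 (Const 0)) Skip) (5 + 5 * l)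
      (\<lambda>\<tau>. if fs = es then reg \<tau> 0 = 0 else holds fs \<tau>)"
  proof (rule triple_Seq[where u = 3], goal_cases)
    case (1 \<tau>)
    have "reg \<tau> rC = 0 \<longleftrightarrow> fs = es" "reg \<tau> 0 = Suc l" "work \<tau> = work \<sigma>"
      using 1 eq l by (auto simp: agree_def fun_eq_iff)
    then show ?case
      using fs by (intro triple_straight) (auto simp: holds_def holds_part_def)
  qed simp
  then show ?thesis
    unfolding compare_prog_def by (rule triple_straight_Seq[rotated 2]) simp_all
qed

text \<open>What remains once the branching vertex and its next edge are known: \<open>es\<close> is
  the part of the old walk that is kept, and \<open>via\<close> supplies the edge with the leftmost
  continuation.\<close>

lemma triple_advance:
  assumes T: "tables (data \<sigma>)" and st: "stored es0 (data \<sigma>)" "length es0 = l"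
    and live: "live (l - length es) v S" and len: "length es < l"
    and cur: "cursor l es S \<sigma>" and reg: "reg \<sigma> 0 = Suc l" "reg \<sigma> rX = Suc i" "reg \<sigma> rV = v"
    and i: "i < indeg v" "good v S i"
  defines "fs \<equiv> es @ via (l - Suc (length es)) v S i"
  shows "triple I \<sigma> (take_prog ;; descend_prog ;; compare_prog)
    (16 + 3 * nQ + 5 * nD + l * (18 + 8 * nQ + 5 * nD)) (\<lambda>\<tau>. if fs = es0 then reg \<tau> 0 = 0 else holds fs \<tau>)"
proof -
  let ?e = "inedge v i"
  have live': "live (l - Suc (length es)) (esrc ?e) (step ?e S)"
  proof (rule live_inedge[OF _ i])
    have "l - length es = Suc (l - Suc (length es))"
      using len by simp
    then show "live (Suc (l - Suc (length es))) v S"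
      using live by simp
  qed
  have fs: "fs = (es @ [?e]) @ hd (enum (l - Suc (length es)) (esrc ?e) (step ?e S))"
    by (simp add: fs_def via_def)
  have "length (hd (enum (l - Suc (length es)) (esrc ?e) (step ?e S))) = l - Suc (length es)"
    by (rule length_enum[OF hd_in_set[OF enum_nonempty[OF live']]])
  then have len_fs: "length fs = l"
    using len by (simp add: fs)
  have tk: "triple I \<sigma> take_prog (9 + 3 * nQ + 5 * nD)
    (\<lambda>\<tau>. cursor l (es @ [?e]) (step ?e S) \<tau> \<and> reg \<tau> rV = esrc ?e)"
    by (rule triple_take[OF T cur len reg(2,3) i])
  show ?thesis
  proof (rule triple_Seq[where u = "7 + l * (18 + 8 * nQ + 5 * nD)", OF tk], goal_cases)
    case (1 \<rho>)
    have \<rho>: "data \<rho> = data \<sigma>" "reg \<rho> 0 = Suc l"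
      using 1(2) agree_data_eq[OF 1(2)] reg(1) by (simp_all add: agree_def)
    have "triple I \<rho> descend_prog (1 + (l - length (es @ [?e])) * (13 + 8 * nQ + 5 * nD)) (holds_part l fs)"
      using triple_descend[of \<rho> l "es @ [?e]" "step ?e S"] 1(1) T \<rho>(1) by (simp add: fs)
    then have ds: "triple I \<rho> descend_prog (1 + l * (13 + 8 * nQ + 5 * nD)) (holds_part l fs)"
      by (rule triple_mono) (simp_all only: add_le_cancel_left mult_le_mono1 diff_le_self)
    show ?case
    proof (rule triple_Seq[where u = "6 + 5 * l", OF ds], goal_cases)
      case (1 \<tau>)
      have "data \<tau> = data \<sigma>" "reg \<tau> 0 = Suc l"
        using 1(2) agree_data_eq[OF 1(2)] \<rho> by (simp_all add: agree_def)
      then show ?case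
        using 1(1) len_fs st by (intro triple_compare) simp_all
    qed (simp add: algebra_simps)
  qed simp
qed

lemma triple_nxt:
  assumes T: "tables (data \<sigma>)" and st: "stored es0 (data \<sigma>)" "length es0 = l"
    and lev: "level l" and es: "es \<in> set (enum l tV (roots l))" and holds: "holds es \<sigma>"
  shows "triple I \<sigma> nxt_prog (2 + l * (66 + 32 * nQ + 15 * nD))
    (\<lambda>\<tau>. if follow l es = es0 then reg \<tau> 0 = 0 else holds (follow l es) \<tau>)"
proof -
  let ?t = "32 + 16 * nQ + 5 * nD + l * (33 + 16 * nQ + 10 * nD)"
  let ?Q = "\<lambda>\<tau>. if follow l es = es0 then reg \<tau> 0 = 0 else holds (follow l es) \<tau>"
  let ?init = "Assign rI (Dec (Reg 0)) ;; Assign rB (Reg rI) ;; Assign rV (in0 Target)"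
  let ?back = "Assign rI (Reg rB) ;; Assign rV (Work 0 (Const 0) (Reg rI)) ;; Assign rX (Reg rN)"
  have len: "length es = l"
    by (rule length_enum[OF es])
  have reg0: "reg \<sigma> 0 = Suc l" and part: "holds_part l es \<sigma>"
    using holds len by (auto simp: holds_def)
  show ?thesis
  proof (cases l)
    case 0
    \<comment> \<open>Without edges there is only one walk, so the stored walk is its own successor
      and the end is reported.\<close>
    then have "es = []" "es0 = []" "follow l es = []"
      using len st(2) by (auto simp: follow_def)
    then show ?thesis
      unfolding nxt_prog_def
      by (intro triple_Cond[where t = 1] triple_straight) (use reg0 0 in simp_all)
  next
    case (Suc k)
    have live: "live (Suc k) tV (roots l)"
      using live_roots[OF lev] Suc by simp
    obtain i0 where i0: "next_pos (good tV (roots l)) (indeg tV) 0 = Suc i0" "i0 < indeg tV"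
      "good tV (roots l) i0" "hd (enum (Suc k) tV (roots l)) = via k tV (roots l) i0"
      using hd_enum[OF live] .
    define \<sigma>1 where "\<sigma>1 = exec I ?init \<sigma>"
    have r1: "reg \<sigma>1 rI = l" "reg \<sigma>1 rB = l" "reg \<sigma>1 rV = tV" "reg \<sigma>1 0 = Suc l" "data \<sigma>1 = data \<sigma>"
      "work \<sigma>1 = work \<sigma>"
      using reg0 by (simp_all add: \<sigma>1_def)
    have "triple I \<sigma>1 roots_prog (4 + 8 * nQ) (row_is l (roots l))"
      using triple_roots[of \<sigma>1 l] T r1 by simp
    then have "triple I \<sigma>1 (roots_prog ;; min_prog (Data 8 (Reg rV) (Reg rQ)) ;; Assign rN (Reg rX) ;;
      scan_prog ;; ?back ;; take_prog ;; descend_prog ;; compare_prog)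
      (28 + 16 * nQ + 5 * nD + l * (33 + 16 * nQ + 10 * nD)) ?Q"
    proof (rule triple_Seq[where u = "24 + 8 * nQ + 5 * nD + l * (33 + 16 * nQ + 10 * nD)"], goal_cases)
      case (1 \<sigma>2)
      have r2: "reg \<sigma>2 rI = l" "reg \<sigma>2 rB = l" "reg \<sigma>2 rV = tV" "reg \<sigma>2 0 = Suc l" "data \<sigma>2 = data \<sigma>"
        "work \<sigma>2 0 = work \<sigma> 0"
        using 1(2) r1 by (simp_all add: agree_def roots_prog_def fun_eq_iff)
      have "triple I \<sigma>2 (min_prog (Data 8 (Reg rV) (Reg rQ))) (3 + 5 * nQ)
          (\<lambda>\<tau>. reg \<tau> rX = next_pos (good tV (roots l)) (indeg tV) 0)"
        using triple_min_first[of \<sigma>2 "roots l" "Suc k"] T r2 1(1) live by simp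
      then show ?case
      proof (rule triple_Seq[where u = "21 + 3 * nQ + 5 * nD + l * (33 + 16 * nQ + 10 * nD)"], goal_cases)
        case (1 \<tau>)
        define \<sigma>3 where "\<sigma>3 = exec I (Assign rN (Reg rX)) \<tau>"
        have r3: "reg \<sigma>3 rI = l" "reg \<sigma>3 rB = l" "reg \<sigma>3 0 = Suc l" "data \<sigma>3 = data \<sigma>"
          "work \<sigma>3 = work \<sigma>2" "reg \<sigma>3 rN = Suc i0"
          using 1 r2 i0(1) by (simp_all add: agree_def fun_eq_iff \<sigma>3_def)
        have "follow l es = (case next_walk es tV (roots l) of Some x \<Rightarrow> x
            | None \<Rightarrow> via k tV (roots l) i0)"
          unfolding follow_def Suc i0(4)[unfolded Suc] ..
        then have "scan_inv l es 0 \<sigma>3"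
          unfolding scan_inv_def
          using r3 i0 Suc \<open>row_is l (roots l) \<sigma>2\<close>
          by (auto simp: vertex_def row_is_def intro!: exI[of _ i0] cong: option.case_cong)
        moreover have "holds_part l es \<sigma>3"
          using part r2 r3 by (simp add: holds_part_def)
        ultimately have sc: "triple I \<sigma>3 scan_prog (1 + l * (15 + 8 * nQ + 5 * nD)) (scan_inv l es l)"
          using T r3 by (intro triple_scan[OF _ lev es]) simp_all
        have "triple I \<sigma>3 (scan_prog ;; ?back ;; take_prog ;; descend_prog ;; compare_prog)
          (20 + 3 * nQ + 5 * nD + l * (33 + 16 * nQ + 10 * nD)) ?Q"
        proof (rule triple_Seq[where u = "19 + 3 * nQ + 5 * nD + l * (18 + 8 * nQ + 5 * nD)", OF sc], goal_cases)
          case (1 \<sigma>4)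
          obtain b i where b: "b < l" "reg \<sigma>4 rB = l - b" "reg \<sigma>4 rN = Suc i"
            "i < indeg (vertex tV es b)" "good (vertex tV es b) (node l es b) i"
            and row: "row_is (l - b) (node l es b) \<sigma>4"
            and f: "follow l es = take b es @ via (l - Suc b) (vertex tV es b) (node l es b) i"
            using 1(1) len unfolding scan_inv_def by auto
          define \<sigma>5 where "\<sigma>5 = exec I ?back \<sigma>4"
          have r4: "reg \<sigma>4 0 = Suc l" "data \<sigma>4 = data \<sigma>" "work \<sigma>4 0 = work \<sigma> 0"
            using 1(2) r2 r3 agree_data_eq[OF 1(2)] by (simp_all add: agree_def)
          have "work \<sigma> 0 0 (l - b) = vertex tV es b"
            using part b(1) len by (simp add: holds_part_def)
          then have r5: "reg \<sigma>5 0 = Suc l" "data \<sigma>5 = data \<sigma>" "work \<sigma>5 = work \<sigma>4" "reg \<sigma>5 rI = l - b"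
            "reg \<sigma>5 rV = vertex tV es b" "reg \<sigma>5 rX = Suc i"
            using r4 b by (simp_all add: \<sigma>5_def)
          have lb: "live (l - b) (vertex tV es b) (node l es b)"
            using enum_node[OF es live_roots[OF lev], of b] b(1) by simp
          have "vertex tV (take b es) j = vertex tV es j" if "j \<le> b" for j
            using vertex_append[of j "take b es" tV "drop b es"] that b(1) len by simp
          then have "holds_part l (take b es) \<sigma>5"
            using part len b(1) by (simp add: holds_part_def r5 r4)
          then have cur: "cursor l (take b es) (node l es b) \<sigma>5"
            using lb row len b(1) by (simp add: cursor_def r5 row_is_def)
          have "triple I \<sigma>5 (take_prog ;; descend_prog ;; compare_prog)
            (16 + 3 * nQ + 5 * nD + l * (18 + 8 * nQ + 5 * nD)) ?Q"
          proof -
            have "length (take b es) = b"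
              using b(1) len by simp
            note adv = triple_advance[of \<sigma>5 es0 l "take b es" "vertex tV es b" "node l es b" i,
                unfolded this, folded f]
            show ?thesis
              by (rule adv) (use T st lb cur r5 b in simp_all)
          qed
          then show ?case
            unfolding \<sigma>5_def by (rule triple_straight_Seq[rotated 2]) simp_all
        qed (simp add: algebra_simps)
        then show ?case
          unfolding \<sigma>3_def by (rule triple_straight_Seq[rotated 2]) simp_all
      qed simp
    qed simp
    then have "triple I \<sigma> (?init ;; roots_prog ;; min_prog (Data 8 (Reg rV) (Reg rQ)) ;; Assign rN (Reg rX) ;;
      scan_prog ;; ?back ;; take_prog ;; descend_prog ;; compare_prog) ?t ?Q"
      unfolding \<sigma>1_def by (rule triple_straight_Seq[rotated 2]) simp_all
    \<comment> \<open>As \<open>l\<close> is positive, the constant part of \<open>?t\<close> is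
      charged to one level: 32 + 33 \<le> 66, 16 + 16 = 32 and 5 + 10 = 15.\<close>
    then show ?thesis
      unfolding nxt_prog_def by (rule triple_Cond[rotated]) (use reg0 Suc in \<open>simp_all add: algebra_simps\<close>)
  qed
qed


end

section \<open>Enumeration on indices\<close>

context indexed_instance
begin

definition shortest :: nat where
  "shortest = (LEAST k. \<exists>es. matching es \<and> length es = k)"

text \<open>At one edge, the transitions used from all states together number at most
  \<open>nD\<close>. Labels are read once per state, which contributes \<open>nQ\<close> times the
  total label size.\<close>

lemma total_cost_le:
  "total_cost \<le> (nV + nE + (\<Sum>e<nE. nlab e)) * (nL + nQ + nD)"
proof -
  let ?N = "\<Sum>e<nE. nlab e"
  have "(\<Sum>p<nQ. cost e p) \<le> nQ + nQ * nlab e + nD" if "e < nE" for e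
  proof -
    have "(\<Sum>p<nQ. cost e p) = nQ + nQ * nlab e + (\<Sum>p<nQ. length (succs e p))"
      unfolding cost_def sum.distrib by simp
    also have "(\<Sum>p<nQ. length (succs e p)) \<le> nD"
      unfolding nD_def by (rule sum_mono) (rule length_succs[OF that])
    finally show ?thesis
      by simp
  qed
  then have "(\<Sum>e<nE. \<Sum>p<nQ. cost e p) \<le> (\<Sum>e<nE. nQ + nQ * nlab e + nD)"
    by (intro sum_mono) simp
  also have "\<dots> = nE * nQ + nQ * ?N + nE * nD"
    unfolding sum.distrib sum_distrib_left by simp
  finally have "total_cost \<le> nV * nQ + (nE * nQ + nQ * ?N + nE * nD)"
    unfolding total_cost_def by (rule add_left_mono)
  also have "\<dots> \<le> (nV + nE + ?N) * (nL + nQ + nD)"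
    by (simp add: algebra_simps)
  finally show ?thesis .
qed

lemma enumeration:
  obtains ess T \<sigma>\<^sub>0 where "distinct ess" "set ess = {es. matching es \<and> length es = shortest}"
    "run I pre_prog init_state T \<sigma>\<^sub>0" "T \<le> 76 * total_cost + 25"
    "if ess = [] then reg \<sigma>\<^sub>0 0 = 0 else holds (hd ess) \<sigma>\<^sub>0"
    "\<And>i \<sigma>. i < length ess \<Longrightarrow> data \<sigma> = data \<sigma>\<^sub>0 \<Longrightarrow> holds (ess ! i) \<sigma> \<Longrightarrow>
       triple I \<sigma> nxt_prog (2 + shortest * (66 + 32 * nQ + 15 * nD))
         (\<lambda>\<sigma>'. if Suc i < length ess then holds (ess ! Suc i) \<sigma>' else reg \<sigma>' 0 = 0)"
proof -
  obtain T \<sigma>\<^sub>0 where r: "run I pre_prog init_state T \<sigma>\<^sub>0" "T \<le> 76 * total_cost + 25"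
    and c: "reg \<sigma>\<^sub>0 0 = 0 \<and> (\<forall>es. \<not> matching es) \<or>
     (\<exists>d l es. distances I d \<and> distances.tables I d (data \<sigma>\<^sub>0) \<and> distances.level I d l \<and>
       length es = l \<and> matching es \<and> holds es \<sigma>\<^sub>0 \<and> stored es (data \<sigma>\<^sub>0))"
    using triple_pre unfolding triple_def by blast
  from c show thesis
  proof (elim disjE exE conjE)
    assume "reg \<sigma>\<^sub>0 0 = 0" "\<forall>es. \<not> matching es"
    then show thesis
      using that[of "[]" T \<sigma>\<^sub>0] r by simp
  next
    fix d l es0
    assume d: "distances I d" and T: "distances.tables I d (data \<sigma>\<^sub>0)" and lev: "distances.level I d l"
      and es0: "length es0 = l" "matching es0" "holds es0 \<sigma>\<^sub>0" "stored es0 (data \<sigma>\<^sub>0)"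
    interpret distances I d by (rule d)
    let ?ws = "enum l tV (roots l)"
    have live: "live l tV (roots l)"
      by (rule live_roots[OF lev])
    have set_ws: "set ?ws = {es. matching es \<and> length es = l}"
      by (rule set_enum_roots[OF lev])
    have sh: "shortest = l"
      unfolding shortest_def using es0(1,2) level_matching[OF lev] by (intro Least_equality) auto
    \<comment> \<open>The rotation makes the stored first walk the head of the list and keeps the
      cyclic successor.\<close>
    obtain ess where ess: "distinct ess" "set ess = set ?ws" "ess \<noteq> []" "hd ess = es0"
      "\<And>i. i < length ess \<Longrightarrow>
        (case next_walk (ess ! i) tV (roots l) of Some x \<Rightarrow> x | None \<Rightarrow> hd ?ws) = ess ! (Suc i mod length ess)"
      using links_rotate[OF links_enum[OF live] distinct_enum[OF live], of es0] es0(1,2) set_ws by auto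
    show thesis
    proof (rule that[OF ess(1) _ r])
      show "set ess = {es. matching es \<and> length es = shortest}"
        using ess(2) set_ws sh by simp
      show "if ess = [] then reg \<sigma>\<^sub>0 0 = 0 else holds (hd ess) \<sigma>\<^sub>0"
        using ess(3,4) es0(3) by simp
      fix i \<sigma>
      assume i: "i < length ess" and \<sigma>: "data \<sigma> = data \<sigma>\<^sub>0" "holds (ess ! i) \<sigma>"
      have mem: "ess ! i \<in> set ?ws"
        using nth_mem[OF i] ess(2) by simp
      have f: "follow l (ess ! i) = ess ! (Suc i mod length ess)"
        using ess(5)[OF i] by (simp add: follow_def)
      \<comment> \<open>The list is distinct, so its first walk recurs exactly after the last one:
        comparison with the stored walk detects the end and nothing else.\<close>
      have wrap: "ess ! (Suc i mod length ess) = es0 \<longleftrightarrow> \<not> Suc i < length ess"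
      proof -
        have e0: "es0 = ess ! 0"
          using ess(3,4) by (simp add: hd_conv_nth)
        show ?thesis
        proof (cases "Suc i < length ess")
          case True
          then have "ess ! Suc i \<noteq> ess ! 0"
            using nth_eq_iff_index_eq[OF ess(1) True, of 0] ess(3) by simp
          then show ?thesis
            using True e0 by simp
        next
          case False
          then have "Suc i = length ess"
            using i by simp
          then show ?thesis
            using e0 by simp
        qed
      qed
      have "triple I \<sigma> nxt_prog (2 + l * (66 + 32 * nQ + 15 * nD))
         (\<lambda>\<tau>. if follow l (ess ! i) = es0 then reg \<tau> 0 = 0 else holds (follow l (ess ! i)) \<tau>)"
        by (rule triple_nxt) (use T es0 lev mem \<sigma> in simp_all)
      then show "triple I \<sigma> nxt_prog (2 + shortest * (66 + 32 * nQ + 15 * nD))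
         (\<lambda>\<sigma>'. if Suc i < length ess then holds (ess ! Suc i) \<sigma>' else reg \<sigma>' 0 = 0)"
        unfolding sh
        by (rule triple_mono) (auto simp: f wrap split: if_splits)
    qed
  qed
qed

end


section \<open>From indices to the instance\<close>

lemma pos_nth:
  assumes "distinct xs" "i < length xs"
  shows "pos xs (xs ! i) = i"
  unfolding pos_def using assms by (intro Least_equality) (auto simp: nth_eq_iff_index_eq)

lemma pos_in:
  assumes "x \<in> set xs"
  shows "pos xs x < length xs" "xs ! pos xs x = x"
proof -
  have "\<exists>i. i < length xs \<and> xs ! i = x"
    using assms by (simp add: in_set_conv_nth)
  from LeastI_ex[OF this] show "pos xs x < length xs" "xs ! pos xs x = x"
    by (simp_all add: pos_def)
qed

text \<open>Common source of the locale assumptions on adjacency arrays, label lists, and initial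
  and final states: each of these arrays, read through positions, enumerates the indices of a subset
  without repetition.\<close>

lemma bij_pos:
  assumes "lists_set xs X" "lists_set ys Y" "X \<subseteq> Y"
  shows "bij_betw (\<lambda>i. pos ys (xs ! i)) {..<length xs} {j. j < length ys \<and> ys ! j \<in> X}"
proof (rule bij_betw_imageI)
  have xs: "distinct xs" "set xs = X" and ys: "distinct ys" "set ys = Y"
    using assms(1,2) by (simp_all add: lists_set_def)
  have memX: "xs ! i \<in> X" if "i < length xs" for i
    using nth_mem[OF that] xs(2) by simp
  have memY: "xs ! i \<in> set ys" if "i < length xs" for i
    using subsetD[OF assms(3) memX[OF that]] ys(2) by simp
  show "inj_on (\<lambda>i. pos ys (xs ! i)) {..<length xs}"
  proof (rule inj_onI)
    fix i j
    assume ij: "i \<in> {..<length xs}" "j \<in> {..<length xs}" "pos ys (xs ! i) = pos ys (xs ! j)"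
    have "xs ! i = ys ! pos ys (xs ! i)"
      by (rule pos_in(2)[OF memY, symmetric]) (use ij(1) in simp)
    also have "\<dots> = ys ! pos ys (xs ! j)"
      by (simp only: ij(3))
    also have "\<dots> = xs ! j"
      by (rule pos_in(2)[OF memY]) (use ij(2) in simp)
    finally show "i = j"
      using nth_eq_iff_index_eq[OF xs(1), of i j] ij(1,2) by simp
  qed
  show "(\<lambda>i. pos ys (xs ! i)) ` {..<length xs} = {j. j < length ys \<and> ys ! j \<in> X}"
  proof (intro set_eqI iffI)
    fix j
    assume "j \<in> {j. j < length ys \<and> ys ! j \<in> X}"
    then have j: "j < length ys" "ys ! j \<in> set xs"
      using xs(2) by simp_all
    then obtain i where i: "i < length xs" "xs ! i = ys ! j"
      by (metis in_set_conv_nth)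
    then have "j = pos ys (xs ! i)"
      using pos_nth[OF ys(1) j(1)] by simp
    then show "j \<in> (\<lambda>i. pos ys (xs ! i)) ` {..<length xs}"
      using i(1) by (intro image_eqI) simp_all
  next
    fix j
    assume "j \<in> (\<lambda>i. pos ys (xs ! i)) ` {..<length xs}"
    then obtain i where i': "j = pos ys (xs ! i)" "i \<in> {..<length xs}"
      by (rule imageE)
    then have i: "i < length xs" "j = pos ys (xs ! i)"
      by simp_all
    show "j \<in> {j. j < length ys \<and> ys ! j \<in> X}"
      using memX[OF i(1)] pos_in[OF memY[OF i(1)]] i(2) by simp
  qed
qed

lemma lists_set_length: "lists_set xs X \<Longrightarrow> length xs = card X"
  by (auto simp: lists_set_def distinct_card)

locale presented =
  fixes D :: "('v, 'e, 'a) database" and A :: "('q, 'a) nfa" and s t :: 'v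
    and P :: "('v, 'e, 'a, 'q) presentation"
  assumes D: "database D" and A: "nfa A" and alph: "nfa_alph A = db_alph D"
    and s: "s \<in> verts D" and t: "t \<in> verts D" and P: "presents P D A"
begin

abbreviation "I \<equiv> instance_input P D s t"
abbreviation "vl \<equiv> vert_list P"
abbreviation "el \<equiv> edge_list P"
abbreviation "al \<equiv> alph_list P"
abbreviation "sl \<equiv> state_list P"

lemma vl: "lists_set vl (verts D)" and el: "lists_set el (edges D)"
  and al: "lists_set al (db_alph D)" and sl: "lists_set sl (states A)"
  and inits: "lists_set (initial_list P) (initial A)" and fins: "lists_set (final_list P) (final A)"
  using P by (simp_all add: presents_def)

lemma in_arr: "v \<in> verts D \<Longrightarrow> lists_set (in_arr P v) {e \<in> edges D. tgt D e = v}"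
  and out_arr: "v \<in> verts D \<Longrightarrow> lists_set (out_arr P v) {e \<in> edges D. src D e = v}"
  and lbl_list: "e \<in> edges D \<Longrightarrow> lists_set (lbl_list P e) (lbl D e)"
  and succ_list: "q \<in> states A \<Longrightarrow> a \<in> db_alph D \<Longrightarrow> lists_set (succ_list P q a) {q'. (q, a, q') \<in> trans A}"
  using P by (simp_all add: presents_def)

lemma edge_in: "e \<in> edges D \<Longrightarrow> src D e \<in> verts D \<and> tgt D e \<in> verts D \<and> lbl D e \<subseteq> db_alph D"
  using D by (simp add: database_def)

lemma trans_in: "(p, a, q) \<in> trans A \<Longrightarrow> p \<in> states A \<and> a \<in> db_alph D \<and> q \<in> states A"
  using A alph by (auto simp: nfa_def)

lemma initial_in: "initial A \<subseteq> states A" and final_in: "final A \<subseteq> states A"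
  using A by (simp_all add: nfa_def)

lemma nth_in:
  "i < length vl \<Longrightarrow> vl ! i \<in> verts D" "i < length el \<Longrightarrow> el ! i \<in> edges D"
  "i < length al \<Longrightarrow> al ! i \<in> db_alph D" "i < length sl \<Longrightarrow> sl ! i \<in> states A"
  using vl el al sl by (auto simp: lists_set_def)

lemma index:
  "x \<in> verts D \<Longrightarrow> pos vl x < length vl \<and> vl ! pos vl x = x"
  "e \<in> edges D \<Longrightarrow> pos el e < length el \<and> el ! pos el e = e"
  "a \<in> db_alph D \<Longrightarrow> pos al a < length al \<and> al ! pos al a = a"
  "q \<in> states A \<Longrightarrow> pos sl q < length sl \<and> sl ! pos sl q = q"
  using vl el al sl by (simp_all add: lists_set_def pos_in)

lemma pos_vl_eq: "x \<in> verts D \<Longrightarrow> i < length vl \<Longrightarrow> pos vl x = i \<longleftrightarrow> x = vl ! i"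
  using index(1)[of x] pos_nth[of vl i] vl by (auto simp: lists_set_def)

lemma edges_at:
  assumes "v < length vl" "\<And>e. e \<in> edges D \<Longrightarrow> f e \<in> verts D"
  shows "{j. j < length el \<and> el ! j \<in> {e \<in> edges D. f e = vl ! v}} =
    {j. j < length el \<and> at el j (\<lambda>x. pos vl (f x)) = v}"
proof (intro Collect_cong conj_cong refl)
  fix j
  assume j: "j < length el"
  have "pos vl (f (el ! j)) = v \<longleftrightarrow> f (el ! j) = vl ! v"
    using nth_in(2)[OF j] assms by (intro pos_vl_eq) auto
  then show "el ! j \<in> {e \<in> edges D. f e = vl ! v} \<longleftrightarrow> at el j (\<lambda>x. pos vl (f x)) = v"
    using nth_in(2)[OF j] j by (simp add: at_def)
qed

end

sublocale presented \<subseteq> indexed_instance "instance_input P D s t"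
proof (unfold_locales, goal_cases)
  case 1
  show ?case using index(1)[OF s] by simp
next
  case 2
  show ?case using index(1)[OF t] by simp
next
  case (3 e)
  then show ?case using index(1)[of "src D (el ! e)"] edge_in[of "el ! e"] nth_in(2)[of e] by (simp add: at_def)
next
  case (4 e)
  then show ?case using index(1)[of "tgt D (el ! e)"] edge_in[of "el ! e"] nth_in(2)[of e] by (simp add: at_def)
next
  case (5 v)
  then have v: "v < length vl" "vl ! v \<in> verts D"
    using nth_in(1)[of v] by simp_all
  let ?xs = "in_arr P (vl ! v)"
  have "bij_betw (\<lambda>i. pos el (?xs ! i)) {..<length ?xs}
    {j. j < length el \<and> el ! j \<in> {e \<in> edges D. tgt D e = vl ! v}}"
    by (rule bij_pos[OF in_arr[OF v(2)] el]) blast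
  also have "{j. j < length el \<and> el ! j \<in> {e \<in> edges D. tgt D e = vl ! v}} =
      {j. j < length el \<and> at el j (\<lambda>x. pos vl (tgt D x)) = v}"
    using edge_in by (intro edges_at[OF v(1)]) simp
  finally have b: "bij_betw (\<lambda>i. pos el (?xs ! i)) {..<length ?xs}
      {j. j < length el \<and> at el j (\<lambda>x. pos vl (tgt D x)) = v}" .
  have deg: "at vl v (\<lambda>x. length (in_arr P x)) = length ?xs"
    using v(1) by (simp add: at_def)
  show ?case
    unfolding instance_input.simps deg
    by (rule iffD2[OF bij_betw_cong b]) (use v(1) in \<open>simp add: at_def\<close>)
next
  case (6 v)
  then have v: "v < length vl" "vl ! v \<in> verts D"
    using nth_in(1)[of v] by simp_all
  let ?xs = "out_arr P (vl ! v)"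
  have "bij_betw (\<lambda>i. pos el (?xs ! i)) {..<length ?xs}
    {j. j < length el \<and> el ! j \<in> {e \<in> edges D. src D e = vl ! v}}"
    by (rule bij_pos[OF out_arr[OF v(2)] el]) blast
  also have "{j. j < length el \<and> el ! j \<in> {e \<in> edges D. src D e = vl ! v}} =
      {j. j < length el \<and> at el j (\<lambda>x. pos vl (src D x)) = v}"
    using edge_in by (intro edges_at[OF v(1)]) simp
  finally have b: "bij_betw (\<lambda>i. pos el (?xs ! i)) {..<length ?xs}
      {j. j < length el \<and> at el j (\<lambda>x. pos vl (src D x)) = v}" .
  have deg: "at vl v (\<lambda>x. length (out_arr P x)) = length ?xs"
    using v(1) by (simp add: at_def)
  show ?case
    unfolding instance_input.simps deg
    by (rule iffD2[OF bij_betw_cong b]) (use v(1) in \<open>simp add: at_def\<close>)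
next
  case (7 e l)
  then have e: "e < length el" "el ! e \<in> edges D" "l < length (lbl_list P (el ! e))"
    using nth_in(2)[of e] by (simp_all add: at_def)
  then have "lbl_list P (el ! e) ! l \<in> db_alph D"
    using lbl_list[OF e(2)] edge_in[OF e(2)] nth_mem[OF e(3)] by (auto simp: lists_set_def)
  then show ?case
    using e index(3) by (simp add: at_def)
next
  case (8 e)
  then have e: "e < length el" "el ! e \<in> edges D"
    using nth_in(2)[of e] by simp_all
  have "inj_on (\<lambda>l. pos al (lbl_list P (el ! e) ! l)) {..<length (lbl_list P (el ! e))}"
    using bij_pos[OF lbl_list[OF e(2)] al] edge_in[OF e(2)] by (simp add: bij_betw_def)
  then show ?case
    using e by (simp add: at_def inj_on_def)
next
  case (9 p a m)
  then have pa: "p < length sl" "a < length al" "m < length (succ_list P (sl ! p) (al ! a))"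
    "sl ! p \<in> states A" "al ! a \<in> db_alph D"
    using nth_in(4)[of p] nth_in(3)[of a] by (simp_all add: at_def)
  then have "succ_list P (sl ! p) (al ! a) ! m \<in> states A"
    using succ_list[OF pa(4,5)] nth_mem[OF pa(3)] trans_in by (auto simp: lists_set_def)
  then show ?case
    using pa index(4) by (simp add: at_def)
next
  case (10 i)
  then have "initial_list P ! i \<in> states A"
    using inits initial_in nth_mem[of i "initial_list P"] by (auto simp: lists_set_def)
  then show ?case
    using 10 index(4) by (simp add: at_def)
next
  case 11
  then show ?case
    using bij_pos[OF inits sl initial_in] by (simp add: at_def bij_betw_def inj_on_def)
next
  case (12 i)
  then have "final_list P ! i \<in> states A"
    using fins final_in nth_mem[of i "final_list P"] by (auto simp: lists_set_def)
  then show ?case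
    using 12 index(4) by (simp add: at_def)
next
  case 13
  then show ?case
    using bij_pos[OF fins sl final_in] by (simp add: at_def bij_betw_def inj_on_def)
qed

text \<open>Word and state sequence in one predicate, without a condition on the last state, so that
  a run can be extended edge by edge.\<close>

definition run_on :: "('v, 'e, 'a) database \<Rightarrow> ('q, 'a) nfa \<Rightarrow> 'e list \<Rightarrow> 'a list \<Rightarrow> 'q list \<Rightarrow> bool" where
  "run_on D A es as qs \<longleftrightarrow> length as = length es \<and> (\<forall>i<length as. as ! i \<in> lbl D (es ! i)) \<and>
     length qs = Suc (length as) \<and> hd qs \<in> initial A \<and>
     (\<forall>i<length as. (qs ! i, as ! i, qs ! Suc i) \<in> trans A)"

lemma run_on_Nil: "run_on D A [] as qs \<longleftrightarrow> as = [] \<and> (\<exists>q\<in>initial A. qs = [q])"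
  by (auto simp: run_on_def length_Suc_conv)

lemma run_on_snoc:
  "run_on D A (es @ [e]) (as @ [a]) (qs @ [q]) \<longleftrightarrow>
    run_on D A es as qs \<and> a \<in> lbl D e \<and> (last qs, a, q) \<in> trans A"
proof (cases "length as = length es \<and> length qs = Suc (length as)")
  case True
  let ?n = "length es"
  have len: "length as = ?n" "length qs = Suc ?n" and ne: "qs \<noteq> []"
    using True by auto
  have "(\<forall>i<Suc ?n. (as @ [a]) ! i \<in> lbl D ((es @ [e]) ! i)) \<longleftrightarrow>
      (\<forall>i<?n. as ! i \<in> lbl D (es ! i)) \<and> a \<in> lbl D e"
    using len by (auto simp: All_less_Suc nth_append)
  moreover have "(\<forall>i<Suc ?n. ((qs @ [q]) ! i, (as @ [a]) ! i, (qs @ [q]) ! Suc i) \<in> trans A) \<longleftrightarrow>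
      (\<forall>i<?n. (qs ! i, as ! i, qs ! Suc i) \<in> trans A) \<and> (last qs, a, q) \<in> trans A"
    using len last_conv_nth[OF ne] by (auto simp: All_less_Suc nth_append)
  ultimately show ?thesis
    using len ne by (auto simp: run_on_def)
next
  case False
  then show ?thesis
    by (auto simp: run_on_def)
qed

lemma run_on_snocE:
  assumes "run_on D A (es @ [e]) bs rs"
  obtains as a qs q where "bs = as @ [a]" "rs = qs @ [q]" "run_on D A es as qs" "a \<in> lbl D e"
    "(last qs, a, q) \<in> trans A"
proof -
  have "bs \<noteq> []" "rs \<noteq> []"
    using assms by (auto simp: run_on_def)
  then obtain as a qs q where "bs = as @ [a]" "rs = qs @ [q]"
    by (metis rev_exhaust)
  with assms that show thesis
    by (simp add: run_on_snoc)
qed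

text \<open>Edges and last vertex determine a walk, as \<open>walk_of_eq\<close> shows; the last
  vertex matters for the walk without edges.\<close>

definition walk_of :: "('v, 'e, 'a) database \<Rightarrow> 'e list \<Rightarrow> 'v \<Rightarrow> ('v, 'e) walk" where
  "walk_of D es v = (map (src D) es @ [v], es)"

lemma walk_of_snoc:
  "walk D (walk_of D (es @ [e]) v) \<longleftrightarrow>
    walk D (walk_of D es (src D e)) \<and> e \<in> edges D \<and> tgt D e = v \<and> v \<in> verts D"
  by (auto simp: walk_def walk_of_def nth_append less_Suc_eq)

lemma walk_of_eq:
  assumes "walk D w"
  shows "w = walk_of D (snd w) (last (fst w))"
proof -
  obtain vs es where w: "w = (vs, es)"
    by (cases w)
  have len: "length vs = Suc (length es)" and src: "\<And>i. i < length es \<Longrightarrow> src D (es ! i) = vs ! i"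
    using assms by (auto simp: walk_def w)
  have "vs = map (src D) es @ [last vs]"
  proof (rule nth_equalityI)
    show "length vs = length (map (src D) es @ [last vs])"
      using len by simp
    fix i
    assume "i < length vs"
    then consider "i < length es" | "i = length es"
      using len by linarith
    then show "vs ! i = (map (src D) es @ [last vs]) ! i"
    proof cases
      case 2
      moreover have "last vs = vs ! length es"
        using len last_conv_nth[of vs] by (cases vs) auto
      ultimately show ?thesis
        by (simp add: nth_append)
    qed (simp add: src nth_append)
  qed
  then show ?thesis
    by (simp add: w walk_of_def)
qed

lemma matching_walks_iff:
  "w \<in> matching_walks D A s t \<longleftrightarrow> walk D w \<and> hd (fst w) = s \<and> last (fst w) = t \<and>
    (\<exists>as qs. run_on D A (snd w) as qs \<and> last qs \<in> final A)"
  unfolding matching_walks_def walk_labels_def lang_def run_on_def by (auto; metis)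

section \<open>Walks and runs against lists of indices\<close>

context presented
begin

text \<open>The counterpart of \<open>accepted\<close> on actual edges and states. It separates the
  translation of indices, in \<open>accepted_iff\<close>, from the reversal of direction, in
  \<open>backward_iff\<close>.\<close>

primrec backward :: "'e list \<Rightarrow> 'v \<Rightarrow> 'q \<Rightarrow> bool" where
  "backward [] v q \<longleftrightarrow> v = s \<and> q \<in> initial A"
| "backward (e # es) v q \<longleftrightarrow> e \<in> edges D \<and> tgt D e = v \<and>
     (\<exists>p. (\<exists>a\<in>lbl D e. (p, a, q) \<in> trans A) \<and> backward es (src D e) p)"

text \<open>An edge put in front of the backward list is appended to the walk and to its run, so the
  forward side proceeds by \<open>walk_of_snoc\<close> and \<open>run_on_snoc\<close>.\<close>

lemma backward_iff:
  "v \<in> verts D \<Longrightarrow> backward es v q \<longleftrightarrow> walk D (walk_of D (rev es) v) \<and>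
    hd (fst (walk_of D (rev es) v)) = s \<and> (\<exists>as qs. run_on D A (rev es) as qs \<and> last qs = q)"
proof (induction es arbitrary: v q)
  case Nil
  then show ?case
    by (auto simp: run_on_Nil walk_of_def walk_def)
next
  case (Cons e es)
  have hd: "hd (fst (walk_of D (rev (e # es)) v)) = hd (fst (walk_of D (rev es) (src D e)))"
    by (cases "rev es") (simp_all add: walk_of_def)
  have run: "(\<exists>bs rs. run_on D A (rev (e # es)) bs rs \<and> last rs = q) \<longleftrightarrow>
    (\<exists>p. (\<exists>a\<in>lbl D e. (p, a, q) \<in> trans A) \<and> (\<exists>as qs. run_on D A (rev es) as qs \<and> last qs = p))" (is "?L \<longleftrightarrow> ?R")
  proof
    assume ?L
    then obtain bs rs where "run_on D A (rev es @ [e]) bs rs" "last rs = q"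
      by auto
    then show ?R
      by (elim run_on_snocE) auto
  next
    assume ?R
    then obtain a as qs where "a \<in> lbl D e" "(last qs, a, q) \<in> trans A" "run_on D A (rev es) as qs"
      by auto
    then have "run_on D A (rev (e # es)) (as @ [a]) (qs @ [q])"
      by (simp add: run_on_snoc)
    then show ?L
      by (intro exI[of _ "as @ [a]"] exI[of _ "qs @ [q]"]) simp
  qed
  have wk: "walk D (walk_of D (rev (e # es)) v) \<longleftrightarrow>
      walk D (walk_of D (rev es) (src D e)) \<and> e \<in> edges D \<and> tgt D e = v"
    using Cons.prems by (simp add: walk_of_snoc)
  show ?case
    unfolding hd run wk backward.simps using Cons.IH edge_in by blast
qed

lemma set_arcs_iff:
  assumes e: "e < length el"
  shows "(p, q) \<in> set (arcs e) \<longleftrightarrow> p < length sl \<and> q < length sl \<and>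
    (\<exists>a\<in>lbl D (el ! e). (sl ! p, a, sl ! q) \<in> trans A)"
proof (cases "p < length sl")
  case True
  have ein: "el ! e \<in> edges D" and p: "sl ! p \<in> states A"
    using nth_in e True by auto
  have "q \<in> set (succs e p) \<longleftrightarrow> (\<exists>x\<in>set (lbl_list P (el ! e)). \<exists>y\<in>set (succ_list P (sl ! p) x). pos sl y = q)"
  proof
    assume "q \<in> set (succs e p)"
    then have "\<exists>l<nlab e.
        \<exists>m<nsuc p (lab e l).
          q = suc p (lab e l) m"
      by (auto simp: succs_def simp del: instance_input.simps) blast
    then obtain l m where l: "l < length (lbl_list P (el ! e))"
      "m < nsuc p (pos al (lbl_list P (el ! e) ! l))"
      "q = suc p (pos al (lbl_list P (el ! e) ! l)) m"
      using e by (auto simp: at_def simp del: instance_input.simps(16,17))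
    let ?a = "lbl_list P (el ! e) ! l"
    have a: "?a \<in> db_alph D"
      using l(1) nth_mem[OF l(1)] lbl_list[OF ein] edge_in[OF ein] by (auto simp: lists_set_def)
    have m: "m < length (succ_list P (sl ! p) ?a)" "q = pos sl (succ_list P (sl ! p) ?a ! m)"
      using l(2,3) True index(3)[OF a] by (simp_all add: at_def)
    show "\<exists>x\<in>set (lbl_list P (el ! e)). \<exists>y\<in>set (succ_list P (sl ! p) x). pos sl y = q"
      using l(1) m by (intro bexI[of _ ?a] bexI[of _ "succ_list P (sl ! p) ?a ! m"]) simp_all
  next
    assume "\<exists>x\<in>set (lbl_list P (el ! e)). \<exists>y\<in>set (succ_list P (sl ! p) x). pos sl y = q"
    then obtain x y where xy: "x \<in> set (lbl_list P (el ! e))" "y \<in> set (succ_list P (sl ! p) x)" "pos sl y = q"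
      by auto
    obtain l where l: "l < length (lbl_list P (el ! e))" "lbl_list P (el ! e) ! l = x"
      using xy(1) by (metis in_set_conv_nth)
    obtain m where m: "m < length (succ_list P (sl ! p) x)" "succ_list P (sl ! p) x ! m = y"
      using xy(2) by (metis in_set_conv_nth)
    have a: "x \<in> db_alph D"
      using xy(1) lbl_list[OF ein] edge_in[OF ein] by (auto simp: lists_set_def)
    have "l < nlab e"
      "lab e l = pos al x"
      using e l by (simp_all add: at_def)
    moreover have "m < nsuc p (pos al x)"
      "suc p (pos al x) m = q"
      using True index(3)[OF a] m xy(3) by (simp_all add: at_def)
    ultimately show "q \<in> set (succs e p)"
      unfolding succs_def by (auto simp del: instance_input.simps intro!: bexI[of _ l] image_eqI[of _ _ m])
  qed
  also have "\<dots> \<longleftrightarrow> (\<exists>x\<in>lbl D (el ! e). \<exists>y. (sl ! p, x, y) \<in> trans A \<and> pos sl y = q)"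
  proof -
    have "set (lbl_list P (el ! e)) = lbl D (el ! e)"
      using lbl_list[OF ein] by (simp add: lists_set_def)
    moreover have "set (succ_list P (sl ! p) x) = {y. (sl ! p, x, y) \<in> trans A}" if "x \<in> lbl D (el ! e)" for x
      using succ_list[OF p, of x] that edge_in[OF ein] by (auto simp: lists_set_def)
    ultimately show ?thesis
      by auto
  qed
  also have "\<dots> \<longleftrightarrow> q < length sl \<and> (\<exists>a\<in>lbl D (el ! e). (sl ! p, a, sl ! q) \<in> trans A)"
  proof -
    have "(\<exists>y. (sl ! p, x, y) \<in> trans A \<and> pos sl y = q) \<longleftrightarrow> q < length sl \<and> (sl ! p, x, sl ! q) \<in> trans A" for x
      using trans_in index(4) pos_nth[of sl q] sl by (auto simp: lists_set_def)
    then show ?thesis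
      by auto
  qed
  finally show ?thesis
    using True by (simp add: set_arcs)
qed (simp add: set_arcs)

lemma accepted_iff:
  "v < length vl \<Longrightarrow> q < length sl \<Longrightarrow> accepted es v q \<longleftrightarrow>
    set es \<subseteq> {..<length el} \<and> backward (map ((!) el) es) (vl ! v) (sl ! q)"
proof (induction es arbitrary: v q)
  case Nil
  have "v = pos vl s \<longleftrightarrow> vl ! v = s"
    using pos_vl_eq[OF s Nil(1)] by auto
  moreover have "ini ` {..<length (initial_list P)} =
      {j. j < length sl \<and> sl ! j \<in> initial A}"
    using bij_pos[OF inits sl initial_in] by (simp add: bij_betw_def at_def)
  ultimately show ?case
    using Nil by simp
next
  case (Cons e es)
  show ?case
  proof (cases "e < length el")
    case True
    then have ein: "el ! e \<in> edges D"
      using nth_in by simp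
    have "etgt e = v \<longleftrightarrow> tgt D (el ! e) = vl ! v"
      using True pos_vl_eq[OF _ Cons.prems(1)] edge_in[OF ein] by (simp add: at_def)
    moreover have src: "esrc e < length vl"
      "vl ! esrc e = src D (el ! e)"
      using True index(1) edge_in[OF ein] by (simp_all add: at_def)
    moreover have "(\<exists>p. (p, q) \<in> set (arcs e) \<and> accepted es (esrc e) p) \<longleftrightarrow>
      set es \<subseteq> {..<length el} \<and> (\<exists>p. (\<exists>a\<in>lbl D (el ! e). (p, a, sl ! q) \<in> trans A) \<and>
        backward (map ((!) el) es) (src D (el ! e)) p)" (is "?L \<longleftrightarrow> ?R")
    proof
      assume ?L
      then obtain p where p: "(p, q) \<in> set (arcs e)" "accepted es (esrc e) p"
        by auto
      with Cons.IH[OF src(1), of p] src(2) show ?R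
        unfolding set_arcs_iff[OF True] by auto
    next
      assume R: ?R
      then obtain p a where p: "a \<in> lbl D (el ! e)" "(p, a, sl ! q) \<in> trans A"
        "backward (map ((!) el) es) (src D (el ! e)) p"
        by auto
      have i: "pos sl p < length sl" "sl ! pos sl p = p"
        using index(4) trans_in[OF p(2)] by auto
      have "(pos sl p, q) \<in> set (arcs e)"
        unfolding set_arcs_iff[OF True] using i Cons.prems(2) p by auto
      moreover have "accepted es (esrc e) (pos sl p)"
        using Cons.IH[OF src(1) i(1)] R p(3) src(2) i(2) by simp
      ultimately show ?L
        by blast
    qed
    ultimately show ?thesis
      using True ein by (auto simp del: instance_input.simps simp: instance_input.simps(2))
  qed simp
qed

text \<open>Lists of indices run from \<open>t\<close> to \<open>s\<close>, walks from
  \<open>s\<close> to \<open>t\<close>.\<close>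

definition conv :: "nat list \<Rightarrow> ('v, 'e) walk" where
  "conv es = walk_of D (map ((!) el) (rev es)) t"

lemma matching_iff: "matching es \<longleftrightarrow> set es \<subseteq> {..<length el} \<and> conv es \<in> matching_walks D A s t"
proof -
  have fin: "fin ` {..<length (final_list P)} =
      {j. j < length sl \<and> sl ! j \<in> final A}"
    using bij_pos[OF fins sl final_in] by (simp add: bij_betw_def at_def)
  have tv: "pos vl t < length vl" "vl ! pos vl t = t"
    using index(1)[OF t] by auto
  have "matching es \<longleftrightarrow> (\<exists>q\<in>{j. j < length sl \<and> sl ! j \<in> final A}. accepted es (pos vl t) q)"
    unfolding matching_def fin[symmetric] by (simp only: instance_input.simps)
  then have "matching es \<longleftrightarrow> (\<exists>q. q < length sl \<and> sl ! q \<in> final A \<and> accepted es (pos vl t) q)"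
    by auto
  also have "\<dots> \<longleftrightarrow> (\<exists>q. q < length sl \<and> sl ! q \<in> final A \<and> set es \<subseteq> {..<length el} \<and>
      backward (map ((!) el) es) t (sl ! q))"
    by (simp only: accepted_iff[OF tv(1)] tv(2) cong: conj_cong)
  also have "\<dots> \<longleftrightarrow> set es \<subseteq> {..<length el} \<and> (\<exists>q\<in>final A. backward (map ((!) el) es) t q)" (is "?L \<longleftrightarrow> ?R")
  proof
    assume ?R
    then obtain q where q: "set es \<subseteq> {..<length el}" "q \<in> final A" "backward (map ((!) el) es) t q"
      by auto
    have "q \<in> states A"
      using q(2) final_in by (rule subsetD[rotated])
    from index(4)[OF this] q show ?L
      by (intro exI[of _ "pos sl q"]) simp
  qed auto
  also have "\<dots> \<longleftrightarrow> set es \<subseteq> {..<length el} \<and> conv es \<in> matching_walks D A s t"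
  proof -
    have "last (fst (conv es)) = t" "snd (conv es) = rev (map ((!) el) es)"
      "conv es = walk_of D (rev (map ((!) el) es)) t"
      by (simp_all add: conv_def walk_of_def rev_map)
    then show ?thesis
      unfolding backward_iff[OF t] matching_walks_iff by auto
  qed
  finally show ?thesis .
qed

lemma conv_inj: "set es \<subseteq> {..<length el} \<Longrightarrow> set fs \<subseteq> {..<length el} \<Longrightarrow> conv es = conv fs \<Longrightarrow> es = fs"
proof -
  assume sub: "set es \<subseteq> {..<length el}" "set fs \<subseteq> {..<length el}" and "conv es = conv fs"
  then have "map ((!) el) es = map ((!) el) fs"
    by (simp add: conv_def walk_of_def rev_map[symmetric])
  moreover have "inj_on ((!) el) (set es \<union> set fs)"
    using el sub by (intro inj_on_nth) (auto simp: lists_set_def)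
  ultimately show "es = fs"
    by (simp add: inj_on_map_eq_map)
qed

lemma conv_surj:
  assumes "w \<in> matching_walks D A s t"
  obtains es where "matching es" "conv es = w"
proof -
  let ?es = "map (pos el) (rev (snd w))"
  have w: "walk D w" "last (fst w) = t"
    using assms by (simp_all add: matching_walks_iff)
  then have e: "set (snd w) \<subseteq> edges D"
    by (auto simp: walk_def)
  have "map ((!) el) (rev ?es) = snd w"
    using e index(2) by (simp add: rev_map comp_def map_idI subset_iff)
  then have "conv ?es = w"
    using walk_of_eq[OF w(1)] w(2) by (simp add: conv_def)
  moreover have "set ?es \<subseteq> {..<length el}"
    using e index(2) by auto
  ultimately show thesis
    using that[of ?es] matching_iff assms by simp
qed

lemma walk_length_conv: "walk_length (conv es) = length es"
  by (simp add: walk_length_def conv_def walk_of_def)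

lemma shortest_eq: "shortest_length D A s t = shortest"
proof -
  have "(\<exists>w\<in>matching_walks D A s t. walk_length w = k) \<longleftrightarrow> (\<exists>es. matching es \<and> length es = k)" for k
    using conv_surj matching_iff walk_length_conv by metis
  then show ?thesis
    by (simp add: shortest_length_def shortest_def)
qed

lemma distinct_shortest_walks_eq:
  "distinct_shortest_walks D A s t = conv ` {es. matching es \<and> length es = shortest}"
proof (intro set_eqI iffI)
  fix w
  assume w: "w \<in> distinct_shortest_walks D A s t"
  then have "w \<in> matching_walks D A s t"
    by (simp add: distinct_shortest_walks_def)
  then obtain es where "matching es" "conv es = w"
    by (rule conv_surj)
  then show "w \<in> conv ` {es. matching es \<and> length es = shortest}"
    using w walk_length_conv[of es] by (auto simp: distinct_shortest_walks_def shortest_eq)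
qed (auto simp: distinct_shortest_walks_def shortest_eq matching_iff walk_length_conv)

lemma outputs_conv:
  assumes "set es \<subseteq> {..<length el}"
  shows "outputs P \<sigma> (conv es) \<longleftrightarrow> holds es \<sigma>"
proof -
  let ?l = "length es"
  have edge: "pos el (map ((!) el) (rev es) ! i) = es ! (?l - Suc i)" if "i < ?l" for i
  proof -
    have "es ! (?l - Suc i) \<in> set es"
      using that by (intro nth_mem) simp
    then have "es ! (?l - Suc i) < length el"
      using assms by auto
    then show ?thesis
      using that el pos_nth[of el "es ! (?l - Suc i)"] by (simp add: rev_nth lists_set_def)
  qed
  have vert: "pos vl ((map (src D) (map ((!) el) (rev es)) @ [t]) ! i) = vertex (pos vl t) es (?l - i)"
    if "i \<le> ?l" for i
  proof (cases "i = ?l")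
    case False
    then have i: "i < ?l" "?l - i = Suc (?l - Suc i)"
      using that by auto
    have "es ! (?l - Suc i) \<in> set es"
      using i(1) by (intro nth_mem) simp
    then have "es ! (?l - Suc i) < length el"
      using assms by auto
    then show ?thesis
      using i by (simp add: nth_append rev_nth vertex_def at_def)
  qed (simp add: nth_append vertex_def)
  \<comment> \<open>Reindexing between counting from the start of the walk, as in
    \<open>outputs\<close>, and from its end, as in \<open>holds\<close>.\<close>
  have flip: "(\<forall>i\<le>?l. Q (?l - i) i) \<longleftrightarrow> (\<forall>j\<le>?l. Q j (?l - j))" for Q :: "nat \<Rightarrow> nat \<Rightarrow> bool"
    by (metis diff_diff_cancel diff_le_self)
  have flip': "(\<forall>i<?l. Q (?l - Suc i) i) \<longleftrightarrow> (\<forall>j<?l. Q j (?l - Suc j))" for Q :: "nat \<Rightarrow> nat \<Rightarrow> bool"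
  proof -
    have "?l - Suc (?l - Suc i) = i" "?l - Suc i < ?l" if "i < ?l" for i
      using that by auto
    then show ?thesis
      by metis
  qed
  have "outputs P \<sigma> (conv es) \<longleftrightarrow> reg \<sigma> 0 = Suc ?l \<and>
    (\<forall>i\<le>?l. work \<sigma> 0 0 i = vertex (pos vl t) es (?l - i)) \<and> (\<forall>i<?l. work \<sigma> 0 1 i = es ! (?l - Suc i))"
    unfolding outputs_def conv_def walk_of_def prod.case
    using vert edge by (simp add: less_Suc_eq_le)
  also have "\<dots> \<longleftrightarrow> holds es \<sigma>"
    unfolding flip[of "\<lambda>j i. work \<sigma> 0 0 i = vertex (pos vl t) es j"]
      flip'[of "\<lambda>j i. work \<sigma> 0 1 i = es ! j"] holds_def holds_part_def
    by simp
  finally show ?thesis .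
qed

section \<open>Sizes of the instance in terms of indices\<close>

lemma nD_eq: "nD = card (trans A)"
proof -
  have fin: "finite (states A)" "finite (db_alph D)"
    using A D by (auto simp: nfa_def database_def)
  have bs: "bij_betw ((!) sl) {..<length sl} (states A)" and ba: "bij_betw ((!) al) {..<length al} (db_alph D)"
    using sl al by (auto simp: lists_set_def intro!: bij_betw_nth)
  have "nD = (\<Sum>p<length sl. \<Sum>a<length al. length (succ_list P (sl ! p) (al ! a)))"
    unfolding nD_def by (simp add: at_def)
  also have "\<dots> = (\<Sum>p\<in>states A. \<Sum>a\<in>db_alph D. length (succ_list P p a))"
    unfolding sum.reindex_bij_betw[OF bs, symmetric] sum.reindex_bij_betw[OF ba, symmetric] ..
  also have "\<dots> = (\<Sum>p\<in>states A. \<Sum>a\<in>db_alph D. card {q. (p, a, q) \<in> trans A})"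
    using succ_list lists_set_length by (intro sum.cong refl) blast
  \<comment> \<open>The transition relation is the disjoint union of its successor sets over all
    states and letters.\<close>
  also have "\<dots> = card (SIGMA p:states A. SIGMA a:db_alph D. {q. (p, a, q) \<in> trans A})"
  proof -
    have "finite {q. (p, a, q) \<in> trans A}" for p a
      by (rule finite_subset[OF _ fin(1)]) (use trans_in in blast)
    then show ?thesis
      using fin by (simp add: card_SigmaI)
  qed
  also have "(SIGMA p:states A. SIGMA a:db_alph D. {q. (p, a, q) \<in> trans A}) = trans A"
    using trans_in by auto
  finally show ?thesis .
qed

lemma nfa_size_eq: "nfa_size A = length al + length sl + nD"
  using lists_set_length[OF al] lists_set_length[OF sl] by (simp add: nfa_size_def alph nD_eq)

lemma db_size_eq: "db_size D = length vl + length el + (\<Sum>e<length el. nlab e)"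
proof -
  have be: "bij_betw ((!) el) {..<length el} (edges D)"
    using el by (auto simp: lists_set_def intro!: bij_betw_nth)
  have "(\<Sum>e\<in>edges D. card (lbl D e)) = (\<Sum>e\<in>edges D. length (lbl_list P e))"
    by (intro sum.cong refl) (simp add: lists_set_length[OF lbl_list])
  also have "\<dots> = (\<Sum>e<length el. length (lbl_list P (el ! e)))"
    unfolding sum.reindex_bij_betw[OF be, symmetric] ..
  also have "\<dots> = (\<Sum>e<length el. nlab e)"
    by (simp add: at_def)
  finally show ?thesis
    using lists_set_length[OF vl] lists_set_length[OF el] by (simp add: db_size_def)
qed

lemma memoryless:
  "memoryless_enumeration I (outputs P) pre_prog nxt_prog (distinct_shortest_walks D A s t)
     (100 * (db_size D * nfa_size A + 1)) (100 * (shortest_length D A s t * nfa_size A + 1))"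
proof -
  obtain ess T \<sigma>\<^sub>0 where ess: "distinct ess" "set ess = {es. matching es \<and> length es = shortest}"
    and run: "run I pre_prog init_state T \<sigma>\<^sub>0" "T \<le> 76 * total_cost + 25"
    and first: "if ess = [] then reg \<sigma>\<^sub>0 0 = 0 else holds (hd ess) \<sigma>\<^sub>0"
    and nxt: "\<And>i \<sigma>. i < length ess \<Longrightarrow> data \<sigma> = data \<sigma>\<^sub>0 \<Longrightarrow> holds (ess ! i) \<sigma> \<Longrightarrow>
       triple I \<sigma> nxt_prog (2 + shortest * (66 + 32 * length sl + 15 * nD))
         (\<lambda>\<sigma>'. if Suc i < length ess then holds (ess ! Suc i) \<sigma>' else reg \<sigma>' 0 = 0)"
    using enumeration by auto
  have sub: "set es \<subseteq> {..<length el}" if "es \<in> set ess" for es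
    using that ess(2) matching_iff by simp
  let ?ws = "map conv ess"
  have out: "outputs P \<sigma> (?ws ! i) \<longleftrightarrow> holds (ess ! i) \<sigma>" if "i < length ess" for i \<sigma>
    using that outputs_conv[OF sub[OF nth_mem[OF that]]] by simp
  have "total_cost \<le> db_size D * nfa_size A"
    using total_cost_le unfolding db_size_eq nfa_size_eq by simp
  then have "T \<le> 76 * (db_size D * nfa_size A) + 25"
    using run(2) by linarith
  also have "\<dots> \<le> 100 * (db_size D * nfa_size A + 1)"
    by simp
  finally have time: "T \<le> 100 * (db_size D * nfa_size A + 1)" .
  have distinct: "distinct ?ws"
    unfolding distinct_map using ess(1) conv_inj sub by (auto intro: inj_onI)
  have set: "set ?ws = distinct_shortest_walks D A s t"
    by (simp add: distinct_shortest_walks_eq ess(2))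
  have out_first: "if ?ws = [] then no_output \<sigma>\<^sub>0 else outputs P \<sigma>\<^sub>0 (hd ?ws)"
  proof (cases ess)
    case (Cons es fs)
    then show ?thesis
      using first outputs_conv[OF sub] by simp
  qed (use first in \<open>simp add: no_output_def\<close>)
  have step: "\<exists>U \<sigma>'. run I nxt_prog \<sigma> U \<sigma>' \<and> U \<le> 100 * (shortest_length D A s t * nfa_size A + 1) \<and>
      (if Suc i < length ?ws then outputs P \<sigma>' (?ws ! Suc i) else no_output \<sigma>')"
    if i: "i < length ?ws" and \<sigma>: "data \<sigma> = data \<sigma>\<^sub>0 \<and> outputs P \<sigma> (?ws ! i)" for i \<sigma>
  proof -
    have il: "i < length ess"
      using i by simp
    obtain U \<sigma>' where U: "run I nxt_prog \<sigma> U \<sigma>'" "U \<le> 2 + shortest * (66 + 32 * length sl + 15 * nD)"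
      "if Suc i < length ess then holds (ess ! Suc i) \<sigma>' else reg \<sigma>' 0 = 0"
      using nxt[OF il, of \<sigma>] \<sigma> out[OF il] unfolding triple_def by blast
    \<comment> \<open>There is an output, hence a final state, hence \<open>length sl\<close> is
      positive and absorbs the 66: 66 + 32 = 98. The remaining 2 steps fit into the constant
      100.\<close>
    have "matching (ess ! i)"
      using nth_mem[OF il] ess(2) by simp
    then obtain j where "j < nfin"
      unfolding matching_def by blast
    from fin[OF this] have "0 < nQ"
      by (rule le_less_trans[OF le0])
    then have "0 < length sl"
      by simp
    then obtain m where "length sl = Suc m"
      using gr0_implies_Suc by blast
    then have "66 + 32 * length sl + 15 * nD \<le> 98 * nfa_size A"
      unfolding nfa_size_eq by (simp only:) simp
    then have "shortest * (66 + 32 * length sl + 15 * nD) \<le> shortest * (98 * nfa_size A)"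
      by (rule mult_le_mono2)
    then have "U \<le> 2 + shortest * (98 * nfa_size A)"
      using U(2) by linarith
    also have "\<dots> \<le> 100 * (shortest_length D A s t * nfa_size A + 1)"
      unfolding shortest_eq by simp
    finally have "U \<le> 100 * (shortest_length D A s t * nfa_size A + 1)" .
    moreover have "if Suc i < length ?ws then outputs P \<sigma>' (?ws ! Suc i) else no_output \<sigma>'"
      using U(3) out[of "Suc i" \<sigma>'] by (simp add: no_output_def del: nth_map)
    ultimately show ?thesis
      using U(1) by blast
  qed
  have "\<forall>i<length ?ws. \<forall>\<sigma>. data \<sigma> = data \<sigma>\<^sub>0 \<and> outputs P \<sigma> (?ws ! i) \<longrightarrow>
      (\<exists>U \<sigma>'. run I nxt_prog \<sigma> U \<sigma>' \<and> U \<le> 100 * (shortest_length D A s t * nfa_size A + 1) \<and>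
        (if Suc i < length ?ws then outputs P \<sigma>' (?ws ! Suc i) else no_output \<sigma>'))"
    using step by (intro allI impI)
  then show ?thesis
    unfolding memoryless_enumeration_def
    by - (rule conjI[OF preserves_data_nxt], rule exI[of _ ?ws], rule conjI[OF distinct], rule conjI[OF set],
      rule exI[of _ T], rule exI[of _ \<sigma>\<^sub>0], rule conjI[OF run(1)], rule conjI[OF time], rule conjI[OF out_first])
qed

end

theorem theorem4p1:
  shows "\<exists>pre nxt C. \<forall>(D :: ('v, 'e, 'a) database) (A :: ('q, 'a) nfa) s t P.
    database D \<and> nfa A \<and> nfa_alph A = db_alph D \<and> s \<in> verts D \<and> t \<in> verts D \<and> presents P D A \<longrightarrow>
    memoryless_enumeration (instance_input P D s t) (outputs P) pre nxt
      (distinct_shortest_walks D A s t)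
      (C * (db_size D * nfa_size A + 1))
      (C * (shortest_length D A s t * nfa_size A + 1))"
proof (rule exI[of _ pre_prog], rule exI[of _ nxt_prog], rule exI[of _ 100], intro allI impI)
  fix D :: "('v, 'e, 'a) database" and A :: "('q, 'a) nfa" and s t P
  assume "database D \<and> nfa A \<and> nfa_alph A = db_alph D \<and> s \<in> verts D \<and> t \<in> verts D \<and> presents P D A"
  then interpret presented D A s t P
    by unfold_locales auto
  show "memoryless_enumeration (instance_input P D s t) (outputs P) pre_prog nxt_prog
      (distinct_shortest_walks D A s t)
      (100 * (db_size D * nfa_size A + 1))
      (100 * (shortest_length D A s t * nfa_size A + 1))"
    by (rule memoryless)
qed

end
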